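(* Let $G$ be a finite nonabelian group with $V_2<G'=G_2$ (proper containment). Then $G/V_2$ is a VZ-group with $V(G/V_2)=V_1/V_2$. In particular, $G/V_1$ and $G'/V_2$ are elementary abelian $p$-groups for some prime $p$, and there exist positive integers $m\le n$ so that $|G:V_1|=p^{2n}$ and $|G':V_2|=p^m$. In addition, $\mathrm{cd}(G/V_2)=\{1,p^n\}$.
   Context: For a finite group $G$, $\mathrm{nl}(G)$ is the set of irreducible complex characters of $G$ of degree greater than $1$, and $\mathrm{cd}(G)$ is the set of degrees of irreducible complex characters of $G$. For a nonabelian finite group $G$, $V(G)=\langle g\in G \mid \text{there exists } \chi\in\mathrm{nl}(G) \text{ such that } \chi(g)\neq 0\rangle$. Set $V_1=V_1(G)=V(G)$ and $V_i=V_i(G)=[V_{i-1}(G),G]$ for $i\ge 2$. The lower central series is $G_1=G$, $G_i=[G_{i-1},G]$; $G'=G_2$. A (nonabelian) group is a VZ-group if all its nonlinear irreducible characters vanish off the center, equivalently if $V(G)=\mathbf{Z}(G)$. *)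

theory Defs
  imports
    "HOL-Algebra.Algebra"
    "HOL-Computational_Algebra.Primes"
    "Jordan_Normal_Form.VS_Connect"
begin

section \<open>Complex representations and characters\<close>

definition GL :: "nat \<Rightarrow> complex mat monoid" where
  "GL n = units_of (ring_mat TYPE(complex) n ())"

definition representation ::
  "('a, 'b) monoid_scheme \<Rightarrow> nat \<Rightarrow> ('a \<Rightarrow> complex mat) \<Rightarrow> bool" where
  "representation G n \<rho> \<longleftrightarrow> \<rho> \<in> hom G (GL n)"

text \<open>The zero-dimensional representation is not irreducible. Since the name subspace is hidden
  by the imported theory, its qualified form is used.\<close>

definition irreducible_representation ::
  "('a, 'b) monoid_scheme \<Rightarrow> nat \<Rightarrow> ('a \<Rightarrow> complex mat) \<Rightarrow> bool" where
  "irreducible_representation G n \<rho> \<longleftrightarrow>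
     representation G n \<rho> \<and> 0 < n \<and>
     (\<forall>W. VectorSpace.subspace class_ring W (module_vec TYPE(complex) n) \<and>
          (\<forall>g\<in>carrier G. \<forall>w\<in>W. \<rho> g *\<^sub>v w \<in> W) \<longrightarrow>
          W = {0\<^sub>v n} \<or> W = carrier_vec n)"

definition mat_trace :: "complex mat \<Rightarrow> complex" where
  "mat_trace A = (\<Sum>i<dim_row A. A $$ (i, i))"

text \<open>Characters are restricted to the carrier, so that each of them is represented by exactly
  one function.\<close>

definition Irr :: "('a, 'b) monoid_scheme \<Rightarrow> ('a \<Rightarrow> complex) set" where
  "Irr G = {\<lambda>g\<in>carrier G. mat_trace (\<rho> g) | \<rho>. \<exists>n. irreducible_representation G n \<rho>}"

definition char_degree :: "('a, 'b) monoid_scheme \<Rightarrow> ('a \<Rightarrow> complex) \<Rightarrow> nat" where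
  "char_degree G \<chi> = (THE d. \<chi> \<one>\<^bsub>G\<^esub> = of_nat d)"

lemma char_degree_eq:
  assumes "group G" "representation G n \<rho>"
  shows "char_degree G (\<lambda>g\<in>carrier G. mat_trace (\<rho> g)) = n"
proof -
  interpret group G by fact
  interpret R: ring "ring_mat TYPE(complex) n ()" by (rule ring_mat)
  have "group (GL n)" unfolding GL_def by (rule R.units_group)
  then have "\<rho> \<one>\<^bsub>G\<^esub> = \<one>\<^bsub>GL n\<^esub>"
    using assms hom_one unfolding representation_def by blast
  also have "\<dots> = 1\<^sub>m n" by (simp add: GL_def units_of_def ring_mat_def)
  finally have "mat_trace (\<rho> \<one>\<^bsub>G\<^esub>) = of_nat n" by (simp add: mat_trace_def)
  then show ?thesis by (simp add: char_degree_def)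
qed

definition nl :: "('a, 'b) monoid_scheme \<Rightarrow> ('a \<Rightarrow> complex) set" where
  "nl G = {\<chi> \<in> Irr G. 1 < char_degree G \<chi>}"

definition cd :: "('a, 'b) monoid_scheme \<Rightarrow> nat set" where
  "cd G = char_degree G ` Irr G"


section \<open>The vanishing-off subgroup and VZ-groups\<close>

definition V :: "('a, 'b) monoid_scheme \<Rightarrow> 'a set" where
  "V G = generate G {g \<in> carrier G. \<exists>\<chi>\<in>nl G. \<chi> g \<noteq> 0}"

definition center :: "('a, 'b) monoid_scheme \<Rightarrow> 'a set" where
  "center G = {z \<in> carrier G. \<forall>g\<in>carrier G. z \<otimes>\<^bsub>G\<^esub> g = g \<otimes>\<^bsub>G\<^esub> z}"

definition VZ_group :: "('a, 'b) monoid_scheme \<Rightarrow> bool" where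
  "VZ_group G \<longleftrightarrow> group G \<and> finite (carrier G) \<and> \<not> comm_group G \<and>
     (\<forall>\<chi>\<in>nl G. \<forall>g\<in>carrier G - center G. \<chi> g = 0)"


section \<open>Commutator subgroups\<close>

definition commutator_subgroup ::
  "('a, 'b) monoid_scheme \<Rightarrow> 'a set \<Rightarrow> 'a set \<Rightarrow> 'a set" where
  "commutator_subgroup G H K =
     generate G (\<Union>h\<in>H. \<Union>k\<in>K. {h \<otimes>\<^bsub>G\<^esub> k \<otimes>\<^bsub>G\<^esub> inv\<^bsub>G\<^esub> h \<otimes>\<^bsub>G\<^esub> inv\<^bsub>G\<^esub> k})"

text \<open>The next two series start at the index 1; their values at 0 have no meaning.\<close>

definition V_series :: "('a, 'b) monoid_scheme \<Rightarrow> nat \<Rightarrow> 'a set" where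
  "V_series G i = ((\<lambda>H. commutator_subgroup G H (carrier G)) ^^ (i - 1)) (V G)"

definition lower_central :: "('a, 'b) monoid_scheme \<Rightarrow> nat \<Rightarrow> 'a set" where
  "lower_central G i = ((\<lambda>H. commutator_subgroup G H (carrier G)) ^^ (i - 1)) (carrier G)"

lemma V_series_1: "V_series G 1 = V G"
  by (simp add: V_series_def)

lemma V_series_step:
  "2 \<le> i \<Longrightarrow> V_series G i = commutator_subgroup G (V_series G (i - 1)) (carrier G)"
  by (cases i; cases "i - 1") (auto simp: V_series_def)

lemma lower_central_2: "lower_central G 2 = derived G (carrier G)"
  by (simp add: lower_central_def commutator_subgroup_def derived_def)


section \<open>Elementary abelian groups\<close>

definition elementary_abelian :: "nat \<Rightarrow> ('a, 'b) monoid_scheme \<Rightarrow> bool" where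
  "elementary_abelian p G \<longleftrightarrow> Factorial_Ring.prime p \<and> comm_group G \<and> finite (carrier G) \<and>
     (\<forall>x\<in>carrier G. x [^]\<^bsub>G\<^esub> p = \<one>\<^bsub>G\<^esub>)"

end

theory Submission
  imports Defs "Jordan_Normal_Form.Spectral_Radius" "HOL-Number_Theory.Residues"
begin

text \<open>Nonlinear irreducible characters of \<open>Q = G / V\<^sub>2\<close> inflate to \<open>G\<close>, so they vanish off \<open>V\<^sub>1 / V\<^sub>2\<close>, which is
  central in \<open>Q\<close>; hence \<open>Q\<close> is a VZ-group. A derived element of \<open>Q\<close> outside the center would have as
  trace in the regular representation the number of linear constituents, which is positive; so
  \<open>Q' \<le> Z(Q)\<close>. For \<open>x\<close> not central and \<open>u \<in> Q'\<close> the elements \<open>x\<close> and \<open>x u\<close> have the same irreducible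
  characters and are therefore conjugate, which means that \<open>y \<mapsto> [x, y]\<close> is a homomorphism onto \<open>Q'\<close>.
  This forces \<open>Q'\<close> and \<open>Q / Z(Q)\<close> to be elementary abelian for one prime \<open>p\<close>, and the norm of a nonlinear
  irreducible character gives \<open>\<chi>(1)\<^sup>2 = |Q : Z(Q)| = p\<^sup>2\<^sup>n\<close>. Finally the commutator map yields an
  \<open>m\<close>-dimensional space of alternating forms in \<open>2n\<close> variables over the field with \<open>p\<close> elements, all of
  whose nonzero members are nonsingular, and such a space has \<open>m \<le> n\<close>.\<close>

text \<open>Properness of the inclusion of \<open>V2\<close> in \<open>G'\<close> makes
  \<open>Q\<close> nonabelian, and \<open>V2 = [V1, G]\<close> makes the image of \<open>V1\<close>
  central. That image is the whole center, because a central element acts by an invertible scalar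
  and so no nonlinear character vanishes at it. The hard point is \<open>m <= n\<close>. The
  Pfaffian of the forms is a polynomial of degree \<open>n\<close> in \<open>m\<close> variables
  that vanishes modulo \<open>p\<close> only at the origin, so Chevalley's theorem would give the
  bound. Its power \<open>p - 1\<close> is the power \<open>(p - 1) / 2\<close> of the determinant,
  which serves for odd \<open>p\<close>; for \<open>p = 2\<close> that exponent is not an integer,
  and Gauss sums of quadratic forms take over. The prime is only found inside the proof, so vectors
  and matrices over the field with \<open>p\<close> elements are represented by integers and
  congruences. In return the matrices can be taken exactly alternating over the integers. The
  separation of conjugacy classes and the existence of a nonlinear representation rest on one fact
  about the group algebra: an element that acts as zero in every irreducible representation is
  zero.\<close>

section \<open>Spaces of nonsingular alternating forms over prime fields\<close>

lemma prime_dvd_power_sum: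
  fixes p e :: nat
  assumes p: "Factorial_Ring.prime p" and e: "e < p - 1"
  shows "int p dvd (\<Sum>t<p. int t ^ e)"
  using e
proof (induction e rule: less_induct)
  case (less e)
  define S where "S j = (\<Sum>t<p. int t ^ j)" for j
  \<comment> \<open>Summing this difference over \<open>t < p\<close> telescopes to
    \<open>p^(e+1)\<close>. By induction the lower power sums vanish modulo \<open>p\<close>, and
    the coefficient \<open>e + 1\<close> of the top one is below \<open>p\<close>, hence
    invertible.\<close>
  have step: "int (Suc t) ^ Suc e - int t ^ Suc e = (\<Sum>k\<le>e. int (Suc e choose k) * int t ^ k)" for t
    using binomial_ring[of "int t" 1 "Suc e"] by (simp add: algebra_simps)
  have "int p ^ Suc e = (\<Sum>t<p. int (Suc t) ^ Suc e - int t ^ Suc e)"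
    using sum_lessThan_telescope[of "\<lambda>t. int t ^ Suc e" p] by simp
  also have "\<dots> = (\<Sum>k\<le>e. int (Suc e choose k) * S k)"
    by (simp only: step S_def sum_distrib_left, rule sum.swap)
  also have "\<dots> = (\<Sum>k<e. int (Suc e choose k) * S k) + int (Suc e) * S e"
    by (simp add: lessThan_Suc_atMost[symmetric])
  finally have eq: "int (Suc e) * S e = int p ^ Suc e - (\<Sum>k<e. int (Suc e choose k) * S k)"
    by simp
  have "int p dvd int (Suc e) * S e"
    unfolding eq
  proof (rule dvd_diff)
    show "int p dvd (\<Sum>k<e. int (Suc e choose k) * S k)"
      using less by (intro dvd_sum dvd_mult) (auto simp: S_def)
  qed simp
  moreover have "\<not> int p dvd int (Suc e)"
    using less.prems by (auto simp only: of_nat_dvd_iff dest!: dvd_imp_le)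
  ultimately show ?case
    using p by (simp add: prime_dvd_mult_iff S_def del: of_nat_Suc)
qed

text \<open>These are the polynomial functions of total degree at most \<open>d\<close> in the
  variables \<open>l 0, ..., l (m - 1)\<close>. Describing functions instead of formal polynomials
  allows a determinant that depends on \<open>l\<close> to be treated directly.\<close>

inductive bounded_degree :: "nat \<Rightarrow> nat \<Rightarrow> ((nat \<Rightarrow> int) \<Rightarrow> int) \<Rightarrow> bool" for m where
  monomial: "(\<Sum>k<m. e k) \<le> d \<Longrightarrow> bounded_degree m d (\<lambda>l. c * (\<Prod>k<m. l k ^ e k))"
| add: "bounded_degree m d f \<Longrightarrow> bounded_degree m d g \<Longrightarrow> bounded_degree m d (\<lambda>l. f l + g l)"

lemma bounded_degree_const: "bounded_degree m d (\<lambda>l. c)"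
  using bounded_degree.monomial[of "\<lambda>_. 0" m d c] by simp

lemma bounded_degree_mult:
  assumes "bounded_degree m d f" "bounded_degree m d' g"
  shows "bounded_degree m (d + d') (\<lambda>l. f l * g l)"
  using assms(1)
proof induction
  case (monomial e d c)
  show ?case using assms(2)
  proof induction
    case (monomial e' d' c')
    have "bounded_degree m (d + d') (\<lambda>l. (c * c') * (\<Prod>k<m. l k ^ (e k + e' k)))"
      using monomial \<open>sum e {..<m} \<le> d\<close> by (intro bounded_degree.monomial) (simp add: sum.distrib)
    then show ?case by (simp add: power_add prod.distrib mult_ac)
  next
    case (add d' f g)
    then show ?case by (simp add: distrib_left bounded_degree.add)
  qed
next
  case (add d f g)
  then show ?case by (simp add: distrib_right bounded_degree.add)
qed

lemma bounded_degree_sum: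
  assumes "\<And>i. i \<in> I \<Longrightarrow> bounded_degree m d (f i)"
  shows "bounded_degree m d (\<lambda>l. \<Sum>i\<in>I. f i l)"
proof (cases "finite I")
  case True
  then show ?thesis using assms
    by induction (auto intro: bounded_degree_const bounded_degree.add)
qed (simp add: bounded_degree_const)

lemma bounded_degree_prod:
  assumes "finite I" "\<And>i. i \<in> I \<Longrightarrow> bounded_degree m d (f i)"
  shows "bounded_degree m (card I * d) (\<lambda>l. \<Prod>i\<in>I. f i l)"
  using assms by induction (auto intro: bounded_degree_const bounded_degree_mult)

lemma bounded_degree_linear: "bounded_degree m 1 (\<lambda>l. \<Sum>k<m. l k * c k)"
proof (rule bounded_degree_sum)
  fix k assume k: "k \<in> {..<m}"
  have "bounded_degree m 1 (\<lambda>l. c k * (\<Prod>j<m. l j ^ (if j = k then 1 else 0)))"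
    using k by (intro bounded_degree.monomial) simp
  moreover have "(\<Prod>j<m. l j ^ (if j = k then 1 else 0)) = l k" for l :: "nat \<Rightarrow> int"
    using k by (simp add: if_distrib[of "\<lambda>e. _ ^ e"] cong: if_cong)
  ultimately show "bounded_degree m 1 (\<lambda>l. l k * c k)" by (simp add: mult.commute)
qed

text \<open>The Chevalley-Warning count. A monomial of degree below \<open>m * (p - 1)\<close> has a
  variable with exponent below \<open>p - 1\<close> (possibly \<open>0\<close>), and its sum over
  the grid factors into power sums, one of which is divisible by \<open>p\<close>.\<close>

lemma prime_dvd_sum_bounded_degree:
  fixes p :: nat
  assumes p: "Factorial_Ring.prime p" and f: "bounded_degree m d f" and d: "d < m * (p - 1)"
  shows "int p dvd (\<Sum>l\<in>{..<m} \<rightarrow>\<^sub>E int ` {..<p}. f l)"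
  using f d
proof induction
  case (monomial e d c)
  have "\<exists>k<m. e k < p - 1"
  proof (rule ccontr)
    assume "\<not> (\<exists>k<m. e k < p - 1)"
    then have "(\<Sum>k<m. p - 1) \<le> (\<Sum>k<m. e k)" by (intro sum_mono) auto
    then show False using monomial by simp
  qed
  then obtain k where k: "k < m" "e k < p - 1" by blast
  have "(\<Sum>l\<in>{..<m} \<rightarrow>\<^sub>E int ` {..<p}. \<Prod>k<m. l k ^ e k) = (\<Prod>k<m. \<Sum>t\<in>int ` {..<p}. t ^ e k)"
    by (subst prod_sum_PiE) auto
  also have "\<dots> = (\<Prod>k<m. \<Sum>t<p. int t ^ e k)"
    by (simp add: sum.reindex)
  also have "int p dvd \<dots>"
    using prime_dvd_power_sum[OF p k(2)] k(1) by (intro dvd_prodI[THEN dvd_trans[rotated]]) auto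
  finally show ?case by (simp add: sum_distrib_left[symmetric])
next
  case (add d f g)
  then show ?case by (simp add: sum.distrib)
qed

section \<open>Determinants of alternating matrices\<close>

text \<open>Elimination by blocks of size 2. A nonzero entry \<open>a\<close> of the first row is
  moved next to the diagonal, the corner block it spans has determinant \<open>a^2\<close>, and the
  remainder is alternating of size \<open>N - 2\<close>. The zero diagonal is a separate condition
  since antisymmetry does not imply it in characteristic 2.\<close>

lemma det_alternating_square:
  fixes A :: "'a :: field mat"
  assumes "A \<in> carrier_mat N N"
    and "\<And>i j. i < N \<Longrightarrow> j < N \<Longrightarrow> A $$ (i, j) = - A $$ (j, i)"
    and "\<And>i. i < N \<Longrightarrow> A $$ (i, i) = 0"
  shows "\<exists>c. det A = c\<^sup>2"
  using assms
proof (induction N arbitrary: A rule: less_induct)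
  case (less N)
  note A = less.prems
  show ?case
  proof (cases "det A = 0")
    case True
    then show ?thesis by (intro exI[of _ 0]) simp
  next
    case False
    show ?thesis
    proof (cases "N = 0")
      case True
      then show ?thesis using A(1) by (intro exI[of _ 1]) (simp add: det_def)
    next
      case N: False
      have "\<exists>k<N. A $$ (0, k) \<noteq> 0"
      proof (rule ccontr)
        assume *: "\<not> (\<exists>k<N. A $$ (0, k) \<noteq> 0)"
        have "(\<Prod>i = 0..<N. A $$ (i, \<pi> i)) = 0" if "\<pi> permutes {0..<N}" for \<pi>
          using that * N permutes_in_image[OF that, of 0]
          by (intro prod_zero bexI[of _ 0]) auto
        then have "det A = 0"
          unfolding det_def'[OF A(1)] by (intro sum.neutral) simp
        then show False using False by simp
      qed
      then obtain k where k: "k < N" "A $$ (0, k) \<noteq> 0" by blast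
      have "k \<noteq> 0" using k A(3)[of 0] by (cases "k = 0") simp_all
      define M where "M = N - 2"
      have NM: "N = 2 + M" using k \<open>k \<noteq> 0\<close> unfolding M_def by simp
      \<comment> \<open>Rows and columns \<open>1\<close> and \<open>k\<close> are exchanged
        together. This preserves alternation, and the two sign changes of the determinant
        cancel.\<close>
      define s where "s i = (if i = 1 then k else if i = k then 1 else i)" for i
      define A' where "A' = mat N N (\<lambda>(i, j). A $$ (s i, s j))"
      have s: "s i < N" if "i < N" for i using that k NM by (auto simp: s_def)
      have A': "A' \<in> carrier_mat N N" by (simp add: A'_def)
      have detA': "det A' = det A"
      proof (cases "k = 1")
        case True
        then have "A' = A" using A(1) by (auto simp: A'_def s_def)
        then show ?thesis by simp
      next
        case False
        have "A' = swapcols 1 k (swaprows 1 k A)"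
          using A(1) k NM by (intro eq_matI) (auto simp: A'_def s_def)
        also have "det \<dots> = det A"
          using A(1) k NM False by (simp add: det_swapcols[of _ N] det_swaprows[of _ N])
        finally show ?thesis .
      qed
      have alt: "A' $$ (i, j) = - A' $$ (j, i)" "A' $$ (i, i) = 0" if "i < N" "j < N" for i j
        using that s[of i] s[of j] A(2)[of "s i" "s j"] A(3)[of "s i"] by (auto simp: A'_def)
      define a where "a = A' $$ (0, 1)"
      have a: "a \<noteq> 0" using k \<open>k \<noteq> 0\<close> NM by (auto simp: a_def A'_def s_def)
      define J where "J = mat 2 2 (\<lambda>(i, j). A' $$ (i, j))"
      define B where "B = mat 2 M (\<lambda>(i, j). A' $$ (i, j + 2))"
      define C where "C = mat M 2 (\<lambda>(i, j). A' $$ (i + 2, j))"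
      define D where "D = mat M M (\<lambda>(i, j). A' $$ (i + 2, j + 2))"
      \<comment> \<open>\<open>- C\<close> times the inverse of \<open>J\<close>\<close>
      define Y where "Y = mat M 2 (\<lambda>(i, j). if j = 0 then - A' $$ (i + 2, 1) / a else A' $$ (i + 2, 0) / a)"
      have carr: "J \<in> carrier_mat 2 2" "B \<in> carrier_mat 2 M" "C \<in> carrier_mat M 2"
        "D \<in> carrier_mat M M" "Y \<in> carrier_mat M 2"
        by (auto simp: J_def B_def C_def D_def Y_def)
      have J10: "A' $$ (Suc 0, 0) = - a" "A' $$ (0, Suc 0) = a"
        "A' $$ (0, 0) = 0" "A' $$ (Suc 0, Suc 0) = 0"
        using alt[of 0 1] alt[of 1 0] NM by (auto simp: a_def)
      have "Suc (Suc (i - 2)) = i" if "\<not> i < 2" for i :: nat using that by simp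
      then have A'_blocks: "A' = four_block_mat J B C D"
        using A' carr NM by (intro eq_matI) (auto simp: J_def B_def C_def D_def)
      \<comment> \<open>The Schur complement \<open>D - C J^-1 B\<close>. Multiplication by the
        unipotent matrix with block \<open>Y\<close> clears \<open>C\<close> and leaves
        \<open>S\<close> in the corner.\<close>
      define S where "S = Y * B + D"
      have S: "S \<in> carrier_mat M M" using carr by (simp add: S_def)
      have YJ: "Y * J + C = 0\<^sub>m M 2"
        using carr a J10
        by (intro eq_matI) (auto simp: Y_def J_def C_def scalar_prod_def numeral_2_eq_2 less_Suc_eq)
      have "four_block_mat (1\<^sub>m 2) (0\<^sub>m 2 M) Y (1\<^sub>m M) * A' = four_block_mat J B (0\<^sub>m M 2) S"
        unfolding A'_blocks
        using carr YJ by (subst mult_four_block_mat) (auto simp: S_def)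
      moreover have "det (four_block_mat (1\<^sub>m 2) (0\<^sub>m 2 M) Y (1\<^sub>m M) * A') =
          det (four_block_mat (1\<^sub>m 2) (0\<^sub>m 2 M) Y (1\<^sub>m M)) * det A'"
        using carr A' NM by (intro det_mult[of _ N]) auto
      moreover have "det (four_block_mat J B (0\<^sub>m M 2) S) = det J * det S"
        using carr S by (intro det_four_block_mat_lower_left_zero[of _ 2 _ M]) auto
      moreover have "det (four_block_mat (1\<^sub>m 2) (0\<^sub>m 2 M) Y (1\<^sub>m M)) = 1"
        using carr by (subst det_four_block_mat_upper_right_zero[of _ 2 _ M]) auto
      moreover have "det J = a\<^sup>2"
      proof -
        have "upper_triangular (swaprows 0 1 J)"
          using J10 by (auto simp: J_def less_Suc_eq numeral_2_eq_2)
        then have "det (swaprows 0 1 J) = prod_list (diag_mat (swaprows 0 1 J))"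
          using carr by (intro det_upper_triangular[of _ 2]) auto
        also have "\<dots> = - a\<^sup>2"
          using J10 by (simp add: diag_mat_def J_def numeral_2_eq_2 power2_eq_square)
        finally show ?thesis
          using carr det_swaprows[of 0 2 1 J] by simp
      qed
      ultimately have detA: "det A = a\<^sup>2 * det S" using detA' by simp
      have "\<exists>c. det S = c\<^sup>2"
      proof (rule less.IH[OF _ S])
        have Sij: "S $$ (i, j) = (A' $$ (i + 2, 0) * A' $$ (1, j + 2)
            - A' $$ (i + 2, 1) * A' $$ (0, j + 2)) / a + A' $$ (i + 2, j + 2)"
          if "i < M" "j < M" for i j
          using that carr
          by (simp add: S_def Y_def B_def D_def scalar_prod_def numeral_2_eq_2 field_simps diff_divide_distrib add_divide_distrib)
        show "S $$ (i, j) = - S $$ (j, i)" if "i < M" "j < M" for i j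
          using that a NM alt(1)[of "i + 2" 0] alt(1)[of "i + 2" 1] alt(1)[of "j + 2" 0]
            alt(1)[of "j + 2" 1] alt(1)[of "i + 2" "j + 2"]
          by (simp add: Sij field_simps)
        show "S $$ (i, i) = 0" if "i < M" for i
          using that a NM alt(1)[of "i + 2" 0] alt(1)[of "i + 2" 1] alt(2)[of "i + 2" "i + 2"]
          by (simp add: Sij field_simps)
      qed (use NM in simp)
      then show ?thesis
        unfolding detA by (auto simp flip: power_mult_distrib)
    qed
  qed
qed

text \<open>A rational square root of an integer is an integer: in lowest terms \<open>u / v\<close>
  the denominator must be a unit. An integer root can be reduced modulo \<open>p\<close>.\<close>

lemma det_alternating_square_int:
  fixes A :: "int mat"
  assumes A: "A \<in> carrier_mat N N"
    and alt: "\<And>i j. i < N \<Longrightarrow> j < N \<Longrightarrow> A $$ (i, j) = - A $$ (j, i)"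
    and diag: "\<And>i. i < N \<Longrightarrow> A $$ (i, i) = 0"
  shows "\<exists>c. det A = c\<^sup>2"
proof -
  interpret of_int_hom: comm_ring_hom "of_int :: int \<Rightarrow> rat" by standard auto
  have "\<exists>c. det (map_mat rat_of_int A) = c\<^sup>2"
  proof (rule det_alternating_square[of _ N])
    fix i j assume "i < N" "j < N"
    then show "map_mat rat_of_int A $$ (i, j) = - map_mat rat_of_int A $$ (j, i)"
      using A alt[of i j] by simp
  qed (use A diag in auto)
  then obtain c where "rat_of_int (det A) = c\<^sup>2" by auto
  moreover obtain u v where q: "quotient_of c = (u, v)"
    by (cases "quotient_of c")
  then have uv: "c = of_int u / of_int v" "v > 0" "coprime u v"
    by (auto dest: quotient_of_div quotient_of_denom_pos quotient_of_coprime)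
  ultimately have "rat_of_int (det A) * (of_int v)\<^sup>2 = (of_int u)\<^sup>2"
    by (simp add: power_divide)
  then have "rat_of_int (det A * v\<^sup>2) = rat_of_int (u\<^sup>2)" by simp
  then have eq: "det A * v\<^sup>2 = u\<^sup>2" by (simp only: of_int_eq_iff)
  have "v dvd det A * v\<^sup>2" by (simp add: power2_eq_square)
  then have "v dvd u\<^sup>2" unfolding eq .
  moreover have "coprime v (u\<^sup>2)" using uv by (simp add: coprime_commute)
  ultimately have "is_unit v" using coprime_common_divisor[of v "u\<^sup>2" v] by simp
  then have "v = 1" using uv by simp
  then show ?thesis using eq by (intro exI[of _ u]) simp
qed

lemma det_cong:
  fixes A B :: "int mat"
  assumes A: "A \<in> carrier_mat N N" and B: "B \<in> carrier_mat N N"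
    and AB: "\<And>i j. i < N \<Longrightarrow> j < N \<Longrightarrow> [A $$ (i, j) = B $$ (i, j)] (mod q)"
  shows "[det A = det B] (mod q)"
  unfolding det_def'[OF A] det_def'[OF B]
proof (intro cong_sum cong_mult cong_refl cong_prod)
  fix \<pi> i assume "\<pi> \<in> {\<pi>. \<pi> permutes {0..<N}}" "i \<in> {0..<N}"
  then show "[A $$ (i, \<pi> i) = B $$ (i, \<pi> i)] (mod q)"
    using permutes_in_image[of \<pi> "{0..<N}" i] by (intro AB) auto
qed

section \<open>Systems of alternating forms and their determinants\<close>

text \<open>For fixed \<open>k\<close> the integers \<open>a i j k\<close> represent an alternating matrix modulo \<open>p\<close>; every nonzero
  linear combination of these \<open>m\<close> matrices is nonsingular.\<close>

locale alternating_forms =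
  fixes p n m N :: nat and a :: "nat \<Rightarrow> nat \<Rightarrow> nat \<Rightarrow> int"
  assumes prime_p: "Factorial_Ring.prime p" and n_pos: "0 < n" and N: "N = 2 * n"
    and alternating: "\<And>i j k. a i j k = - a j i k"
    and nondegenerate: "\<And>x l. \<exists>i<N. \<not> int p dvd x i \<Longrightarrow> \<exists>k<m. \<not> int p dvd l k \<Longrightarrow>
      \<exists>j<N. \<not> int p dvd (\<Sum>i<N. x i * (\<Sum>k<m. l k * a i j k))"
begin

definition form :: "(nat \<Rightarrow> int) \<Rightarrow> nat \<Rightarrow> nat \<Rightarrow> int" where
  "form l i j = (\<Sum>k<m. l k * a i j k)"

lemma form_alt: "form l i j = - form l j i"
  unfolding form_def sum_negf[symmetric] by (intro sum.cong refl, subst alternating) simp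

text \<open>Antisymmetry is an equality of integers here, so \<open>2 * form l i i = 0\<close> gives
  a zero diagonal even when \<open>p = 2\<close>.\<close>

lemma form_diag: "form l i i = 0"
  using form_alt[of l i i] by simp

lemma p_gt_1: "1 < p"
  using prime_p by (rule prime_gt_1_nat)

definition form_mat :: "(nat \<Rightarrow> int) \<Rightarrow> int mat" where
  "form_mat l = mat N N (\<lambda>(i, j). form l i j)"

lemma form_mat: "form_mat l \<in> carrier_mat N N"
  by (simp add: form_mat_def)

definition vectors :: "nat \<Rightarrow> (nat \<Rightarrow> int) set" where
  "vectors d = {..<d} \<rightarrow>\<^sub>E {0..<int p}"

lemma finite_vectors: "finite (vectors d)"
  by (simp add: vectors_def finite_PiE)

lemma card_vectors: "card (vectors d) = p ^ d"
  by (simp add: vectors_def card_PiE)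

lemma vectors_eqI:
  assumes "x \<in> vectors d" "y \<in> vectors d" "\<And>i. i < d \<Longrightarrow> [x i = y i] (mod int p)"
  shows "x = y"
proof (rule PiE_ext)
  show "x \<in> {..<d} \<rightarrow>\<^sub>E {0..<int p}" "y \<in> {..<d} \<rightarrow>\<^sub>E {0..<int p}"
    using assms by (auto simp: vectors_def)
  fix i assume i: "i \<in> {..<d}"
  then have "x i \<in> {0..<int p}" "y i \<in> {0..<int p}"
    using assms(1,2) unfolding vectors_def by (blast intro: PiE_mem)+
  then show "x i = y i" using assms(3)[of i] i by (simp add: Cong.cong_def)
qed

text \<open>Nondegeneracy makes the linear map of the matrix injective on the finite set of vectors
  modulo \<open>p\<close>, hence onto. Preimages of the unit vectors are the rows of a matrix
  \<open>Y\<close> that inverts it modulo \<open>p\<close>, so the determinant is a unit.\<close>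

lemma not_dvd_det_form_mat:
  assumes l: "\<exists>k<m. \<not> int p dvd l k"
  shows "\<not> int p dvd det (form_mat l)"
proof -
  define \<phi> where "\<phi> x = (\<lambda>j\<in>{..<N}. (\<Sum>i<N. x i * form l i j) mod int p)" for x
  have \<phi>: "\<phi> x \<in> vectors N" for x
    using p_gt_1 by (auto simp: \<phi>_def vectors_def)
  have "inj_on \<phi> (vectors N)"
  proof (rule inj_onI)
    fix x y assume xy: "x \<in> vectors N" "y \<in> vectors N" "\<phi> x = \<phi> y"
    have "int p dvd (\<Sum>i<N. (x i - y i) * form l i j)" if "j < N" for j
    proof -
      have "(\<Sum>i<N. x i * form l i j) mod int p = (\<Sum>i<N. y i * form l i j) mod int p"
        using fun_cong[OF xy(3), of j] that by (simp add: \<phi>_def)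
      then show ?thesis
        by (simp add: mod_eq_dvd_iff left_diff_distrib sum_subtractf)
    qed
    then have "int p dvd x i - y i" if "i < N" for i
      using nondegenerate[OF _ l, of "\<lambda>i. x i - y i"] that unfolding form_def by blast
    then show "x = y" using xy by (intro vectors_eqI) (auto simp: cong_iff_dvd_diff)
  qed
  then have surj: "\<phi> ` vectors N = vectors N"
    using \<phi> finite_vectors by (intro endo_inj_surj) auto
  have "\<exists>x. \<forall>j<N. [\<Sum>i<N. x i * form l i j = (if j = r then 1 else 0)] (mod int p)" for r
  proof -
    have "(\<lambda>j\<in>{..<N}. if j = r then 1 else 0) \<in> vectors N"
      using p_gt_1 by (auto simp: vectors_def)
    then have "(\<lambda>j\<in>{..<N}. if j = r then 1 else 0) \<in> \<phi> ` vectors N"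
      unfolding surj .
    then obtain x where x: "(\<lambda>j\<in>{..<N}. if j = r then 1 else 0) = \<phi> x"
      by (rule imageE)
    have "(\<Sum>i<N. x i * form l i j) mod int p = (if j = r then 1 else 0)" if "j < N" for j
      using fun_cong[OF x, of j] that by (simp add: \<phi>_def)
    then show ?thesis using p_gt_1 by (intro exI[of _ x]) (simp add: Cong.cong_def)
  qed
  then obtain y where y: "\<And>r j. j < N \<Longrightarrow>
      [\<Sum>i<N. y r i * form l i j = (if j = r then 1 else 0)] (mod int p)"
    by metis
  define Y where "Y = mat N N (\<lambda>(r, i). y r i)"
  have Y: "Y \<in> carrier_mat N N" by (simp add: Y_def)
  have "[det (Y * form_mat l) = det (1\<^sub>m N)] (mod int p)"
  proof (rule det_cong)
    fix i j assume ij: "i < N" "j < N"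
    then have "(Y * form_mat l) $$ (i, j) = (\<Sum>k<N. y i k * form l k j)"
      by (simp add: Y_def form_mat_def scalar_prod_def atLeast0LessThan)
    then show "[(Y * form_mat l) $$ (i, j) = 1\<^sub>m N $$ (i, j)] (mod int p)"
      using y[of j i] ij by (auto split: if_splits)
  qed (use Y form_mat[of l] in auto)
  then have "[det Y * det (form_mat l) = 1] (mod int p)"
    using Y form_mat[of l] by (simp add: det_mult[of _ N])
  then have dvd: "int p dvd det Y * det (form_mat l) - 1"
    by (simp add: cong_iff_dvd_diff)
  show ?thesis
  proof
    assume "int p dvd det (form_mat l)"
    then have "int p dvd det Y * det (form_mat l)" by simp
    then have "int p dvd det Y * det (form_mat l) - (det Y * det (form_mat l) - 1)"
      using dvd by (rule dvd_diff)
    also have "det Y * det (form_mat l) - (det Y * det (form_mat l) - 1) = 1" by simp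
    finally have "int p dvd 1" .
    then show False using p_gt_1 by simp
  qed
qed

lemma zero_vector: "(\<lambda>k\<in>{..<d}. 0) \<in> vectors d"
  using p_gt_1 by (auto simp: vectors_def)

lemma nonzero_vector:
  assumes "l \<in> vectors d" "l \<noteq> (\<lambda>k\<in>{..<d}. 0)"
  shows "\<exists>k<d. \<not> int p dvd l k"
proof (rule ccontr)
  assume "\<not> ?thesis"
  then have "l = (\<lambda>k\<in>{..<d}. 0)"
    using assms(1) zero_vector by (intro vectors_eqI) (auto simp: cong_iff_dvd_diff)
  then show False using assms(2) by simp
qed

lemma bounded_degree_det: "bounded_degree m N (\<lambda>l. det (form_mat l))"
proof -
  have eq: "det (form_mat l) = (\<Sum>\<pi> | \<pi> permutes {0..<N}.
      of_int (sign \<pi>) * (\<Prod>i = 0..<N. \<Sum>k<m. l k * a i (\<pi> i) k))" for l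
  proof -
    have "form_mat l $$ (i, \<pi> i) = (\<Sum>k<m. l k * a i (\<pi> i) k)"
      if "\<pi> permutes {0..<N}" "i \<in> {0..<N}" for \<pi> i
      using that permutes_in_image[of \<pi> "{0..<N}" i] by (auto simp: form_mat_def form_def)
    then show ?thesis
      unfolding det_def'[OF form_mat] by (intro sum.cong refl arg_cong2[where f = "(*)"] prod.cong) auto
  qed
  have "bounded_degree m (0 + card {0..<N} * 1) (\<lambda>l. of_int (sign \<pi>) * (\<Prod>i = 0..<N. \<Sum>k<m. l k * a i (\<pi> i) k))" for \<pi>
    by (intro bounded_degree_mult bounded_degree_const bounded_degree_prod bounded_degree_linear) simp
  then show ?thesis unfolding eq by (intro bounded_degree_sum) simp
qed

section \<open>The dimension bound for odd primes\<close>

text \<open>A Chevalley-Warning argument. The determinant of an alternating matrix is a square, so its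
  power \<open>(p - 1) / 2\<close> is \<open>1\<close> at every nonzero \<open>l\<close>, whereas its degree in \<open>l\<close> is only \<open>n * (p - 1)\<close>. The
  square root of the determinant (the Pfaffian) is never needed.\<close>

lemma dimension_bound_odd:
  assumes "odd p"
  shows "m \<le> n"
proof (rule ccontr)
  assume mn: "\<not> m \<le> n"
  define h where "h = (p - 1) div 2"
  have h: "2 * h = p - 1" "0 < h" using assms p_gt_1 by (auto simp: h_def elim!: oddE)
  define f where "f l = det (form_mat l) ^ h" for l
  have f1: "[f l = 1] (mod int p)" if l: "l \<in> vectors m - {\<lambda>k\<in>{..<m}. 0}" for l
  proof -
    have "\<exists>c. det (form_mat l) = c\<^sup>2"
    proof (rule det_alternating_square_int[OF form_mat])
      fix i j assume "i < N" "j < N"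
      then show "form_mat l $$ (i, j) = - form_mat l $$ (j, i)"
        by (simp add: form_mat_def form_alt[of l i j])
    qed (simp add: form_mat_def form_diag)
    then obtain c where c: "det (form_mat l) = c\<^sup>2" by blast
    have "\<not> int p dvd c\<^sup>2"
      using not_dvd_det_form_mat[OF nonzero_vector, of l] l c by simp
    then have "\<not> int p dvd c" by (auto simp: power2_eq_square)
    then have "\<not> p dvd nat \<bar>c\<bar>" by simp
    then have "[nat \<bar>c\<bar> ^ (p - 1) = 1] (mod p)" using prime_p by (rule fermat_theorem[rotated])
    then have "[\<bar>c\<bar> ^ (p - 1) = 1] (mod int p)"
      by (metis cong_int_iff of_nat_1 of_nat_power int_nat_eq abs_ge_zero)
    moreover have "f l = \<bar>c\<bar> ^ (p - 1)"
      unfolding f_def c h(1)[symmetric] by (simp add: power_mult)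
    ultimately show ?thesis by simp
  qed
  \<comment> \<open>Both \<open>0 < N\<close> and \<open>0 < h\<close> enter: an empty determinant
    and a zeroth power would be \<open>1\<close>.\<close>
  have f0: "f (\<lambda>k\<in>{..<m}. 0) = 0"
  proof -
    have "form_mat (\<lambda>k\<in>{..<m}. 0) = 0\<^sub>m N N"
      by (intro eq_matI) (auto simp: form_mat_def form_def)
    then show ?thesis using n_pos N h by (simp add: f_def det_zero)
  qed
  \<comment> \<open>Modulo \<open>p\<close> the sum counts the nonzero vectors, so it is
    \<open>-1\<close>; the degree bound will make it \<open>0\<close>.\<close>
  have "(\<Sum>l\<in>vectors m. f l) = (\<Sum>l\<in>vectors m - {\<lambda>k\<in>{..<m}. 0}. f l)"
    using f0 zero_vector finite_vectors by (simp add: sum_diff1)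
  also have "[\<dots> = (\<Sum>l\<in>vectors m - {\<lambda>k\<in>{..<m}. 0}. 1)] (mod int p)"
    by (intro cong_sum f1)
  also have "(\<Sum>l\<in>vectors m - {\<lambda>k\<in>{..<m}. 0}. 1) = int p ^ m - 1"
    using zero_vector finite_vectors p_gt_1 by (simp add: card_vectors of_nat_diff)
  finally have "[(\<Sum>l\<in>vectors m. f l) = int p ^ m - 1] (mod int p)" .
  moreover have "int p dvd (\<Sum>l\<in>vectors m. f l)"
  proof -
    have "bounded_degree m (card {..<h} * N) (\<lambda>l. \<Prod>i<h. det (form_mat l))"
      by (intro bounded_degree_prod bounded_degree_det) simp
    then have "bounded_degree m (h * N) f" by (simp add: f_def[abs_def])
    moreover have "h * N < m * (p - 1)"
      using mn h(2) unfolding h(1)[symmetric] N by simp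
    moreover have "int ` {..<p} = {0..<int p}"
      by (simp add: lessThan_atLeast0 image_int_atLeastLessThan)
    ultimately show ?thesis
      using prime_dvd_sum_bounded_degree[OF prime_p] by (metis vectors_def)
  qed
  ultimately have "int p dvd int p ^ m - 1" by (simp add: cong_dvd_iff)
  moreover have "int p dvd int p ^ m" using mn by simp
  ultimately have "int p dvd 1" by (metis dvd_diff_right_iff)
  then show False using p_gt_1 by simp
qed

section \<open>The dimension bound for the prime 2\<close>

text \<open>For \<open>p = 2\<close> the determinant itself has too large a degree. Instead, the upper triangular part
  of the alternating form is a quadratic form, and its Gauss sum is \<open>\<plusminus> 2\<^sup>n\<close>.\<close>

definition quadratic :: "(nat \<Rightarrow> int) \<Rightarrow> (nat \<Rightarrow> int) \<Rightarrow> int" where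
  "quadratic l x = (\<Sum>i<N. \<Sum>j<i. x i * x j * form l i j)"

text \<open>The nontrivial additive character of the integers modulo 2, with integer values so that
  powers of 2 dividing the sums can be compared.\<close>

definition parity_sign :: "int \<Rightarrow> int" where
  "parity_sign t = (if even t then 1 else - 1)"

lemma parity_sign_add: "parity_sign (s + t) = parity_sign s * parity_sign t"
  by (simp add: parity_sign_def)

lemma parity_sign_square: "parity_sign t * parity_sign t = 1"
  by (simp add: parity_sign_def)

lemma parity_sign_sum:
  fixes t :: "nat \<Rightarrow> int"
  shows "parity_sign (\<Sum>k<d. t k) = (\<Prod>k<d. parity_sign (t k))"
proof (induction d)
  case 0
  then show ?case by (simp add: parity_sign_def)
next
  case (Suc d)
  then show ?case by (simp add: parity_sign_add)
qed

text \<open>The left side sees only the entries below the diagonal. On the right the entries above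
  it occur as well; they are the negatives, and changing a sign costs an even number. The size
  \<open>M\<close> is independent of \<open>N\<close> so that one row and column can be added at a
  time.\<close>

lemma polar_form:
  "\<exists>r. (\<Sum>i<M. \<Sum>j<i. (x i * y j + y i * x j) * form l i j) =
     (\<Sum>j<M. \<Sum>i<M. x j * y i * form l i j) + 2 * r"
proof (induction M)
  case (Suc M)
  then obtain r where r: "(\<Sum>i<M. \<Sum>j<i. (x i * y j + y i * x j) * form l i j) =
     (\<Sum>j<M. \<Sum>i<M. x j * y i * form l i j) + 2 * r" ..
  let ?t = "\<Sum>j<M. x M * y j * form l M j"
  have "(\<Sum>i<Suc M. \<Sum>j<i. (x i * y j + y i * x j) * form l i j) =
      (\<Sum>i<M. \<Sum>j<i. (x i * y j + y i * x j) * form l i j)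
      + (\<Sum>j<M. (x M * y j + y M * x j) * form l M j)"
    by simp
  also have "(\<Sum>j<M. (x M * y j + y M * x j) * form l M j) = ?t + (\<Sum>j<M. x j * y M * form l M j)"
    unfolding sum.distrib[symmetric] by (intro sum.cong refl) (simp add: algebra_simps)
  finally have left: "(\<Sum>i<Suc M. \<Sum>j<i. (x i * y j + y i * x j) * form l i j) =
      (\<Sum>i<M. \<Sum>j<i. (x i * y j + y i * x j) * form l i j) + (?t + (\<Sum>j<M. x j * y M * form l M j))" .
  have "(\<Sum>j<Suc M. \<Sum>i<Suc M. x j * y i * form l i j) =
      (\<Sum>j<M. \<Sum>i<M. x j * y i * form l i j) + (\<Sum>j<M. x j * y M * form l M j)
      + (\<Sum>i<M. x M * y i * form l i M)"
    by (simp add: sum.distrib form_diag)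
  also have "(\<Sum>i<M. x M * y i * form l i M) = - ?t"
    unfolding sum_negf[symmetric] by (intro sum.cong refl, subst form_alt) simp
  finally show ?case
    unfolding left r by (intro exI[of _ "r + ?t"]) simp
qed simp

definition xor_vec :: "(nat \<Rightarrow> int) \<Rightarrow> (nat \<Rightarrow> int) \<Rightarrow> nat \<Rightarrow> int" where
  "xor_vec x y = (\<lambda>i\<in>{..<N}. (x i + y i) mod 2)"

lemma parity_quadratic_xor:
  "parity_sign (quadratic l (xor_vec x y)) =
     parity_sign (quadratic l x) * parity_sign (quadratic l y) *
     parity_sign (\<Sum>j<N. x j * (\<Sum>i<N. y i * form l i j))"
proof -
  have "[quadratic l (xor_vec x y) = quadratic l (\<lambda>i. x i + y i)] (mod 2)"
    unfolding quadratic_def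
    by (intro cong_sum cong_mult cong_refl) (auto simp: xor_vec_def Cong.cong_def)
  also have "quadratic l (\<lambda>i. x i + y i) = quadratic l x + quadratic l y
      + (\<Sum>i<N. \<Sum>j<i. (x i * y j + y i * x j) * form l i j)"
    unfolding quadratic_def sum.distrib[symmetric]
    by (intro sum.cong refl) (simp add: algebra_simps)
  also obtain r where "(\<Sum>i<N. \<Sum>j<i. (x i * y j + y i * x j) * form l i j) =
      (\<Sum>j<N. \<Sum>i<N. x j * y i * form l i j) + 2 * r"
    using polar_form by blast
  finally have "even (quadratic l (xor_vec x y)) \<longleftrightarrow>
      even (quadratic l x + quadratic l y + (\<Sum>j<N. x j * (\<Sum>i<N. y i * form l i j)))"
    by (auto dest!: cong_dvd_iff simp: sum_distrib_left mult.assoc)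
  then show ?thesis by (simp add: parity_sign_def)
qed

lemma xor_vec_mem: "p = 2 \<Longrightarrow> xor_vec x y \<in> vectors N"
  unfolding xor_vec_def vectors_def restrict_PiE_iff by simp

lemma xor_vec_xor_vec:
  assumes "p = 2" "y \<in> vectors N"
  shows "xor_vec x (xor_vec x y) = y"
proof (rule vectors_eqI[OF xor_vec_mem[OF assms(1)] assms(2)])
  fix i assume "i < N"
  then show "[xor_vec x (xor_vec x y) i = y i] (mod int p)"
    using assms(1) by (simp add: xor_vec_def Cong.cong_def mod_add_right_eq flip: add.assoc mult_2)
qed

lemma sum_vectors_xor:
  assumes "p = 2"
  shows "(\<Sum>y\<in>vectors N. f (xor_vec x y)) = (\<Sum>y\<in>vectors N. f y)"
proof (rule sum.reindex_bij_witness[of _ "xor_vec x" "xor_vec x"])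
  fix y assume "y \<in> vectors N"
  then show "xor_vec x (xor_vec x y) = y" by (rule xor_vec_xor_vec[OF assms])
qed (use xor_vec_xor_vec[OF assms] xor_vec_mem[OF assms] in simp_all)

text \<open>Orthogonality of characters: adding the \<open>j\<close>-th unit vector permutes the
  vectors and flips the sign of every term.\<close>

lemma sum_parity_sign_linear:
  assumes p: "p = 2" and j: "j < N" "odd (c j)"
  shows "(\<Sum>x\<in>vectors N. parity_sign (\<Sum>j<N. x j * c j)) = 0"
proof -
  define u where "u i = (if i = j then 1 else 0 :: int)" for i
  have "parity_sign (\<Sum>i<N. xor_vec u x i * c i) = - parity_sign (\<Sum>i<N. x i * c i)" for x
  proof -
    have "[(\<Sum>i<N. xor_vec u x i * c i) = (\<Sum>i<N. (u i + x i) * c i)] (mod 2)"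
      by (intro cong_sum cong_mult cong_refl) (auto simp: xor_vec_def Cong.cong_def)
    also have "(\<Sum>i<N. (u i + x i) * c i) = c j + (\<Sum>i<N. x i * c i)"
      using j by (simp add: u_def distrib_right sum.distrib if_distrib[of "\<lambda>t. t * _"] cong: if_cong)
    finally show ?thesis
      using j by (auto dest!: cong_dvd_iff simp: parity_sign_def)
  qed
  then have "(\<Sum>x\<in>vectors N. parity_sign (\<Sum>i<N. x i * c i)) =
      - (\<Sum>x\<in>vectors N. parity_sign (\<Sum>i<N. x i * c i))"
    using sum_vectors_xor[OF p, of "\<lambda>x. parity_sign (\<Sum>i<N. x i * c i)" u]
    by (simp add: sum_negf)
  then show ?thesis by simp
qed

text \<open>In the double sum, \<open>y\<close> is replaced by the sum of \<open>x\<close> and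
  \<open>y\<close>. The signs of \<open>quadratic l x\<close> then cancel, and only
  \<open>quadratic l y\<close> and the polar form remain. The latter is linear in \<open>x\<close>
  and nondegenerate, so the sum over \<open>x\<close> vanishes unless \<open>y = 0\<close>.\<close>

lemma gauss_sum_square:
  assumes p: "p = 2" and l: "\<exists>k<m. \<not> int p dvd l k"
  shows "(\<Sum>x\<in>vectors N. parity_sign (quadratic l x))\<^sup>2 = 2 ^ N"
proof -
  define \<beta> where "\<beta> x y = (\<Sum>j<N. x j * (\<Sum>i<N. y i * form l i j))" for x y
  have "(\<Sum>x\<in>vectors N. parity_sign (quadratic l x))\<^sup>2 =
      (\<Sum>x\<in>vectors N. \<Sum>y\<in>vectors N. parity_sign (quadratic l x) * parity_sign (quadratic l y))"
    by (simp add: power2_eq_square sum_product)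
  also have "\<dots> = (\<Sum>x\<in>vectors N. \<Sum>y\<in>vectors N.
      parity_sign (quadratic l x) * parity_sign (quadratic l (xor_vec x y)))"
    unfolding sum_distrib_left[symmetric] by (subst sum_vectors_xor[OF p]) simp
  also have "\<dots> = (\<Sum>x\<in>vectors N. \<Sum>y\<in>vectors N. parity_sign (quadratic l y) * parity_sign (\<beta> x y))"
    by (intro sum.cong refl)
      (simp only: parity_quadratic_xor \<beta>_def parity_sign_square mult.assoc[symmetric] mult_1)
  also have "\<dots> = (\<Sum>y\<in>vectors N. parity_sign (quadratic l y) * (\<Sum>x\<in>vectors N. parity_sign (\<beta> x y)))"
    by (subst sum.swap) (simp add: sum_distrib_left)
  also have "\<dots> = (\<Sum>y\<in>vectors N. if y = (\<lambda>i\<in>{..<N}. 0) then 2 ^ N else 0)"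
  proof (intro sum.cong refl)
    fix y assume y: "y \<in> vectors N"
    show "parity_sign (quadratic l y) * (\<Sum>x\<in>vectors N. parity_sign (\<beta> x y)) =
      (if y = (\<lambda>i\<in>{..<N}. 0) then 2 ^ N else 0)"
    proof (cases "y = (\<lambda>i\<in>{..<N}. 0)")
      case True
      then show ?thesis
        using p card_vectors[of N] by (simp add: quadratic_def \<beta>_def parity_sign_def)
    next
      case False
      have "\<exists>i<N. \<not> int p dvd y i" by (rule nonzero_vector[OF y False])
      then obtain j where "j < N" "odd (\<Sum>i<N. y i * form l i j)"
        using nondegenerate[OF _ l, of y] p unfolding form_def by auto
      then show ?thesis using False sum_parity_sign_linear[OF p] by (simp add: \<beta>_def)
    qed
  qed
  also have "\<dots> = 2 ^ N" using zero_vector finite_vectors by simp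
  finally show ?thesis .
qed

text \<open>The sum of all Gauss sums is evaluated twice. The zero form contributes
  \<open>4^n\<close> and each of the others, odd in number, \<open>2^n\<close> or its negative, so
  the total is \<open>2^n\<close> times an odd number. Summing over the forms first, every vector
  contributes a multiple of \<open>2^m\<close>.\<close>

lemma dimension_bound_even:
  assumes p: "p = 2"
  shows "m \<le> n"
proof (cases "m = 0")
  case m: False
  define S where "S l = (\<Sum>x\<in>vectors N. parity_sign (quadratic l x))" for l
  define z :: "nat \<Rightarrow> int" where "z = (\<lambda>k\<in>{..<m}. 0)"
  have Sz: "S z = 2 ^ N"
  proof -
    have "quadratic z x = 0" for x
      by (simp add: quadratic_def form_def z_def)
    then have "S z = int (card (vectors N))"
      by (simp add: S_def parity_sign_def)
    then show ?thesis using card_vectors[of N] p by simp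
  qed
  have "\<exists>e. S l = 2 ^ n * e \<and> odd e" if l: "l \<in> vectors m - {z}" for l
  proof -
    have "(S l)\<^sup>2 = (2 ^ n)\<^sup>2"
      using gauss_sum_square[OF p nonzero_vector] l unfolding S_def z_def
      by (auto simp: N power_mult mult.commute)
    then have "S l = 2 ^ n * 1 \<or> S l = 2 ^ n * (-1)" by (auto simp: power2_eq_iff)
    then show ?thesis
    proof
      assume "S l = 2 ^ n * 1"
      then show ?thesis by (intro exI[of _ 1]) simp
    next
      assume "S l = 2 ^ n * (-1)"
      then show ?thesis by (intro exI[of _ "-1"]) simp
    qed
  qed
  then obtain e where e: "\<And>l. l \<in> vectors m - {z} \<Longrightarrow> S l = 2 ^ n * e l \<and> odd (e l)"
    by metis
  have z: "z \<in> vectors m" using zero_vector by (simp add: z_def)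
  have "(\<Sum>l\<in>vectors m. S l) = S z + (\<Sum>l\<in>vectors m - {z}. S l)"
    using z finite_vectors by (simp add: sum.remove)
  also have "\<dots> = 2 ^ N + 2 ^ n * (\<Sum>l\<in>vectors m - {z}. e l)"
    using e by (simp add: Sz sum_distrib_left)
  also have "\<dots> = 2 ^ n * (2 ^ n + (\<Sum>l\<in>vectors m - {z}. e l))"
    by (simp add: N algebra_simps power_add[symmetric] mult_2)
  finally have total: "(\<Sum>l\<in>vectors m. S l) = 2 ^ n * (2 ^ n + (\<Sum>l\<in>vectors m - {z}. e l))" .
  have "card (vectors m - {z}) = p ^ m - 1"
    using z finite_vectors by (simp add: card_vectors)
  then have "odd (card (vectors m - {z}))"
    using m p by (simp only:) simp
  moreover have "{l \<in> vectors m - {z}. odd (e l)} = vectors m - {z}"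
    using e by auto
  ultimately have "odd (\<Sum>l\<in>vectors m - {z}. e l)"
    using finite_vectors[of m] even_sum_iff[of "vectors m - {z}" e] by simp
  then have odd: "odd (2 ^ n + (\<Sum>l\<in>vectors m - {z}. e l))"
    using n_pos by simp
  have "2 ^ m dvd (\<Sum>l\<in>vectors m. S l)"
  proof -
    have "2 ^ m dvd (\<Sum>l\<in>vectors m. parity_sign (quadratic l x))" for x
    proof -
      \<comment> \<open>For a fixed vector the quadratic form is linear in \<open>l\<close>, so the
        sum over \<open>l\<close> is a product of \<open>m\<close> factors, each \<open>0\<close> or
        \<open>2\<close>.\<close>
      define c where "c k = (\<Sum>i<N. \<Sum>j<i. x i * x j * a i j k)" for k
      have "quadratic l x = (\<Sum>k<m. l k * c k)" for l
      proof -
        have "quadratic l x = (\<Sum>i<N. \<Sum>j<i. \<Sum>k<m. l k * (x i * x j * a i j k))"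
          by (simp add: quadratic_def form_def sum_distrib_left mult_ac)
        also have "\<dots> = (\<Sum>i<N. \<Sum>k<m. l k * (\<Sum>j<i. x i * x j * a i j k))"
          unfolding sum_distrib_left by (subst sum.swap) (rule refl)
        also have "\<dots> = (\<Sum>k<m. l k * c k)"
          unfolding c_def sum_distrib_left by (rule sum.swap)
        finally show ?thesis .
      qed
      then have "(\<Sum>l\<in>vectors m. parity_sign (quadratic l x)) =
          (\<Sum>l\<in>vectors m. \<Prod>k<m. parity_sign (l k * c k))"
        by (simp add: parity_sign_sum)
      also have "\<dots> = (\<Prod>k<m. \<Sum>t\<in>{0..<2}. parity_sign (t * c k))"
        unfolding vectors_def by (subst p, subst prod_sum_PiE) simp_all
      also have "2 ^ m dvd \<dots>"
      proof -
        have "{0..<2 :: int} = {0, 1}" by auto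
        then have "(\<Prod>k<m. 2) dvd (\<Prod>k<m. \<Sum>t\<in>{0..<2}. parity_sign (t * c k))"
          by (intro prod_dvd_prod) (auto simp: parity_sign_def)
        then show ?thesis by simp
      qed
      finally show ?thesis .
    qed
    then show ?thesis unfolding S_def by (subst sum.swap) (auto intro: dvd_sum)
  qed
  then have "(2 :: int) ^ m dvd 2 ^ n"
    unfolding total
    by (subst (asm) coprime_dvd_mult_left_iff) (use odd in \<open>simp_all add: coprime_left_2_iff_odd\<close>)
  then show ?thesis by (simp add: dvd_power_iff)
qed simp

theorem dimension_bound: "m \<le> n"
proof (cases "p = 2")
  case True
  then show ?thesis by (rule dimension_bound_even)
next
  case False
  then have "odd p" using prime_p p_gt_1 prime_odd_nat[of p] by simp
  then show ?thesis by (rule dimension_bound_odd)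
qed

end

section \<open>Complex representations of finite groups\<close>

lemma mult_assoc_mat:
  fixes A :: "'a :: semiring_0 mat"
  shows "dim_col A = dim_row B \<Longrightarrow> dim_col B = dim_row C \<Longrightarrow> A * B * C = A * (B * C)"
  by (rule assoc_mult_mat[of _ "dim_row A" "dim_row B" _ "dim_row C" _ "dim_col C"]) auto

lemma one_mult_mat:
  fixes A :: "'a :: semiring_1 mat"
  shows "dim_row A = n \<Longrightarrow> 1\<^sub>m n * A = A" "dim_col A = n \<Longrightarrow> A * 1\<^sub>m n = A"
  by (auto intro: left_mult_one_mat[of _ _ "dim_col A"] right_mult_one_mat[of _ "dim_row A"])

lemma mat_eq_vecI:
  fixes A B :: "'a :: semiring_1 mat"
  assumes A: "A \<in> carrier_mat n r" and B: "B \<in> carrier_mat n r"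
    and eq: "\<And>v. v \<in> carrier_vec r \<Longrightarrow> A *\<^sub>v v = B *\<^sub>v v"
  shows "A = B"
proof (rule eq_matI)
  fix i j assume ij: "i < dim_row B" "j < dim_col B"
  have "(A *\<^sub>v unit_vec r j) $ i = (B *\<^sub>v unit_vec r j) $ i" by (simp add: eq)
  then show "A $$ (i, j) = B $$ (i, j)"
    using A B ij by (simp add: scalar_prod_right_unit)
qed (use A B in auto)

text \<open>All sizes share one matrix type, so the size of the sum is passed explicitly; an empty
  sum is the zero matrix of that size.\<close>

definition mat_sum :: "nat \<Rightarrow> nat \<Rightarrow> ('i \<Rightarrow> complex mat) \<Rightarrow> 'i set \<Rightarrow> complex mat" where
  "mat_sum n m f S = mat n m (\<lambda>ij. \<Sum>g\<in>S. f g $$ ij)"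

lemma mat_sum_dim [simp]: "dim_row (mat_sum n m f S) = n" "dim_col (mat_sum n m f S) = m"
  by (simp_all add: mat_sum_def)

lemma mat_sum_carrier [simp]: "mat_sum n m f S \<in> carrier_mat n m"
  by (simp add: mat_sum_def)

lemma mat_sum_index [simp]: "i < n \<Longrightarrow> j < m \<Longrightarrow> mat_sum n m f S $$ (i, j) = (\<Sum>g\<in>S. f g $$ (i, j))"
  by (simp add: mat_sum_def)

lemma mat_sum_cong: "(\<And>g. g \<in> S \<Longrightarrow> f g = h g) \<Longrightarrow> mat_sum n m f S = mat_sum n m h S"
  by (simp add: mat_sum_def cong: sum.cong)

lemma mat_sum_reindex:
  assumes "bij_betw \<phi> S T"
  shows "mat_sum n m (\<lambda>g. f (\<phi> g)) S = mat_sum n m f T"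
  by (simp add: mat_sum_def sum.reindex_bij_betw[OF assms, symmetric])

lemma mult_mat_sum:
  assumes "dim_col A = n" "\<And>g. g \<in> S \<Longrightarrow> f g \<in> carrier_mat n m"
  shows "A * mat_sum n m f S = mat_sum (dim_row A) m (\<lambda>g. A * f g) S"
proof (rule eq_matI)
  fix i j assume ij: "i < dim_row (mat_sum (dim_row A) m (\<lambda>g. A * f g) S)"
    "j < dim_col (mat_sum (dim_row A) m (\<lambda>g. A * f g) S)"
  have "(A * f g) $$ (i, j) = (\<Sum>k\<in>{0..<n}. A $$ (i, k) * f g $$ (k, j))" if "g \<in> S" for g
    using assms(2)[OF that] assms(1) ij by (simp add: scalar_prod_def)
  moreover have "(A * mat_sum n m f S) $$ (i, j) = (\<Sum>k\<in>{0..<n}. A $$ (i, k) * mat_sum n m f S $$ (k, j))"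
    using assms(1) ij by (simp add: scalar_prod_def)
  moreover have "\<dots> = (\<Sum>k\<in>{0..<n}. \<Sum>g\<in>S. A $$ (i, k) * f g $$ (k, j))"
    using ij by (simp add: sum_distrib_left)
  ultimately show "(A * mat_sum n m f S) $$ (i, j) = mat_sum (dim_row A) m (\<lambda>g. A * f g) S $$ (i, j)"
    using ij sum.swap[of "\<lambda>k g. A $$ (i, k) * f g $$ (k, j)" S "{0..<n}"] by simp
qed simp_all

lemma mat_sum_mult:
  assumes "dim_row A = m" "\<And>g. g \<in> S \<Longrightarrow> f g \<in> carrier_mat n m"
  shows "mat_sum n m f S * A = mat_sum n (dim_col A) (\<lambda>g. f g * A) S"
proof (rule eq_matI)
  fix i j assume ij: "i < dim_row (mat_sum n (dim_col A) (\<lambda>g. f g * A) S)"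
    "j < dim_col (mat_sum n (dim_col A) (\<lambda>g. f g * A) S)"
  have "(f g * A) $$ (i, j) = (\<Sum>k\<in>{0..<m}. f g $$ (i, k) * A $$ (k, j))" if "g \<in> S" for g
    using assms(2)[OF that] assms(1) ij by (simp add: scalar_prod_def)
  moreover have "(mat_sum n m f S * A) $$ (i, j) = (\<Sum>k\<in>{0..<m}. mat_sum n m f S $$ (i, k) * A $$ (k, j))"
    using assms(1) ij by (simp add: scalar_prod_def)
  moreover have "\<dots> = (\<Sum>k\<in>{0..<m}. \<Sum>g\<in>S. f g $$ (i, k) * A $$ (k, j))"
    using ij by (simp add: sum_distrib_right)
  ultimately show "(mat_sum n m f S * A) $$ (i, j) = mat_sum n (dim_col A) (\<lambda>g. f g * A) S $$ (i, j)"
    using ij sum.swap[of "\<lambda>k g. f g $$ (i, k) * A $$ (k, j)" S "{0..<m}"] by simp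
qed simp_all

lemma mat_sum_const: "A \<in> carrier_mat n m \<Longrightarrow> mat_sum n m (\<lambda>g. A) S = of_nat (card S) \<cdot>\<^sub>m A"
  by (intro eq_matI) auto

lemma mat_sum_add:
  assumes "\<And>g. g \<in> S \<Longrightarrow> f g \<in> carrier_mat n m" "\<And>g. g \<in> S \<Longrightarrow> h g \<in> carrier_mat n m"
  shows "mat_sum n m (\<lambda>g. f g + h g) S = mat_sum n m f S + mat_sum n m h S"
proof (rule eq_matI)
  fix i j assume "i < dim_row (mat_sum n m f S + mat_sum n m h S)"
    "j < dim_col (mat_sum n m f S + mat_sum n m h S)"
  moreover from this have "(f g + h g) $$ (i, j) = f g $$ (i, j) + h g $$ (i, j)" if "g \<in> S" for g
    using assms[OF that] by simp
  ultimately show "mat_sum n m (\<lambda>g. f g + h g) S $$ (i, j) = (mat_sum n m f S + mat_sum n m h S) $$ (i, j)"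
    by (simp add: sum.distrib)
qed simp_all

lemma mat_trace_mat_sum:
  assumes "\<And>g. g \<in> S \<Longrightarrow> f g \<in> carrier_mat n n"
  shows "mat_trace (mat_sum n n f S) = (\<Sum>g\<in>S. mat_trace (f g))"
proof -
  have "mat_trace (f g) = (\<Sum>i<n. f g $$ (i, i))" if "g \<in> S" for g
    using assms[OF that] by (simp add: mat_trace_def)
  then show ?thesis by (simp add: mat_trace_def sum.swap[of _ "{..<n}"])
qed

lemma mat_trace_comm:
  assumes "A \<in> carrier_mat n m" "B \<in> carrier_mat m n"
  shows "mat_trace (A * B) = mat_trace (B * A)"
proof -
  have "mat_trace (A * B) = (\<Sum>i<n. \<Sum>k<m. A $$ (i, k) * B $$ (k, i))"
    using assms by (simp add: mat_trace_def scalar_prod_def atLeast0LessThan)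
  also have "\<dots> = (\<Sum>k<m. \<Sum>i<n. B $$ (k, i) * A $$ (i, k))"
    by (subst sum.swap) (simp add: mult.commute)
  also have "\<dots> = mat_trace (B * A)"
    using assms by (simp add: mat_trace_def scalar_prod_def atLeast0LessThan)
  finally show ?thesis .
qed

lemma mat_trace_add:
  assumes "A \<in> carrier_mat n n" "B \<in> carrier_mat n n"
  shows "mat_trace (A + B) = mat_trace A + mat_trace B"
  using assms by (simp add: mat_trace_def sum.distrib)

lemma mat_trace_smult: "dim_row A = dim_col A \<Longrightarrow> mat_trace (c \<cdot>\<^sub>m A) = c * mat_trace A"
  by (simp add: mat_trace_def sum_distrib_left)

lemma mat_trace_one: "mat_trace (1\<^sub>m n) = of_nat n"
  by (simp add: mat_trace_def)

lemma subspace_iff: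
  "VectorSpace.subspace class_ring W (module_vec TYPE(complex) n) \<longleftrightarrow>
     W \<subseteq> carrier_vec n \<and> 0\<^sub>v n \<in> W \<and> (\<forall>v\<in>W. \<forall>w\<in>W. v + w \<in> W) \<and> (\<forall>c. \<forall>v\<in>W. c \<cdot>\<^sub>v v \<in> W)"
  using vec_vs vec_module unfolding VectorSpace.subspace_def submodule_def
  by (auto simp: module_vec_simps class_ring_simps)

text \<open>Padded with zeros to square matrices of size \<open>r\<close>, the two would be mutually
  inverse for \<open>r > n\<close>, although the padded \<open>B\<close> has a zero row.\<close>

lemma left_inverse_dim_le:
  fixes B L :: "complex mat"
  assumes B: "B \<in> carrier_mat n r" and L: "L \<in> carrier_mat r n" and LB: "L * B = 1\<^sub>m r"
  shows "r \<le> n"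
proof (rule ccontr)
  assume r: "\<not> r \<le> n"
  define L0 where "L0 = mat r r (\<lambda>(i, j). if j < n then L $$ (i, j) else 0)"
  define B0 where "B0 = mat r r (\<lambda>(i, j). if i < n then B $$ (i, j) else 0)"
  have carr: "L0 \<in> carrier_mat r r" "B0 \<in> carrier_mat r r" by (simp_all add: L0_def B0_def)
  have "L0 * B0 = 1\<^sub>m r"
  proof (rule eq_matI)
    fix i j assume "i < dim_row (1\<^sub>m r :: complex mat)" "j < dim_col (1\<^sub>m r :: complex mat)"
    then have ij: "i < r" "j < r" by auto
    have "(L0 * B0) $$ (i, j) = (\<Sum>k\<in>{0..<r}. if k < n then L $$ (i, k) * B $$ (k, j) else 0)"
      using ij by (auto simp: L0_def B0_def scalar_prod_def intro!: sum.cong)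
    also have "\<dots> = (\<Sum>k\<in>{0..<n}. L $$ (i, k) * B $$ (k, j))"
      using r by (intro sum.mono_neutral_cong_right) auto
    also have "\<dots> = (L * B) $$ (i, j)"
      using ij B L by (simp add: scalar_prod_def)
    finally show "(L0 * B0) $$ (i, j) = 1\<^sub>m r $$ (i, j)" using LB by simp
  qed (use carr in auto)
  then have "B0 * L0 = 1\<^sub>m r"
    using carr mat_mult_left_right_inverse by blast
  then have "(B0 * L0) $$ (n, n) = 1" using r by simp
  moreover have "(B0 * L0) $$ (n, n) = 0"
    using r by (simp add: L0_def B0_def scalar_prod_def)
  ultimately show False by simp
qed

text \<open>A pair \<open>(B, L)\<close> of maximal rank must reach all of the subspace: a vector \<open>w - B L w \<noteq> 0\<close>
  would provide one more column.\<close>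

lemma subspace_coordinates:
  assumes W: "W \<subseteq> carrier_vec n" "0\<^sub>v n \<in> W" "\<And>v w. v \<in> W \<Longrightarrow> w \<in> W \<Longrightarrow> v + w \<in> W"
    "\<And>c v. v \<in> W \<Longrightarrow> c \<cdot>\<^sub>v v \<in> W"
  obtains r :: nat and B L :: "complex mat" where "B \<in> carrier_mat n r" "L \<in> carrier_mat r n" "L * B = 1\<^sub>m r"
    "\<And>v. v \<in> carrier_vec r \<Longrightarrow> B *\<^sub>v v \<in> W" "\<And>w. w \<in> W \<Longrightarrow> B *\<^sub>v (L *\<^sub>v w) = w"
proof -
  define P where "P r \<longleftrightarrow> (\<exists>B\<in>carrier_mat n r. \<exists>L\<in>carrier_mat r n.
    L * B = 1\<^sub>m r \<and> (\<forall>v\<in>carrier_vec r. B *\<^sub>v v \<in> W))" for r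
  have "P 0" unfolding P_def
  proof (intro bexI conjI ballI)
    show "(0\<^sub>m 0 n :: complex mat) * 0\<^sub>m n 0 = 1\<^sub>m 0" by (intro eq_matI) auto
    fix v :: "complex vec" assume "v \<in> carrier_vec 0"
    then have "0\<^sub>m n 0 *\<^sub>v v = 0\<^sub>v n" by (intro eq_vecI) (auto simp: scalar_prod_def)
    then show "0\<^sub>m n 0 *\<^sub>v v \<in> W" using W(2) by simp
  qed auto
  moreover have "\<forall>r. P r \<longrightarrow> r \<le> n"
    unfolding P_def using left_inverse_dim_le by blast
  ultimately have max: "P (Greatest P)" "\<And>r. P r \<Longrightarrow> r \<le> Greatest P"
    using GreatestI_nat[of P 0 n] Greatest_le_nat[of P _ n] by blast+
  define r where "r = Greatest P"
  obtain B L where B: "B \<in> carrier_mat n r" and L: "L \<in> carrier_mat r n"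
    and LB: "L * B = 1\<^sub>m r" and BW: "\<And>v. v \<in> carrier_vec r \<Longrightarrow> B *\<^sub>v v \<in> W"
    using max(1) unfolding P_def r_def by blast
  have "B *\<^sub>v (L *\<^sub>v w) = w" if w: "w \<in> W" for w
  proof (rule ccontr)
    assume ne: "B *\<^sub>v (L *\<^sub>v w) \<noteq> w"
    have wc: "w \<in> carrier_vec n" using w W(1) by auto
    define u where "u = w + (- 1) \<cdot>\<^sub>v (B *\<^sub>v (L *\<^sub>v w))"
    have u: "u \<in> W" "u \<in> carrier_vec n"
      using w BW[of "L *\<^sub>v w"] L B wc W(1) unfolding u_def by (auto intro!: W(3,4))
    have "\<exists>i<n. u $ i \<noteq> 0"
    proof (rule ccontr)
      assume *: "\<not> ?thesis"
      have "B *\<^sub>v (L *\<^sub>v w) = w"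
      proof (rule eq_vecI)
        fix i assume "i < dim_vec w"
        then show "(B *\<^sub>v (L *\<^sub>v w)) $ i = w $ i"
          using * wc B by (auto simp: u_def)
      qed (use wc B in auto)
      then show False using ne by simp
    qed
    then obtain i0 where i0: "i0 < n" "u $ i0 \<noteq> 0" by blast
    \<comment> \<open>\<open>M\<close> projects along the columns of \<open>B\<close>, and
      \<open>u = M w\<close> is the part of \<open>w\<close> that \<open>B\<close> misses.\<close>
    define M where "M = 1\<^sub>m n - B * L"
    have M: "M \<in> carrier_mat n n" using B L unfolding M_def by (intro minus_carrier_mat mult_carrier_mat)
    have MB: "M * B = 0\<^sub>m n r"
    proof -
      have "M * B = 1\<^sub>m n * B - B * L * B"
        unfolding M_def using B L by (intro minus_mult_distrib_mat) auto
      also have "B * L * B = B"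
        using B L LB by (simp add: assoc_mult_mat[of B n r L n B r])
      finally show ?thesis using B by simp
    qed
    have Lu: "L *\<^sub>v u = 0\<^sub>v r"
    proof -
      have "L *\<^sub>v u = L *\<^sub>v w + (- 1) \<cdot>\<^sub>v (L *\<^sub>v (B *\<^sub>v (L *\<^sub>v w)))"
        unfolding u_def using L B wc
        by (subst mult_add_distrib_mat_vec[of _ r n]) (auto simp: mult_mat_vec)
      also have "L *\<^sub>v (B *\<^sub>v (L *\<^sub>v w)) = L *\<^sub>v w"
        using L B wc LB by (simp add: assoc_mult_mat_vec[symmetric, of L r n B r])
      finally show ?thesis using L wc by (intro eq_vecI) auto
    qed
    have Mu: "M *\<^sub>v u = u"
    proof -
      have "M *\<^sub>v u = 1\<^sub>m n *\<^sub>v u - B * L *\<^sub>v u"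
        unfolding M_def using B L u by (intro minus_mult_distrib_mat_vec) auto
      also have "B * L *\<^sub>v u = B *\<^sub>v 0\<^sub>v r"
        using B L u Lu by (simp add: assoc_mult_mat_vec[of B n r L n])
      also have "\<dots> = 0\<^sub>v n" using B by (intro eq_vecI) auto
      finally show ?thesis using u by simp
    qed
    define B' where "B' = mat n (Suc r) (\<lambda>(i, j). if j < r then B $$ (i, j) else u $ i)"
    \<comment> \<open>The new row is the functional \<open>v |-> (M v)_i0 / u_i0\<close>. It kills
      the columns of \<open>B\<close> and is \<open>1\<close> at \<open>u\<close>, so
      \<open>L'\<close> is a left inverse of the enlarged matrix.\<close>
    define L' where "L' = mat (Suc r) n (\<lambda>(i, j). if i < r then L $$ (i, j) else M $$ (i0, j) / u $ i0)"
    have B': "B' \<in> carrier_mat n (Suc r)" and L': "L' \<in> carrier_mat (Suc r) n"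
      by (simp_all add: B'_def L'_def)
    have "L' * B' = 1\<^sub>m (Suc r)"
    proof (rule eq_matI)
      fix i j assume "i < dim_row (1\<^sub>m (Suc r) :: complex mat)" "j < dim_col (1\<^sub>m (Suc r) :: complex mat)"
      then have ij: "i < Suc r" "j < Suc r" by auto
      have entry: "(L' * B') $$ (i, j) = (\<Sum>k\<in>{0..<n}. L' $$ (i, k) * B' $$ (k, j))"
        using ij B' L' by (simp add: scalar_prod_def)
      consider "i < r" "j < r" | "i < r" "j = r" | "i = r" "j < r" | "i = r" "j = r"
        using ij by linarith
      then show "(L' * B') $$ (i, j) = 1\<^sub>m (Suc r) $$ (i, j)"
      proof cases
        case 1
        then have "(L' * B') $$ (i, j) = (L * B) $$ (i, j)"
          unfolding entry using B L by (simp add: B'_def L'_def scalar_prod_def)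
        then show ?thesis using 1 LB by simp
      next
        case 2
        then have "(L' * B') $$ (i, j) = (L *\<^sub>v u) $ i"
          unfolding entry using L u by (simp add: B'_def L'_def scalar_prod_def)
        then show ?thesis using 2 Lu by simp
      next
        case 3
        then have "(L' * B') $$ (i, j) = (M * B) $$ (i0, j) / u $ i0"
          unfolding entry using B M i0 by (simp add: B'_def L'_def scalar_prod_def sum_divide_distrib)
        then show ?thesis using 3 MB i0 by simp
      next
        case 4
        then have "(L' * B') $$ (i, j) = (M *\<^sub>v u) $ i0 / u $ i0"
          unfolding entry using u M i0 by (simp add: B'_def L'_def scalar_prod_def sum_divide_distrib)
        then show ?thesis using 4 Mu i0 by simp
      qed
    qed (use B' L' in auto)
    moreover have "B' *\<^sub>v v \<in> W" if v: "v \<in> carrier_vec (Suc r)" for v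
    proof -
      have "B' *\<^sub>v v = B *\<^sub>v vec_first v r + v $ r \<cdot>\<^sub>v u"
        using v B u by (intro eq_vecI) (auto simp: B'_def scalar_prod_def vec_first_def)
      then show ?thesis using u BW[of "vec_first v r"] by (auto intro!: W(3,4))
    qed
    ultimately have "P (Suc r)" using B' L' unfolding P_def by blast
    then show False using max(2)[of "Suc r"] by (simp add: r_def)
  qed
  then show ?thesis using that B L LB BW by blast
qed

section \<open>Representations and their compressions to subspaces\<close>

lemma representation_iff:
  assumes "group G"
  shows "representation G n \<rho> \<longleftrightarrow> (\<forall>g\<in>carrier G. \<rho> g \<in> carrier_mat n n) \<and>
    (\<forall>g\<in>carrier G. \<forall>h\<in>carrier G. \<rho> (g \<otimes>\<^bsub>G\<^esub> h) = \<rho> g * \<rho> h) \<and> \<rho> \<one>\<^bsub>G\<^esub> = 1\<^sub>m n"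
    (is "_ \<longleftrightarrow> ?R")
proof -
  interpret group G by fact
  interpret R: ring "ring_mat TYPE(complex) n ()" by (rule ring_mat)
  have GL: "carrier (GL n) = {y \<in> carrier_mat n n. \<exists>x\<in>carrier_mat n n. x * y = 1\<^sub>m n \<and> y * x = 1\<^sub>m n}"
    "A \<otimes>\<^bsub>GL n\<^esub> B = A * B" "\<one>\<^bsub>GL n\<^esub> = 1\<^sub>m n" for A B
    by (simp_all add: GL_def units_of_def Units_def ring_mat_def)
  show ?thesis
  proof
    assume \<rho>: "representation G n \<rho>"
    have "group (GL n)" unfolding GL_def by (rule R.units_group)
    then have "\<rho> \<one>\<^bsub>G\<^esub> = \<one>\<^bsub>GL n\<^esub>"
      using \<rho> assms hom_one unfolding representation_def by blast
    then show ?R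
      using \<rho> unfolding representation_def hom_def by (auto simp: GL)
  next
    assume R: ?R
    have "\<rho> g \<in> carrier (GL n)" if "g \<in> carrier G" for g
      unfolding GL using that R
      by (auto intro!: bexI[of _ "\<rho> (inv\<^bsub>G\<^esub> g)"]) (metis inv_closed l_inv r_inv)+
    then show "representation G n \<rho>"
      using R unfolding representation_def hom_def by (auto simp: GL)
  qed
qed

text \<open>\<open>B\<close> embeds the coordinate space with left inverse \<open>L\<close>; since
  the trace is cyclic and \<open>L * B = 1\<close>, the trace on the image can be computed in
  coordinates.\<close>

lemma compression_trace:
  assumes A: "A \<in> carrier_mat n n" and B: "B \<in> carrier_mat n r" and L: "L \<in> carrier_mat r n"
    and LB: "L * B = 1\<^sub>m r" and eq: "A * (B * L) = B * (L * A * B) * L"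
  shows "mat_trace (A * (B * L)) = mat_trace (L * A * B)"
proof -
  note c = carrier_matD[OF A] carrier_matD[OF B] carrier_matD[OF L]
  have "mat_trace (A * (B * L)) = mat_trace (B * (L * A * B * L))"
    unfolding eq by (simp add: mult_assoc_mat c)
  also have "\<dots> = mat_trace (L * A * B * L * B)"
    by (rule mat_trace_comm[of _ n r]) (auto intro!: carrier_matI simp: c)
  also have "L * A * B * L * B = L * A * B"
    using LB by (simp add: mult_assoc_mat one_mult_mat c)
  finally show ?thesis .
qed

locale finite_group = group +
  assumes finite_carrier: "finite (carrier G)"
begin

lemma order_pos: "0 < card (carrier G)"
  using finite_carrier one_closed by (auto simp: card_gt_0_iff)

lemma rep_carrier: "representation G n \<rho> \<Longrightarrow> g \<in> carrier G \<Longrightarrow> \<rho> g \<in> carrier_mat n n"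
  using representation_iff[OF is_group] by blast

lemma rep_mult:
  "representation G n \<rho> \<Longrightarrow> g \<in> carrier G \<Longrightarrow> h \<in> carrier G \<Longrightarrow> \<rho> (g \<otimes> h) = \<rho> g * \<rho> h"
  using representation_iff[OF is_group] by blast

lemma rep_one: "representation G n \<rho> \<Longrightarrow> \<rho> \<one> = 1\<^sub>m n"
  using representation_iff[OF is_group] by blast

lemma rep_inv:
  assumes "representation G n \<rho>" "g \<in> carrier G"
  shows "\<rho> g * \<rho> (inv g) = 1\<^sub>m n" "\<rho> (inv g) * \<rho> g = 1\<^sub>m n"
  using assms by (simp_all flip: rep_mult add: rep_one)

lemma bij_betw_mult_left: "h \<in> carrier G \<Longrightarrow> bij_betw ((\<otimes>) h) (carrier G) (carrier G)"
  by (rule bij_betw_byWitness[of _ "(\<otimes>) (inv h)"]) (auto simp: m_assoc[symmetric])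

lemma bij_betw_mult_right: "h \<in> carrier G \<Longrightarrow> bij_betw (\<lambda>g. g \<otimes> h) (carrier G) (carrier G)"
  by (rule bij_betw_byWitness[of _ "\<lambda>g. g \<otimes> inv h"]) (auto simp: m_assoc)

section \<open>Averaging over the group and complete reducibility\<close>

text \<open>The factor \<open>1 / |G|\<close> is left out; it is supplied where a projection is
  wanted.\<close>

definition average :: "nat \<Rightarrow> ('a \<Rightarrow> complex mat) \<Rightarrow> complex mat \<Rightarrow> complex mat" where
  "average n \<rho> A = mat_sum n n (\<lambda>g. \<rho> g * A * \<rho> (inv g)) (carrier G)"

lemma average_carrier [simp]: "average n \<rho> A \<in> carrier_mat n n"
  by (simp add: average_def)

lemma average_commute:
  assumes \<rho>: "representation G n \<rho>" and A: "A \<in> carrier_mat n n" and h: "h \<in> carrier G"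
  shows "\<rho> h * average n \<rho> A = average n \<rho> A * \<rho> h"
proof -
  note c = carrier_matD[OF rep_carrier[OF \<rho>]] carrier_matD[OF A]
  have "\<rho> h * average n \<rho> A = mat_sum n n (\<lambda>g. \<rho> h * (\<rho> g * A * \<rho> (inv g))) (carrier G)"
    unfolding average_def using h
    by (subst mult_mat_sum) (auto intro!: carrier_matI simp: c)
  also have "\<dots> = mat_sum n n (\<lambda>g. \<rho> (h \<otimes> g) * A * \<rho> (inv (h \<otimes> g)) * \<rho> h) (carrier G)"
  proof (rule mat_sum_cong)
    fix g assume g: "g \<in> carrier G"
    have "inv (h \<otimes> g) \<otimes> h = inv g"
      using g h by (simp add: inv_mult_group m_assoc)
    then have "\<rho> (inv (h \<otimes> g)) * \<rho> h = \<rho> (inv g)"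
      using g h by (simp flip: rep_mult[OF \<rho>])
    then show "\<rho> h * (\<rho> g * A * \<rho> (inv g)) = \<rho> (h \<otimes> g) * A * \<rho> (inv (h \<otimes> g)) * \<rho> h"
      using g h by (simp add: rep_mult[OF \<rho> h g] mult_assoc_mat c)
  qed
  also have "\<dots> = mat_sum n n (\<lambda>g. \<rho> g * A * \<rho> (inv g) * \<rho> h) (carrier G)"
    by (rule mat_sum_reindex[OF bij_betw_mult_left[OF h]])
  also have "\<dots> = average n \<rho> A * \<rho> h"
    unfolding average_def using h
    by (subst mat_sum_mult) (auto intro!: carrier_matI simp: c)
  finally show ?thesis .
qed

text \<open>\<open>B * L\<close> commutes with the group and fixes the columns of \<open>B\<close>,
  so these span an invariant subspace: \<open>\<rho> g * B = B * (L * \<rho> g * B)\<close>. This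
  makes the compressed matrices multiply.\<close>

lemma compression_representation:
  assumes \<rho>: "representation G n \<rho>" and B: "B \<in> carrier_mat n r" and L: "L \<in> carrier_mat r n"
    and LB: "L * B = 1\<^sub>m r" and comm: "\<And>g. g \<in> carrier G \<Longrightarrow> \<rho> g * (B * L) = B * L * \<rho> g"
  shows "representation G r (\<lambda>g. L * \<rho> g * B)"
    and "g \<in> carrier G \<Longrightarrow> \<rho> g * (B * L) = B * (L * \<rho> g * B) * L"
proof -
  note c = carrier_matD[OF rep_carrier[OF \<rho>]] carrier_matD[OF B] carrier_matD[OF L]
  have BLB: "B * (L * B) = B" using LB by (simp add: one_mult_mat c)
  have key: "\<rho> g * B = B * (L * (\<rho> g * B))" if g: "g \<in> carrier G" for g
  proof -
    have "\<rho> g * B = \<rho> g * (B * L) * B" using g BLB by (simp add: mult_assoc_mat c)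
    also have "\<dots> = B * (L * (\<rho> g * B))"
      unfolding comm[OF g] using g by (simp add: mult_assoc_mat c)
    finally show ?thesis .
  qed
  show "representation G r (\<lambda>g. L * \<rho> g * B)"
    unfolding representation_iff[OF is_group]
  proof (intro conjI ballI)
    show "L * \<rho> g * B \<in> carrier_mat r r" if "g \<in> carrier G" for g
      using that c by (intro carrier_matI) simp_all
    show "L * \<rho> (g \<otimes> h) * B = L * \<rho> g * B * (L * \<rho> h * B)"
      if g: "g \<in> carrier G" and h: "h \<in> carrier G" for g h
    proof -
      have "L * \<rho> g * B * (L * \<rho> h * B) = L * (\<rho> g * (B * (L * (\<rho> h * B))))"
        using g h by (simp add: mult_assoc_mat c)
      also have "\<dots> = L * (\<rho> g * (\<rho> h * B))" by (simp only: key[OF h, symmetric])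
      also have "\<dots> = L * \<rho> (g \<otimes> h) * B"
        using g h by (simp add: mult_assoc_mat c rep_mult[OF \<rho>])
      finally show ?thesis ..
    qed
    show "L * \<rho> \<one> * B = 1\<^sub>m r"
      using LB by (simp add: rep_one[OF \<rho>] one_mult_mat c)
  qed
  show "\<rho> g * (B * L) = B * (L * \<rho> g * B) * L" if g: "g \<in> carrier G"
  proof -
    have "\<rho> g * (B * L) = \<rho> g * B * L" using g by (simp add: mult_assoc_mat c)
    also have "\<dots> = B * (L * (\<rho> g * B)) * L" by (simp only: key[OF g, symmetric])
    finally show ?thesis using g by (simp add: mult_assoc_mat c)
  qed
qed

text \<open>Maschke's theorem: averaging a projection onto an invariant subspace makes it commute with
  the group.\<close>

lemma invariant_projection:
  assumes \<rho>: "representation G n \<rho>"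
    and W: "VectorSpace.subspace class_ring W (module_vec TYPE(complex) n)"
    and inv: "\<And>g w. g \<in> carrier G \<Longrightarrow> w \<in> W \<Longrightarrow> \<rho> g *\<^sub>v w \<in> W"
  obtains r B L where "B \<in> carrier_mat n r" "L \<in> carrier_mat r n" "L * B = 1\<^sub>m r"
    "\<And>v. v \<in> carrier_vec r \<Longrightarrow> B *\<^sub>v v \<in> W" "\<And>w. w \<in> W \<Longrightarrow> B *\<^sub>v (L *\<^sub>v w) = w"
    "\<And>g. g \<in> carrier G \<Longrightarrow> \<rho> g * (B * L) = B * L * \<rho> g"
proof -
  obtain r B L where B: "B \<in> carrier_mat n r" and L: "L \<in> carrier_mat r n"
    and LB: "L * B = 1\<^sub>m r" and BW: "\<And>v. v \<in> carrier_vec r \<Longrightarrow> B *\<^sub>v v \<in> W"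
    and Wfix: "\<And>w. w \<in> W \<Longrightarrow> B *\<^sub>v (L *\<^sub>v w) = w"
    using W unfolding subspace_iff by (auto intro: subspace_coordinates[of W n])
  note c = carrier_matD[OF rep_carrier[OF \<rho>]] carrier_matD[OF B] carrier_matD[OF L]
  \<comment> \<open>\<open>B * L\<close> is the identity on \<open>W\<close>, and by invariance the
    columns of \<open>\<rho> g * B\<close> lie in \<open>W\<close>.\<close>
  have key: "B * (L * (\<rho> g * B)) = \<rho> g * B" if g: "g \<in> carrier G" for g
  proof (rule mat_eq_vecI)
    note \<rho>g = rep_carrier[OF \<rho> g]
    show "B * (L * (\<rho> g * B)) \<in> carrier_mat n r" "\<rho> g * B \<in> carrier_mat n r"
      using g c by (auto intro!: carrier_matI)
    fix v :: "complex vec" assume v: "v \<in> carrier_vec r"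
    have "B * (L * (\<rho> g * B)) *\<^sub>v v = B *\<^sub>v (L *\<^sub>v (\<rho> g *\<^sub>v (B *\<^sub>v v)))"
      using v B L \<rho>g
      by (simp add: assoc_mult_mat_vec[of B n r _ r] assoc_mult_mat_vec[of L r n _ r]
          assoc_mult_mat_vec[of "\<rho> g" n n _ r] mult_carrier_mat[of L r n] mult_carrier_mat[of "\<rho> g" n n])
    also have "\<dots> = \<rho> g *\<^sub>v (B *\<^sub>v v)"
      using inv[OF g BW[OF v]] by (rule Wfix)
    also have "\<dots> = \<rho> g * B *\<^sub>v v"
      using v B \<rho>g by (simp add: assoc_mult_mat_vec[of "\<rho> g" n n _ r])
    finally show "B * (L * (\<rho> g * B)) *\<^sub>v v = \<rho> g * B *\<^sub>v v" .
  qed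
  define E where "E = (1 / of_nat (card (carrier G))) \<cdot>\<^sub>m average n \<rho> (B * L)"
  have E: "E \<in> carrier_mat n n" by (simp add: E_def)
  have BL: "B * L \<in> carrier_mat n n" using B L by (rule mult_carrier_mat)
  have comm: "\<rho> g * E = E * \<rho> g" if g: "g \<in> carrier G" for g
    unfolding E_def using average_commute[OF \<rho> BL g] rep_carrier[OF \<rho> g]
    by (simp add: mult_smult_distrib[of _ n n _ n] mult_smult_assoc_mat[of _ n n _ n])
  have EB: "E * B = B"
  proof -
    have "average n \<rho> (B * L) * B = mat_sum n r (\<lambda>g. \<rho> g * (B * L) * \<rho> (inv g) * B) (carrier G)"
      unfolding average_def using c
      by (subst mat_sum_mult) (auto intro!: carrier_matI)
    also have "\<dots> = mat_sum n r (\<lambda>g. B) (carrier G)"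
    proof (rule mat_sum_cong)
      fix g assume g: "g \<in> carrier G"
      have "\<rho> g * (B * L) * \<rho> (inv g) * B = \<rho> g * (B * (L * (\<rho> (inv g) * B)))"
        using g by (simp add: mult_assoc_mat c)
      also have "\<dots> = \<rho> g * \<rho> (inv g) * B"
        using g by (simp add: key mult_assoc_mat c)
      finally show "\<rho> g * (B * L) * \<rho> (inv g) * B = B"
        using g by (simp add: rep_inv[OF \<rho>] one_mult_mat c)
    qed
    also have "\<dots> = of_nat (card (carrier G)) \<cdot>\<^sub>m B" using B by (rule mat_sum_const)
    finally show ?thesis
      unfolding E_def using B order_pos
      by (simp add: mult_smult_assoc_mat[of _ n n _ r]) (intro eq_matI, auto)
  qed
  have BLE: "B * (L * E) = E"
  proof -
    have "B * L * average n \<rho> (B * L) = mat_sum n n (\<lambda>g. B * L * (\<rho> g * (B * L) * \<rho> (inv g))) (carrier G)"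
      unfolding average_def using c
      by (subst mult_mat_sum) (auto intro!: carrier_matI)
    also have "\<dots> = average n \<rho> (B * L)"
      unfolding average_def
    proof (rule mat_sum_cong)
      fix g assume g: "g \<in> carrier G"
      have "B * L * (\<rho> g * (B * L) * \<rho> (inv g)) = B * (L * (\<rho> g * B)) * (L * \<rho> (inv g))"
        using g by (simp add: mult_assoc_mat c)
      also have "\<dots> = \<rho> g * (B * L) * \<rho> (inv g)"
        using g by (simp add: key mult_assoc_mat c)
      finally show "B * L * (\<rho> g * (B * L) * \<rho> (inv g)) = \<rho> g * (B * L) * \<rho> (inv g)" .
    qed
    finally have "B * L * E = E"
      unfolding E_def using BL by (simp add: mult_smult_distrib[of _ n n _ n])
    then show ?thesis using E by (simp add: mult_assoc_mat c)
  qed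
  have EW: "E *\<^sub>v w = w" if w: "w \<in> W" for w
  proof -
    have wc: "w \<in> carrier_vec n" using w W by (auto simp: subspace_iff)
    have "E *\<^sub>v w = E *\<^sub>v (B *\<^sub>v (L *\<^sub>v w))" using Wfix[OF w] by simp
    also have "\<dots> = E * B *\<^sub>v (L *\<^sub>v w)"
      using E B L wc by (simp add: assoc_mult_mat_vec[of E n n B r])
    also have "\<dots> = w" unfolding EB by (rule Wfix[OF w])
    finally show ?thesis .
  qed
  show ?thesis
  \<comment> \<open>\<open>L * E\<close> is again a left inverse of \<open>B\<close>, and
    \<open>B * (L * E) = E\<close> is the averaged projection, which commutes with the
    group.\<close>
  proof (rule that[of B r "L * E"])
    show "L * E \<in> carrier_mat r n" using L E by (rule mult_carrier_mat)
    show "L * E * B = 1\<^sub>m r"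
      using EB LB E by (simp add: mult_assoc_mat c)
    show "B *\<^sub>v (L * E *\<^sub>v w) = w" if w: "w \<in> W" for w
    proof -
      have wc: "w \<in> carrier_vec n" using w W by (auto simp: subspace_iff)
      then have "L * E *\<^sub>v w = L *\<^sub>v w"
        using L E EW[OF w] by (simp add: assoc_mult_mat_vec[of L r n E n])
      then show ?thesis using Wfix[OF w] by simp
    qed
  qed (use B BW comm BLE in simp_all)
qed

lemma irreducibleD:
  assumes "irreducible_representation G n \<rho>" "W \<subseteq> carrier_vec n" "0\<^sub>v n \<in> W"
    "\<And>v w. v \<in> W \<Longrightarrow> w \<in> W \<Longrightarrow> v + w \<in> W" "\<And>c v. v \<in> W \<Longrightarrow> c \<cdot>\<^sub>v v \<in> W"
    "\<And>g w. g \<in> carrier G \<Longrightarrow> w \<in> W \<Longrightarrow> \<rho> g *\<^sub>v w \<in> W"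
  shows "W = {0\<^sub>v n} \<or> W = carrier_vec n"
proof -
  have "VectorSpace.subspace class_ring W (module_vec TYPE(complex) n)"
    unfolding subspace_iff using assms(2-5) by simp
  moreover have "\<forall>g\<in>carrier G. \<forall>w\<in>W. \<rho> g *\<^sub>v w \<in> W"
    using assms(6) by simp
  ultimately show ?thesis
    using assms(1) unfolding irreducible_representation_def by simp
qed

lemma irreducible_rep: "irreducible_representation G n \<rho> \<Longrightarrow> representation G n \<rho>"
  by (simp add: irreducible_representation_def)

lemma irreducible_degree: "irreducible_representation G n \<rho> \<Longrightarrow> 0 < n"
  by (simp add: irreducible_representation_def)

text \<open>Maschke's theorem gives an equivariant projection \<open>B * L\<close> onto an invariant
  subspace; \<open>1 - B * L\<close> projects onto an invariant complement, and both parts are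
  compressed. The splitting is recorded as an identity of matrices so that sums over the group split
  along it as well as traces.\<close>

lemma rep_decomposition:
  assumes \<rho>: "representation G n \<rho>" and n: "0 < n" and irr: "\<not> irreducible_representation G n \<rho>"
  obtains r s \<sigma> \<tau> B L B' L' where "r < n" "s < n" "representation G r \<sigma>" "representation G s \<tau>"
    "B \<in> carrier_mat n r" "L \<in> carrier_mat r n" "B' \<in> carrier_mat n s" "L' \<in> carrier_mat s n"
    "\<And>g. g \<in> carrier G \<Longrightarrow> \<rho> g = B * \<sigma> g * L + B' * \<tau> g * L'"
    "\<And>g. g \<in> carrier G \<Longrightarrow> mat_trace (\<rho> g) = mat_trace (\<sigma> g) + mat_trace (\<tau> g)"
proof -
  obtain W where W: "VectorSpace.subspace class_ring W (module_vec TYPE(complex) n)"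
    and inv: "\<And>g w. g \<in> carrier G \<Longrightarrow> w \<in> W \<Longrightarrow> \<rho> g *\<^sub>v w \<in> W"
    and ne: "W \<noteq> {0\<^sub>v n}" "W \<noteq> carrier_vec n"
    using \<rho> n irr unfolding irreducible_representation_def by blast
  obtain r B L where B: "B \<in> carrier_mat n r" and L: "L \<in> carrier_mat r n" and LB: "L * B = 1\<^sub>m r"
    and BW: "\<And>v. v \<in> carrier_vec r \<Longrightarrow> B *\<^sub>v v \<in> W"
    and WB: "\<And>w. w \<in> W \<Longrightarrow> B *\<^sub>v (L *\<^sub>v w) = w"
    and comm: "\<And>g. g \<in> carrier G \<Longrightarrow> \<rho> g * (B * L) = B * L * \<rho> g"
    using invariant_projection[OF \<rho> W inv] by metis
  note c = carrier_matD[OF rep_carrier[OF \<rho>]] carrier_matD[OF B] carrier_matD[OF L]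
  define F where "F = 1\<^sub>m n - B * L"
  have BL: "B * L \<in> carrier_mat n n" using B L by (rule mult_carrier_mat)
  have F: "F \<in> carrier_mat n n" unfolding F_def using BL by (rule minus_carrier_mat)
  have sum: "B * L + F = 1\<^sub>m n"
    unfolding F_def by (intro eq_matI) (auto simp: c)
  have idem: "B * L * (B * L) = B * L"
  proof -
    have "B * L * (B * L) = B * (L * B * L)" by (simp add: mult_assoc_mat c)
    then show ?thesis using LB by (simp add: one_mult_mat c)
  qed
  have FF: "F * F = F"
  proof -
    have "F * F = 1\<^sub>m n * F - B * L * F"
      by (subst (1) F_def) (rule minus_mult_distrib_mat[OF one_carrier_mat BL F])
    also have "B * L * F = B * L * 1\<^sub>m n - B * L * (B * L)"
      unfolding F_def by (rule mult_minus_distrib_mat[OF BL one_carrier_mat BL])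
    also have "\<dots> = 0\<^sub>m n n" unfolding idem right_mult_one_mat[OF BL] using BL by simp
    also have "1\<^sub>m n * F - 0\<^sub>m n n = F" using F by (intro eq_matI) auto
    finally show ?thesis .
  qed
  have Fcomm: "\<rho> g * F = F * \<rho> g" if g: "g \<in> carrier G" for g
  proof -
    note \<rho>g = rep_carrier[OF \<rho> g]
    have "\<rho> g * F = \<rho> g * 1\<^sub>m n - \<rho> g * (B * L)"
      unfolding F_def by (rule mult_minus_distrib_mat[OF \<rho>g one_carrier_mat BL])
    also have "\<dots> = 1\<^sub>m n * \<rho> g - B * L * \<rho> g"
      using \<rho>g by (simp add: comm[OF g])
    also have "\<dots> = F * \<rho> g"
      unfolding F_def by (rule minus_mult_distrib_mat[OF one_carrier_mat BL \<rho>g, symmetric])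
    finally show ?thesis .
  qed
  define W' where "W' = {v \<in> carrier_vec n. F *\<^sub>v v = v}"
  have FW': "F *\<^sub>v v \<in> W'" if "v \<in> carrier_vec n" for v
    using that F FF by (simp add: W'_def assoc_mult_mat_vec[symmetric, of F n n F n])
  have "F *\<^sub>v 0\<^sub>v n = 0\<^sub>v n" using F by (intro eq_vecI) auto
  then obtain s B' L0 where B': "B' \<in> carrier_mat n s" and L0: "L0 \<in> carrier_mat s n"
    and LB0: "L0 * B' = 1\<^sub>m s" and BW': "\<And>v. v \<in> carrier_vec s \<Longrightarrow> B' *\<^sub>v v \<in> W'"
    and WB': "\<And>w. w \<in> W' \<Longrightarrow> B' *\<^sub>v (L0 *\<^sub>v w) = w"
    using F by (auto intro: subspace_coordinates[of W' n]
        simp: W'_def mult_add_distrib_mat_vec[of F n n] mult_mat_vec[of F n n])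
  \<comment> \<open>Composing with \<open>F\<close> turns \<open>L0\<close>, which is controlled
    only on \<open>W'\<close>, into a map with \<open>B' * L' = F\<close>.\<close>
  define L' where "L' = L0 * F"
  have L': "L' \<in> carrier_mat s n" unfolding L'_def using L0 F by (rule mult_carrier_mat)
  have FB': "F * B' = B'"
    using BW' F B'
    by (intro mat_eq_vecI[of _ n s]) (auto simp: W'_def assoc_mult_mat_vec[of F n n B' s])
  have BL': "B' * L' = F"
  proof (rule mat_eq_vecI)
    fix v :: "complex vec" assume v: "v \<in> carrier_vec n"
    then show "B' * L' *\<^sub>v v = F *\<^sub>v v"
      unfolding L'_def using WB'[OF FW'[OF v]] B' L0 F
      by (simp add: assoc_mult_mat_vec[of B' n s _ n] assoc_mult_mat_vec[of L0 s n F n]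
          mult_carrier_mat[OF L0 F])
  qed (use B' L' F in auto)
  have LB': "L' * B' = 1\<^sub>m s"
    unfolding L'_def using LB0 FB' L0 F B' by (simp add: assoc_mult_mat[of L0 s n F n B' s])
  have comm': "\<rho> g * (B' * L') = B' * L' * \<rho> g" if "g \<in> carrier G" for g
    unfolding BL' by (rule Fcomm[OF that])
  \<comment> \<open>The dimensions add up because \<open>r\<close> and \<open>s\<close> are the
    traces of the projections \<open>B * L\<close> and \<open>F\<close>, whose sum is the
    identity.\<close>
  have "(of_nat r + of_nat s :: complex) = mat_trace (L * B) + mat_trace (L' * B')"
    by (simp add: LB LB' mat_trace_one)
  also have "\<dots> = mat_trace (B * L) + mat_trace F"
    by (simp add: mat_trace_comm[OF B L] mat_trace_comm[OF B' L', unfolded BL'])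
  also have "\<dots> = of_nat n"
    using mat_trace_add[OF BL F] by (simp add: sum mat_trace_one)
  finally have rs: "r + s = n" by (simp only: of_nat_add[symmetric] of_nat_eq_iff)
  have "r \<noteq> 0"
  proof
    assume r: "r = 0"
    have "w = 0\<^sub>v n" if w: "w \<in> W" for w
    proof -
      have "B *\<^sub>v (L *\<^sub>v w) = 0\<^sub>v n"
        using B L r by (intro eq_vecI) (auto simp: scalar_prod_def)
      then show ?thesis using WB[OF w] by simp
    qed
    then show False using ne(1) W by (auto simp: subspace_iff)
  qed
  have "s \<noteq> 0"
  proof
    assume s: "s = 0"
    have "F = 0\<^sub>m n n"
      unfolding BL'[symmetric] using B' L' s by (intro eq_matI) (auto simp: scalar_prod_def)
    then have BL1: "B * L = 1\<^sub>m n" using sum BL by simp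
    have "v \<in> W" if v: "v \<in> carrier_vec n" for v
    proof -
      have "B *\<^sub>v (L *\<^sub>v v) \<in> W" using L v by (intro BW) simp
      moreover have "B *\<^sub>v (L *\<^sub>v v) = v"
        using v B L BL1 by (simp add: assoc_mult_mat_vec[symmetric, of B n r L n])
      ultimately show ?thesis by simp
    qed
    then show False using ne(2) W by (auto simp: subspace_iff)
  qed
  have split: "\<rho> g = \<rho> g * (B * L) + \<rho> g * (B' * L')" if g: "g \<in> carrier G" for g
  proof -
    have "\<rho> g = \<rho> g * (B * L + F)" using rep_carrier[OF \<rho> g] by (simp add: sum)
    also have "\<dots> = \<rho> g * (B * L) + \<rho> g * F"
      using rep_carrier[OF \<rho> g] BL F by (rule mult_add_distrib_mat)
    finally show ?thesis by (simp add: BL')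
  qed
  note comp = compression_representation[OF \<rho> B L LB comm]
  note comp' = compression_representation[OF \<rho> B' L' LB' comm']
  show ?thesis
  proof (rule that[OF _ _ comp(1) comp'(1) B L B' L'])
    show "r < n" "s < n" using rs \<open>r \<noteq> 0\<close> \<open>s \<noteq> 0\<close> by auto
    fix g assume g: "g \<in> carrier G"
    show "\<rho> g = B * (L * \<rho> g * B) * L + B' * (L' * \<rho> g * B') * L'"
      using split[OF g] comp(2)[OF _ g] comp'(2)[OF _ g] by simp
    have "mat_trace (\<rho> g) = mat_trace (\<rho> g * (B * L)) + mat_trace (\<rho> g * (B' * L'))"
      by (subst split[OF g], rule mat_trace_add[of _ n])
        (use rep_carrier[OF \<rho> g] B L B' L' in auto)
    then show "mat_trace (\<rho> g) = mat_trace (L * \<rho> g * B) + mat_trace (L' * \<rho> g * B')"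
      using compression_trace[OF rep_carrier[OF \<rho> g] B L LB comp(2)[OF _ g]]
        compression_trace[OF rep_carrier[OF \<rho> g] B' L' LB' comp'(2)[OF _ g]] by simp
  qed
qed

section \<open>The group algebra and the regular representation\<close>

text \<open>Induction on the degree: a reducible representation is a sum of two smaller ones placed
  between fixed matrices, and these can be pulled out of the sum over the group.\<close>

lemma algebra_element_zero:
  assumes "representation G n \<rho>"
    and irr: "\<And>n \<rho>. irreducible_representation G n \<rho> \<Longrightarrow>
      mat_sum n n (\<lambda>g. a g \<cdot>\<^sub>m \<rho> g) (carrier G) = 0\<^sub>m n n"
  shows "mat_sum n n (\<lambda>g. a g \<cdot>\<^sub>m \<rho> g) (carrier G) = 0\<^sub>m n n"
  using assms(1)
proof (induction n arbitrary: \<rho> rule: less_induct)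
  case (less n)
  consider "n = 0" | "irreducible_representation G n \<rho>" | "0 < n" "\<not> irreducible_representation G n \<rho>"
    by auto
  then show ?case
  proof cases
    case 1
    then show ?thesis by (intro eq_matI) auto
  next
    case 2
    then show ?thesis by (rule irr)
  next
    case 3
    then obtain r s \<sigma> \<tau> B L B' L' where rs: "r < n" "s < n"
      and reps: "representation G r \<sigma>" "representation G s \<tau>"
      and mats: "B \<in> carrier_mat n r" "L \<in> carrier_mat r n" "B' \<in> carrier_mat n s" "L' \<in> carrier_mat s n"
      and eq: "\<And>g. g \<in> carrier G \<Longrightarrow> \<rho> g = B * \<sigma> g * L + B' * \<tau> g * L'"
      using rep_decomposition[OF less.prems] by metis
    have zero: "mat_sum n n (\<lambda>g. C * (a g \<cdot>\<^sub>m \<theta> g) * D) (carrier G) = 0\<^sub>m n n"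
      if t: "t < n" "representation G t \<theta>" "C \<in> carrier_mat n t" "D \<in> carrier_mat t n" for t \<theta> C D
    proof -
      note c = carrier_matD[OF rep_carrier[OF t(2)]] carrier_matD[OF t(3)] carrier_matD[OF t(4)]
      have "mat_sum n n (\<lambda>g. C * (a g \<cdot>\<^sub>m \<theta> g) * D) (carrier G) =
          mat_sum n t (\<lambda>g. C * (a g \<cdot>\<^sub>m \<theta> g)) (carrier G) * D"
        by (subst mat_sum_mult) (auto intro!: carrier_matI simp: c)
      also have "mat_sum n t (\<lambda>g. C * (a g \<cdot>\<^sub>m \<theta> g)) (carrier G) =
          C * mat_sum t t (\<lambda>g. a g \<cdot>\<^sub>m \<theta> g) (carrier G)"
        by (subst mult_mat_sum) (auto intro!: carrier_matI simp: c)
      finally show ?thesis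
        using less.IH[OF t(1,2)] t(3,4) by simp
    qed
    have eq': "a g \<cdot>\<^sub>m \<rho> g = B * (a g \<cdot>\<^sub>m \<sigma> g) * L + B' * (a g \<cdot>\<^sub>m \<tau> g) * L'" if g: "g \<in> carrier G" for g
    proof -
      have C: "C * (a g \<cdot>\<^sub>m A) * D = a g \<cdot>\<^sub>m (C * A * D)"
        if "A \<in> carrier_mat t t" "C \<in> carrier_mat n t" "D \<in> carrier_mat t n" for A C D t
        using that by (simp add: mult_smult_distrib[of C n t _ t] mult_smult_assoc_mat[of _ n t _ n])
      show ?thesis
        using mats rep_carrier[OF reps(1) g] rep_carrier[OF reps(2) g]
        by (simp add: C eq[OF g] add_smult_distrib_left_mat[of _ n n])
    qed
    have "mat_sum n n (\<lambda>g. a g \<cdot>\<^sub>m \<rho> g) (carrier G) =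
        mat_sum n n (\<lambda>g. B * (a g \<cdot>\<^sub>m \<sigma> g) * L + B' * (a g \<cdot>\<^sub>m \<tau> g) * L') (carrier G)"
      using eq' by (rule mat_sum_cong)
    also have "\<dots> = mat_sum n n (\<lambda>g. B * (a g \<cdot>\<^sub>m \<sigma> g) * L) (carrier G)
        + mat_sum n n (\<lambda>g. B' * (a g \<cdot>\<^sub>m \<tau> g) * L') (carrier G)"
      using mats rep_carrier[OF reps(1)] rep_carrier[OF reps(2)]
      by (intro mat_sum_add) (auto intro!: carrier_matI)
    also have "\<dots> = 0\<^sub>m n n"
      using zero[OF rs(1) reps(1) mats(1,2)] zero[OF rs(2) reps(2) mats(3,4)] by simp
    finally show ?thesis .
  qed
qed

text \<open>Matrix indices are numbers, so the regular representation requires a numbering of the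
  group.\<close>

definition regular_enum :: "nat \<Rightarrow> 'a" where
  "regular_enum = (SOME e. bij_betw e {..<card (carrier G)} (carrier G))"

lemma regular_enum: "bij_betw regular_enum {..<card (carrier G)} (carrier G)"
proof -
  obtain e where "bij_betw e {..<card (carrier G)} (carrier G)"
    using ex_bij_betw_nat_finite[OF finite_carrier] unfolding atLeast0LessThan by blast
  then show ?thesis unfolding regular_enum_def
    by (rule someI[of "\<lambda>e. bij_betw e {..<card (carrier G)} (carrier G)"])
qed

lemma regular_enum_mem: "i < card (carrier G) \<Longrightarrow> regular_enum i \<in> carrier G"
  using bij_betwE[OF regular_enum] by auto

lemma regular_enum_eq:
  "i < card (carrier G) \<Longrightarrow> j < card (carrier G) \<Longrightarrow> regular_enum i = regular_enum j \<longleftrightarrow> i = j"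
  using bij_betw_imp_inj_on[OF regular_enum] by (auto simp: inj_on_def)

lemma regular_enum_surj: "g \<in> carrier G \<Longrightarrow> \<exists>i<card (carrier G). regular_enum i = g"
proof -
  assume "g \<in> carrier G"
  then have "g \<in> regular_enum ` {..<card (carrier G)}"
    unfolding bij_betw_imp_surj_on[OF regular_enum] .
  then show ?thesis by (rule imageE) auto
qed

definition regular_rep :: "'a \<Rightarrow> complex mat" where
  "regular_rep g = mat (card (carrier G)) (card (carrier G))
     (\<lambda>(i, j). if regular_enum i = g \<otimes> regular_enum j then 1 else 0)"

lemma regular_rep: "representation G (card (carrier G)) regular_rep"
  unfolding representation_iff[OF is_group]
proof (intro conjI ballI)
  let ?N = "card (carrier G)"
  show "regular_rep g \<in> carrier_mat ?N ?N" for g by (simp add: regular_rep_def)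
  show "regular_rep \<one> = 1\<^sub>m ?N"
    by (intro eq_matI) (auto simp: regular_rep_def regular_enum_mem regular_enum_eq)
  fix g h assume g: "g \<in> carrier G" and h: "h \<in> carrier G"
  show "regular_rep (g \<otimes> h) = regular_rep g * regular_rep h"
  proof (rule eq_matI)
    fix i j assume "i < dim_row (regular_rep g * regular_rep h)" "j < dim_col (regular_rep g * regular_rep h)"
    then have ij: "i < ?N" "j < ?N" by (auto simp: regular_rep_def)
    obtain k where k: "k < ?N" "regular_enum k = h \<otimes> regular_enum j"
      using regular_enum_surj[of "h \<otimes> regular_enum j"] h ij by (auto simp: regular_enum_mem)
    have "(regular_rep g * regular_rep h) $$ (i, j) = (\<Sum>l\<in>{0..<?N}.
        (if regular_enum i = g \<otimes> regular_enum l then 1 else 0) *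
        (if regular_enum l = h \<otimes> regular_enum j then 1 else 0))"
      using ij by (simp add: regular_rep_def scalar_prod_def)
    also have "\<dots> = (\<Sum>l\<in>{0..<?N}. if l = k then (if regular_enum i = g \<otimes> regular_enum l then 1 else 0) else 0)"
      using k regular_enum_eq by (intro sum.cong refl) (auto simp flip: k(2))
    also have "\<dots> = (if regular_enum i = g \<otimes> regular_enum k then 1 else 0)"
      using k by simp
    also have "\<dots> = regular_rep (g \<otimes> h) $$ (i, j)"
      using ij k g h by (simp add: regular_rep_def m_assoc regular_enum_mem)
    finally show "regular_rep (g \<otimes> h) $$ (i, j) = (regular_rep g * regular_rep h) $$ (i, j)" ..
  qed (simp_all add: regular_rep_def)
qed

text \<open>In the regular representation the column of the identity displays the coefficients of a
  group algebra element: the entry in the row of \<open>h\<close> is \<open>a h\<close>.\<close>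

theorem group_algebra_faithful:
  assumes irr: "\<And>n \<rho>. irreducible_representation G n \<rho> \<Longrightarrow>
      mat_sum n n (\<lambda>g. a g \<cdot>\<^sub>m \<rho> g) (carrier G) = 0\<^sub>m n n"
    and h: "h \<in> carrier G"
  shows "a h = 0"
proof -
  let ?N = "card (carrier G)"
  obtain i where i: "i < ?N" "regular_enum i = h" using regular_enum_surj[OF h] by blast
  obtain j where j: "j < ?N" "regular_enum j = \<one>" using regular_enum_surj[OF one_closed] by blast
  have "mat_sum ?N ?N (\<lambda>g. a g \<cdot>\<^sub>m regular_rep g) (carrier G) = 0\<^sub>m ?N ?N"
    by (rule algebra_element_zero[OF regular_rep irr])
  from arg_cong[OF this, of "\<lambda>A. A $$ (i, j)"]
  have "(\<Sum>g\<in>carrier G. (a g \<cdot>\<^sub>m regular_rep g) $$ (i, j)) = 0"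
    unfolding mat_sum_index[OF i(1) j(1)] using i(1) j(1) by (simp only: index_zero_mat)
  moreover have "(a g \<cdot>\<^sub>m regular_rep g) $$ (i, j) = (if g = h then a h else 0)" if "g \<in> carrier G" for g
    using i j that by (auto simp: regular_rep_def)
  ultimately show ?thesis using h finite_carrier by simp
qed

section \<open>Schur's lemma and irreducible characters\<close>

text \<open>Over the complex numbers \<open>A\<close> has an eigenvalue because
  \<open>0 < n\<close>; its eigenspace is invariant and nonzero, hence everything. Writing the
  scalar through the trace makes it computable.\<close>

theorem schur:
  assumes irr: "irreducible_representation G n \<rho>" and A: "A \<in> carrier_mat n n"
    and comm: "\<And>g. g \<in> carrier G \<Longrightarrow> \<rho> g * A = A * \<rho> g"
  shows "A = (mat_trace A / of_nat n) \<cdot>\<^sub>m 1\<^sub>m n"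
proof -
  note \<rho> = rep_carrier[OF irreducible_rep[OF irr]]
  have n: "0 < n" using irr by (rule irreducible_degree)
  obtain c v where v: "v \<in> carrier_vec n" "v \<noteq> 0\<^sub>v n" "A *\<^sub>v v = c \<cdot>\<^sub>v v"
    using spectrum_non_empty[OF A n] A unfolding spectrum_def eigenvalue_def eigenvector_def by auto
  define W where "W = {v \<in> carrier_vec n. A *\<^sub>v v = c \<cdot>\<^sub>v v}"
  have "W = {0\<^sub>v n} \<or> W = carrier_vec n"
  proof (rule irreducibleD[OF irr])
    show "0\<^sub>v n \<in> W" using A by (auto simp: W_def intro!: eq_vecI)
    show "v + w \<in> W" if "v \<in> W" "w \<in> W" for v w
      using that A by (auto simp: W_def mult_add_distrib_mat_vec[of A n n] smult_add_distrib_vec[of _ n])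
    show "k \<cdot>\<^sub>v v \<in> W" if "v \<in> W" for k v
      using that A by (auto simp: W_def mult_mat_vec[of A n n] smult_smult_assoc mult.commute)
    show "\<rho> g *\<^sub>v w \<in> W" if g: "g \<in> carrier G" and w: "w \<in> W" for g w
    proof -
      have wc: "w \<in> carrier_vec n" "A *\<^sub>v w = c \<cdot>\<^sub>v w" using w by (auto simp: W_def)
      have "A *\<^sub>v (\<rho> g *\<^sub>v w) = A * \<rho> g *\<^sub>v w"
        using A \<rho>[OF g] wc by (simp add: assoc_mult_mat_vec[of A n n "\<rho> g" n])
      also have "\<dots> = \<rho> g *\<^sub>v (A *\<^sub>v w)"
        using A \<rho>[OF g] wc unfolding comm[OF g, symmetric]
        by (simp only: assoc_mult_mat_vec[of "\<rho> g" n n A n])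
      also have "\<dots> = c \<cdot>\<^sub>v (\<rho> g *\<^sub>v w)"
        using \<rho>[OF g] wc by (simp add: mult_mat_vec[of "\<rho> g" n n])
      finally show ?thesis using \<rho>[OF g] wc by (simp add: W_def)
    qed
  qed (auto simp: W_def)
  then have W: "W = carrier_vec n" using v by (auto simp: W_def)
  have A_eq: "A = c \<cdot>\<^sub>m 1\<^sub>m n"
  proof (rule mat_eq_vecI[OF A])
    fix v :: "complex vec" assume v: "v \<in> carrier_vec n"
    then have "A *\<^sub>v v = c \<cdot>\<^sub>v v" using W by (auto simp: W_def)
    also have "\<dots> = (c \<cdot>\<^sub>m 1\<^sub>m n) *\<^sub>v v"
      using v by (intro eq_vecI) (auto simp: smult_scalar_prod_distrib[of _ n])
    finally show "A *\<^sub>v v = (c \<cdot>\<^sub>m 1\<^sub>m n) *\<^sub>v v" .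
  qed simp
  have "mat_trace A = c * of_nat n" unfolding A_eq by (simp add: mat_trace_smult mat_trace_one)
  then show ?thesis using A_eq n by simp
qed

lemma average_scalar:
  assumes irr: "irreducible_representation G n \<rho>" and A: "A \<in> carrier_mat n n"
  shows "average n \<rho> A = (of_nat (card (carrier G)) * mat_trace A / of_nat n) \<cdot>\<^sub>m 1\<^sub>m n"
proof -
  note \<rho> = irreducible_rep[OF irr]
  note c = carrier_matD[OF rep_carrier[OF \<rho>]] carrier_matD[OF A]
  have "mat_trace (average n \<rho> A) = (\<Sum>g\<in>carrier G. mat_trace (\<rho> g * A * \<rho> (inv g)))"
    unfolding average_def by (intro mat_trace_mat_sum) (auto intro!: carrier_matI simp: c)
  also have "\<dots> = (\<Sum>g\<in>carrier G. mat_trace A)"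
  proof (intro sum.cong refl)
    fix g assume g: "g \<in> carrier G"
    have "mat_trace (\<rho> g * A * \<rho> (inv g)) = mat_trace (\<rho> (inv g) * (\<rho> g * A))"
      using g by (intro mat_trace_comm[of _ n n]) (auto intro!: carrier_matI simp: c)
    also have "\<rho> (inv g) * (\<rho> g * A) = \<rho> (inv g) * \<rho> g * A"
      using g by (simp add: mult_assoc_mat c)
    also have "\<dots> = A" using g A by (simp add: rep_inv[OF \<rho>])
    finally show "mat_trace (\<rho> g * A * \<rho> (inv g)) = mat_trace A" .
  qed
  finally show ?thesis
    using schur[OF irr average_carrier average_commute[OF \<rho> A]] by simp
qed

text \<open>Putting the matrix unit \<open>U i j\<close> between \<open>\<rho> g\<close> and
  \<open>\<rho> (inv g)\<close> isolates the product of two diagonal entries, so the sum over the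
  group is an entry of an average, which Schur's lemma evaluates. Only \<open>i = j\<close>
  survives, \<open>n\<close> times with value \<open>|G| / n\<close>. The element
  \<open>inv g\<close> stands in for complex conjugation, which keeps the argument
  algebraic.\<close>

theorem character_norm:
  assumes irr: "irreducible_representation G n \<rho>"
  shows "(\<Sum>g\<in>carrier G. mat_trace (\<rho> g) * mat_trace (\<rho> (inv g))) = of_nat (card (carrier G))"
proof -
  note \<rho> = irreducible_rep[OF irr]
  note c = carrier_matD[OF rep_carrier[OF \<rho>]]
  have n: "0 < n" using irr by (rule irreducible_degree)
  define U :: "nat \<Rightarrow> nat \<Rightarrow> complex mat" where
    "U i j = mat n n (\<lambda>(k, l). if k = i \<and> l = j then 1 else 0)" for i j
  have U: "U i j \<in> carrier_mat n n" for i j by (simp add: U_def)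
  have trU: "mat_trace (U i j) = (if i = j then 1 else 0)" if "i < n" for i j
    using that by (auto simp: mat_trace_def U_def)
  have entry: "\<rho> g $$ (i, i) * \<rho> (inv g) $$ (j, j) = (\<rho> g * U i j * \<rho> (inv g)) $$ (i, j)"
    if g: "g \<in> carrier G" and ij: "i < n" "j < n" for g i j
  proof -
    have "(\<rho> g * U i j) $$ (i, l) = (if l = j then \<rho> g $$ (i, i) else 0)" if "l < n" for l
    proof -
      have "(\<rho> g * U i j) $$ (i, l) = (\<Sum>k\<in>{0..<n}. \<rho> g $$ (i, k) * U i j $$ (k, l))"
        using g ij that c carrier_matD[OF U[of i j]] by (simp add: scalar_prod_def)
      also have "\<dots> = (\<Sum>k\<in>{0..<n}. if k = i then (if l = j then \<rho> g $$ (i, i) else 0) else 0)"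
        using that by (intro sum.cong) (auto simp: U_def)
      finally have "(\<rho> g * U i j) $$ (i, l) =
          (\<Sum>k\<in>{0..<n}. if k = i then (if l = j then \<rho> g $$ (i, i) else 0) else 0)" .
      then show ?thesis using ij by simp
    qed
    then have "(\<rho> g * U i j * \<rho> (inv g)) $$ (i, j) =
        (\<Sum>l\<in>{0..<n}. (if l = j then \<rho> g $$ (i, i) else 0) * \<rho> (inv g) $$ (l, j))"
      using g ij carrier_matD[OF U[of i j]] c
      by (subst index_mult_mat) (auto simp: scalar_prod_def simp del: index_mult_mat(1) intro!: sum.cong)
    also have "\<dots> = (\<Sum>l\<in>{0..<n}. if l = j then \<rho> g $$ (i, i) * \<rho> (inv g) $$ (j, j) else 0)"
      by (intro sum.cong) auto
    also have "\<dots> = \<rho> g $$ (i, i) * \<rho> (inv g) $$ (j, j)"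
      using ij by simp
    finally show ?thesis by simp
  qed
  have "(\<Sum>g\<in>carrier G. mat_trace (\<rho> g) * mat_trace (\<rho> (inv g))) =
      (\<Sum>g\<in>carrier G. \<Sum>i<n. \<Sum>j<n. (\<rho> g * U i j * \<rho> (inv g)) $$ (i, j))"
    using c by (intro sum.cong refl) (simp add: mat_trace_def sum_product entry)
  also have "\<dots> = (\<Sum>i<n. \<Sum>j<n. \<Sum>g\<in>carrier G. (\<rho> g * U i j * \<rho> (inv g)) $$ (i, j))"
    by (subst sum.swap, intro sum.cong refl, rule sum.swap)
  also have "\<dots> = (\<Sum>i<n. \<Sum>j<n. average n \<rho> (U i j) $$ (i, j))"
    by (intro sum.cong refl) (simp add: average_def)
  also have "\<dots> = (\<Sum>i<n. \<Sum>j<n. if j = i then of_nat (card (carrier G)) / of_nat n else 0)"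
    by (intro sum.cong refl) (simp add: average_scalar[OF irr U] trU)
  also have "\<dots> = of_nat (card (carrier G))" using n by simp
  finally show ?thesis .
qed

text \<open>By Schur's lemma the normalized difference of the two class sums acts on an irreducible
  representation by a multiple of \<open>mat_trace (\<rho> x) - mat_trace (\<rho> y)\<close>.\<close>

theorem irreducible_characters_separate:
  assumes x: "x \<in> carrier G" and y: "y \<in> carrier G"
    and eq: "\<And>n \<rho>. irreducible_representation G n \<rho> \<Longrightarrow> mat_trace (\<rho> x) = mat_trace (\<rho> y)"
  shows "\<exists>g\<in>carrier G. g \<otimes> x \<otimes> inv g = y"
proof (rule ccontr)
  assume not: "\<not> ?thesis"
  \<comment> \<open>The coefficients of the difference of the two class sums, each weighted by a
    centralizer order. If \<open>x\<close> and \<open>y\<close> are not conjugate, the value at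
    \<open>y\<close> is minus the order of the centralizer of \<open>y\<close>.\<close>
  define a :: "'a \<Rightarrow> complex" where
    "a h = (\<Sum>g\<in>carrier G. (if g \<otimes> x \<otimes> inv g = h then 1 else 0) - (if g \<otimes> y \<otimes> inv g = h then 1 else 0))" for h
  have "a y = 0"
  proof (rule group_algebra_faithful[OF _ y])
    fix n \<rho> assume irr: "irreducible_representation G n \<rho>"
    note \<rho> = irreducible_rep[OF irr]
    have avg: "average n \<rho> (\<rho> z) $$ (i, j) = (\<Sum>h\<in>carrier G. \<Sum>g\<in>carrier G. (if g \<otimes> z \<otimes> inv g = h then 1 else 0) * \<rho> h $$ (i, j))"
      if z: "z \<in> carrier G" and ij: "i < n" "j < n" for z i j
    proof -
      have "average n \<rho> (\<rho> z) $$ (i, j) = (\<Sum>g\<in>carrier G. \<rho> (g \<otimes> z \<otimes> inv g) $$ (i, j))"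
        using ij z by (simp add: average_def rep_mult[OF \<rho>])
      also have "\<dots> = (\<Sum>g\<in>carrier G. \<Sum>h\<in>carrier G. if h = g \<otimes> z \<otimes> inv g then \<rho> h $$ (i, j) else 0)"
        using z finite_carrier by (intro sum.cong refl) simp
      also have "\<dots> = (\<Sum>h\<in>carrier G. \<Sum>g\<in>carrier G. if h = g \<otimes> z \<otimes> inv g then \<rho> h $$ (i, j) else 0)"
        by (rule sum.swap)
      also have "\<dots> = (\<Sum>h\<in>carrier G. \<Sum>g\<in>carrier G. (if g \<otimes> z \<otimes> inv g = h then 1 else 0) * \<rho> h $$ (i, j))"
        by (intro sum.cong refl) simp
      finally show ?thesis .
    qed
    have "average n \<rho> (\<rho> x) = average n \<rho> (\<rho> y)"
      using x y by (simp add: average_scalar[OF irr] rep_carrier[OF \<rho>] eq[OF irr])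
    then have same: "average n \<rho> (\<rho> x) $$ (i, j) - average n \<rho> (\<rho> y) $$ (i, j) = 0" for i j
      by simp
    show "mat_sum n n (\<lambda>g. a g \<cdot>\<^sub>m \<rho> g) (carrier G) = 0\<^sub>m n n"
    proof (rule eq_matI)
      fix i j assume "i < dim_row (0\<^sub>m n n :: complex mat)" "j < dim_col (0\<^sub>m n n :: complex mat)"
      then have ij: "i < n" "j < n" by auto
      have "mat_sum n n (\<lambda>g. a g \<cdot>\<^sub>m \<rho> g) (carrier G) $$ (i, j) = (\<Sum>h\<in>carrier G. a h * \<rho> h $$ (i, j))"
        using ij carrier_matD[OF rep_carrier[OF \<rho>]] by simp
      also have "\<dots> = average n \<rho> (\<rho> x) $$ (i, j) - average n \<rho> (\<rho> y) $$ (i, j)"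
        unfolding avg[OF x ij] avg[OF y ij] a_def
        by (simp add: sum_distrib_right sum_subtractf[symmetric] left_diff_distrib)
      finally show "mat_sum n n (\<lambda>g. a g \<cdot>\<^sub>m \<rho> g) (carrier G) $$ (i, j) = 0\<^sub>m n n $$ (i, j)"
        using same ij by simp
    qed simp_all
  qed
  moreover have "a y = - (\<Sum>g\<in>carrier G. if g \<otimes> y \<otimes> inv g = y then 1 else 0)"
  proof -
    have "a y = (\<Sum>g\<in>carrier G. - (if g \<otimes> y \<otimes> inv g = y then 1 else 0))"
      unfolding a_def using not by (intro sum.cong refl) auto
    then show ?thesis by (simp only: sum_negf)
  qed
  moreover have "(\<Sum>g\<in>carrier G. if g \<otimes> y \<otimes> inv g = y then 1 else 0 :: complex) =
      of_nat (card {g \<in> carrier G. g \<otimes> y \<otimes> inv g = y})"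
    using finite_carrier by (simp flip: sum.inter_filter)
  moreover have "card {g \<in> carrier G. g \<otimes> y \<otimes> inv g = y} \<noteq> 0"
    using finite_carrier y by (auto intro!: exI[of _ \<one>])
  ultimately show False by simp
qed

section \<open>Linear representations and the derived subgroup\<close>

lemma linear_rep_commute:
  assumes "representation G 1 \<rho>" "g \<in> carrier G" "h \<in> carrier G"
  shows "\<rho> g * \<rho> h = \<rho> h * \<rho> g"
  using rep_carrier[OF assms(1,2)] rep_carrier[OF assms(1,3)]
  by (intro eq_matI) (auto simp: scalar_prod_def)

lemma linear_rep_derived:
  assumes \<rho>: "representation G 1 \<rho>" and u: "u \<in> derived G (carrier G)"
  shows "\<rho> u = 1\<^sub>m 1"
  using u unfolding derived_def
proof (induction rule: generate.induct)
  case one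
  then show ?case by (rule rep_one[OF \<rho>])
next
  case (incl h)
  then obtain x y where xy: "x \<in> carrier G" "y \<in> carrier G" "h = x \<otimes> y \<otimes> inv x \<otimes> inv y" by blast
  note c = carrier_matD[OF rep_carrier[OF \<rho>]]
  have "\<rho> h = \<rho> x * \<rho> y * \<rho> (inv x) * \<rho> (inv y)"
    using xy by (simp add: rep_mult[OF \<rho>])
  also have "\<dots> = \<rho> y * \<rho> x * \<rho> (inv x) * \<rho> (inv y)"
    using linear_rep_commute[OF \<rho> xy(1,2)] by simp
  also have "\<dots> = \<rho> y * (\<rho> x * \<rho> (inv x)) * \<rho> (inv y)"
    using xy by (simp add: mult_assoc_mat c)
  also have "\<dots> = 1\<^sub>m 1"
    using xy by (simp add: rep_inv[OF \<rho>] one_mult_mat c)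
  finally show ?case .
next
  case (inv h)
  then obtain x y where xy: "x \<in> carrier G" "y \<in> carrier G" "h = x \<otimes> y \<otimes> inv x \<otimes> inv y" by blast
  note c = carrier_matD[OF rep_carrier[OF \<rho>]]
  have "inv h = y \<otimes> x \<otimes> inv y \<otimes> inv x"
    using xy by (simp add: inv_mult_group m_assoc)
  then have "\<rho> (inv h) = \<rho> y * \<rho> x * \<rho> (inv y) * \<rho> (inv x)"
    using xy by (simp add: rep_mult[OF \<rho>])
  also have "\<dots> = \<rho> x * \<rho> y * \<rho> (inv y) * \<rho> (inv x)"
    using linear_rep_commute[OF \<rho> xy(1,2)] by simp
  also have "\<dots> = \<rho> x * (\<rho> y * \<rho> (inv y)) * \<rho> (inv x)"
    using xy by (simp add: mult_assoc_mat c)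
  also have "\<dots> = 1\<^sub>m 1"
    using xy by (simp add: rep_inv[OF \<rho>] one_mult_mat c)
  finally show ?case .
next
  case (eng h1 h2)
  have "generate G (\<Union>h\<in>carrier G. \<Union>k\<in>carrier G. {h \<otimes> k \<otimes> inv h \<otimes> inv k}) \<subseteq> carrier G"
    by (rule generate_incl) auto
  then have "h1 \<in> carrier G" "h2 \<in> carrier G" using eng by blast+
  then show ?case using eng by (simp add: rep_mult[OF \<rho>])
qed

text \<open>If all irreducible representations had degree \<open>1\<close>, the group algebra
  element \<open>x y - y x\<close> would act as zero in each of them.\<close>

lemma nonlinear_irreducible_exists:
  assumes "\<not> comm_group G"
  shows "\<exists>n \<rho>. irreducible_representation G n \<rho> \<and> 1 < n"
proof (rule ccontr)
  assume *: "\<not> ?thesis"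
  obtain x y where xy: "x \<in> carrier G" "y \<in> carrier G" "x \<otimes> y \<noteq> y \<otimes> x"
    using assms group_comm_groupI by blast
  define a :: "'a \<Rightarrow> complex" where
    "a g = (if g = x \<otimes> y then 1 else 0) - (if g = y \<otimes> x then 1 else 0)" for g
  have "a (x \<otimes> y) = 0"
  proof (rule group_algebra_faithful)
    fix n \<rho> assume irr: "irreducible_representation G n \<rho>"
    then have n: "n = 1" using * irreducible_degree[OF irr] by (cases "1 < n") auto
    note \<rho> = irreducible_rep[OF irr]
    have eq: "\<rho> (x \<otimes> y) = \<rho> (y \<otimes> x)"
      using linear_rep_commute[OF \<rho>[unfolded n] xy(1,2)] xy by (simp add: rep_mult[OF \<rho>])
    show "mat_sum n n (\<lambda>g. a g \<cdot>\<^sub>m \<rho> g) (carrier G) = 0\<^sub>m n n"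
    proof (rule eq_matI)
      fix i j assume "i < dim_row (0\<^sub>m n n :: complex mat)" "j < dim_col (0\<^sub>m n n :: complex mat)"
      then have ij: "i < n" "j < n" by auto
      have "mat_sum n n (\<lambda>g. a g \<cdot>\<^sub>m \<rho> g) (carrier G) $$ (i, j) = (\<Sum>g\<in>carrier G. a g * \<rho> g $$ (i, j))"
        using ij carrier_matD[OF rep_carrier[OF \<rho>]] by simp
      also have "\<dots> = (\<Sum>g\<in>carrier G. (if g = x \<otimes> y then \<rho> g $$ (i, j) else 0)
          - (if g = y \<otimes> x then \<rho> g $$ (i, j) else 0))"
        by (intro sum.cong refl) (simp add: a_def)
      also have "\<dots> = 0" using xy finite_carrier by (simp add: sum_subtractf eq)
      finally show "mat_sum n n (\<lambda>g. a g \<cdot>\<^sub>m \<rho> g) (carrier G) $$ (i, j) = 0\<^sub>m n n $$ (i, j)"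
        using ij by simp
    qed simp_all
  qed (use xy in simp)
  then show False using xy by (simp add: a_def)
qed

text \<open>By Schur's lemma every matrix would be scalar, which fails for an off-diagonal matrix
  unit when \<open>n > 1\<close>.\<close>

lemma scalar_irreducible_linear:
  assumes irr: "irreducible_representation G n \<rho>"
    and comm: "\<And>g A. g \<in> carrier G \<Longrightarrow> A \<in> carrier_mat n n \<Longrightarrow> \<rho> g * A = A * \<rho> g"
  shows "n = 1"
proof (rule ccontr)
  assume "n \<noteq> 1"
  then have n: "1 < n" using irreducible_degree[OF irr] by linarith
  define A :: "complex mat" where "A = mat n n (\<lambda>(i, j). if i = 0 \<and> j = 1 then 1 else 0)"
  have A: "A \<in> carrier_mat n n" by (simp add: A_def)
  have "A $$ (0, 1) = ((mat_trace A / of_nat n) \<cdot>\<^sub>m 1\<^sub>m n) $$ (0, 1)"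
    using schur[OF irr A comm[OF _ A]] by simp
  then show False using n by (simp add: A_def)
qed

text \<open>If every nonlinear irreducible character vanishes at \<open>y\<close>, the trace at \<open>y\<close> counts the linear
  constituents. The regular representation has trace \<open>0\<close> away from the identity, but it contains
  the trivial one.\<close>

lemma derived_vanish_imp_one:
  assumes y: "y \<in> derived G (carrier G)"
    and vanish: "\<And>n \<rho>. irreducible_representation G n \<rho> \<Longrightarrow> 1 < n \<Longrightarrow> mat_trace (\<rho> y) = 0"
  shows "y = \<one>"
proof (rule ccontr)
  assume ne: "y \<noteq> \<one>"
  have yc: "y \<in> carrier G" using y derived_in_carrier[of "carrier G"] by auto
  \<comment> \<open>\<open>k\<close> is the number of linear constituents. The second clause says
    that without any of them the sum of all group elements acts as zero, which expresses the absence
    of the trivial representation.\<close>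
  have count: "\<exists>k. mat_trace (\<rho> y) = of_nat k \<and>
      (k = 0 \<longrightarrow> mat_sum n n \<rho> (carrier G) = 0\<^sub>m n n)"
    if "representation G n \<rho>" for n \<rho>
    using that
  proof (induction n arbitrary: \<rho> rule: less_induct)
    case (less n)
    note \<rho> = less.prems
    consider "n = 0" | "irreducible_representation G n \<rho>" "n = 1"
      | "irreducible_representation G n \<rho>" "1 < n" | "0 < n" "\<not> irreducible_representation G n \<rho>"
      by linarith
    then show ?case
    proof cases
      case 1
      then have "mat_trace (\<rho> y) = of_nat 0" "mat_sum n n \<rho> (carrier G) = 0\<^sub>m n n"
        using rep_carrier[OF \<rho> yc] by (auto simp: mat_trace_def intro!: eq_matI)
      then show ?thesis by blast
    next
      case 2
      then have "mat_trace (\<rho> y) = of_nat 1"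
        using linear_rep_derived[of \<rho> y] \<rho> y by (simp add: mat_trace_one)
      then show ?thesis by (intro exI[of _ 1]) simp
    next
      case 3
      let ?S = "mat_sum n n \<rho> (carrier G)"
      have S: "?S \<in> carrier_mat n n" by simp
      have left: "\<rho> h * ?S = ?S" if h: "h \<in> carrier G" for h
      proof -
        have "\<rho> h * ?S = mat_sum n n (\<lambda>g. \<rho> (h \<otimes> g)) (carrier G)"
          using h carrier_matD[OF rep_carrier[OF \<rho>]] rep_carrier[OF \<rho>]
          by (subst mult_mat_sum) (auto simp: rep_mult[OF \<rho>] intro: mat_sum_cong)
        also have "\<dots> = ?S"
          by (rule mat_sum_reindex[OF bij_betw_mult_left[OF h]])
        finally show ?thesis .
      qed
      have right: "?S * \<rho> h = ?S" if h: "h \<in> carrier G" for h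
      proof -
        have "?S * \<rho> h = mat_sum n n (\<lambda>g. \<rho> (g \<otimes> h)) (carrier G)"
          using h carrier_matD[OF rep_carrier[OF \<rho>]] rep_carrier[OF \<rho>]
          by (subst mat_sum_mult) (auto simp: rep_mult[OF \<rho>] intro: mat_sum_cong)
        also have "\<dots> = ?S"
          by (rule mat_sum_reindex[OF bij_betw_mult_right[OF h]])
        finally show ?thesis .
      qed
      define c where "c = mat_trace ?S / of_nat n"
      have Sc: "?S = c \<cdot>\<^sub>m 1\<^sub>m n"
        unfolding c_def by (rule schur[OF 3(1) S]) (simp add: left right)
      \<comment> \<open>Multiplication by \<open>h\<close> does not change the group sum, so a
        nonzero \<open>c\<close> would make every \<open>\<rho> h\<close> the identity.\<close>
      have "c = 0"
      proof (rule ccontr)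
        assume c: "c \<noteq> 0"
        have "\<rho> h = 1\<^sub>m n" if h: "h \<in> carrier G" for h
        proof -
          have "c \<cdot>\<^sub>m \<rho> h = \<rho> h * (c \<cdot>\<^sub>m 1\<^sub>m n)"
            using rep_carrier[OF \<rho> h] by (simp add: mult_smult_distrib[of _ n n _ n])
          also have "\<dots> = c \<cdot>\<^sub>m 1\<^sub>m n" using left[OF h] unfolding Sc .
          finally have eq: "c \<cdot>\<^sub>m \<rho> h = c \<cdot>\<^sub>m 1\<^sub>m n" .
          show ?thesis
          proof (rule eq_matI)
            fix i j assume "i < dim_row (1\<^sub>m n :: complex mat)" "j < dim_col (1\<^sub>m n :: complex mat)"
            then show "\<rho> h $$ (i, j) = 1\<^sub>m n $$ (i, j)"
              using arg_cong[OF eq, of "\<lambda>A. A $$ (i, j)"] c rep_carrier[OF \<rho> h] by auto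
          qed (use rep_carrier[OF \<rho> h] in auto)
        qed
        then have "n = 1" using 3(1) by (intro scalar_irreducible_linear) auto
        then show False using 3(2) by simp
      qed
      then have "?S = 0\<^sub>m n n" unfolding Sc by (intro eq_matI) auto
      then show ?thesis using vanish[OF 3] by (intro exI[of _ 0]) simp
    next
      case 4
      then obtain r s \<sigma> \<tau> B L B' L' where rs: "r < n" "s < n"
        and reps: "representation G r \<sigma>" "representation G s \<tau>"
        and mats: "B \<in> carrier_mat n r" "L \<in> carrier_mat r n" "B' \<in> carrier_mat n s" "L' \<in> carrier_mat s n"
        and eq: "\<And>g. g \<in> carrier G \<Longrightarrow> \<rho> g = B * \<sigma> g * L + B' * \<tau> g * L'"
        and tr: "\<And>g. g \<in> carrier G \<Longrightarrow> mat_trace (\<rho> g) = mat_trace (\<sigma> g) + mat_trace (\<tau> g)"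
        using rep_decomposition[OF \<rho>] by metis
      obtain k where k: "mat_trace (\<sigma> y) = of_nat k" "k = 0 \<longrightarrow> mat_sum r r \<sigma> (carrier G) = 0\<^sub>m r r"
        using less.IH[OF rs(1) reps(1)] by blast
      obtain l where l: "mat_trace (\<tau> y) = of_nat l" "l = 0 \<longrightarrow> mat_sum s s \<tau> (carrier G) = 0\<^sub>m s s"
        using less.IH[OF rs(2) reps(2)] by blast
      have factor: "mat_sum n n (\<lambda>g. C * \<theta> g * D) (carrier G) = C * mat_sum t t \<theta> (carrier G) * D"
        if t: "representation G t \<theta>" "C \<in> carrier_mat n t" "D \<in> carrier_mat t n" for t \<theta> C D
      proof -
        note c = carrier_matD[OF rep_carrier[OF t(1)]] carrier_matD[OF t(2)] carrier_matD[OF t(3)]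
        have "mat_sum n n (\<lambda>g. C * \<theta> g * D) (carrier G) = mat_sum n t (\<lambda>g. C * \<theta> g) (carrier G) * D"
          by (subst mat_sum_mult) (auto intro!: carrier_matI simp: c)
        also have "mat_sum n t (\<lambda>g. C * \<theta> g) (carrier G) = C * mat_sum t t \<theta> (carrier G)"
          by (subst mult_mat_sum) (auto intro!: carrier_matI simp: c)
        finally show ?thesis .
      qed
      have "mat_sum n n \<rho> (carrier G) = mat_sum n n (\<lambda>g. B * \<sigma> g * L + B' * \<tau> g * L') (carrier G)"
        using eq by (rule mat_sum_cong)
      also have "\<dots> = mat_sum n n (\<lambda>g. B * \<sigma> g * L) (carrier G) + mat_sum n n (\<lambda>g. B' * \<tau> g * L') (carrier G)"
        using mats by (intro mat_sum_add) (auto intro!: carrier_matI)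
      also have "\<dots> = B * mat_sum r r \<sigma> (carrier G) * L + B' * mat_sum s s \<tau> (carrier G) * L'"
        using factor[OF reps(1) mats(1,2)] factor[OF reps(2) mats(3,4)] by simp
      finally have "k + l = 0 \<longrightarrow> mat_sum n n \<rho> (carrier G) = 0\<^sub>m n n"
        using k l mats by auto
      then show ?thesis
        using k l tr[OF yc] by (intro exI[of _ "k + l"]) simp
    qed
  qed
  let ?N = "card (carrier G)"
  \<comment> \<open>Left multiplication by \<open>y\<close> has no fixed point, so the regular trace
    at \<open>y\<close> is \<open>0\<close>. The group sum, however, has entry \<open>1\<close> at
    every position and is not zero.\<close>
  have "regular_rep y $$ (i, i) = 0" if "i < ?N" for i
    using that ne yc regular_enum_mem[of i] r_cancel_one'[of "regular_enum i" y]
    by (auto simp: regular_rep_def)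
  then have "mat_trace (regular_rep y) = 0"
    by (simp add: mat_trace_def regular_rep_def)
  then have "mat_sum ?N ?N regular_rep (carrier G) = 0\<^sub>m ?N ?N"
    using count[OF regular_rep] by auto
  then have "mat_sum ?N ?N regular_rep (carrier G) $$ (0, 0) = 0"
    using order_pos by simp
  moreover have "mat_sum ?N ?N regular_rep (carrier G) $$ (0, 0) = (\<Sum>g\<in>carrier G. if g = \<one> then 1 else 0)"
    using order_pos regular_enum_mem[of 0] r_cancel_one'[of "regular_enum 0"]
    by (auto simp: regular_rep_def intro!: sum.cong)
  ultimately show False using finite_carrier by simp
qed

end

section \<open>Elementary abelian groups\<close>

text \<open>An isomorphism of \<open>H\<close> with the space of \<open>N\<close>-tuples over the field with \<open>p\<close> elements, given by
  integer representatives of the coordinates.\<close>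

definition linear_coordinates ::
  "nat \<Rightarrow> ('a, 'b) monoid_scheme \<Rightarrow> 'a set \<Rightarrow> nat \<Rightarrow> ('a \<Rightarrow> nat \<Rightarrow> int) \<Rightarrow> bool" where
  "linear_coordinates p G H N f \<longleftrightarrow>
     (\<forall>x\<in>H. \<forall>y\<in>H. \<forall>k<N. [f (x \<otimes>\<^bsub>G\<^esub> y) k = f x k + f y k] (mod int p)) \<and>
     (\<forall>x\<in>H. (\<forall>k<N. int p dvd f x k) \<longrightarrow> x = \<one>\<^bsub>G\<^esub>) \<and>
     (\<forall>v. \<exists>x\<in>H. \<forall>k<N. [f x k = v k] (mod int p)) \<and>
     card H = p ^ N"

context comm_group
begin

text \<open>Comparing the two factorizations puts \<open>x^(i - j)\<close> into \<open>H\<close>. If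
  \<open>p\<close> did not divide \<open>i - j\<close>, Bezout's identity would make
  \<open>x\<close> a power of that element.\<close>

lemma coset_representation_unique:
  assumes p: "Factorial_Ring.prime p" and H: "subgroup H G" and x: "x \<in> carrier G" "x \<notin> H" "x [^] p = \<one>"
    and h: "h \<in> H" "h' \<in> H" and eq: "h \<otimes> x [^] (i :: nat) = h' \<otimes> x [^] (j :: nat)"
  shows "[int i = int j] (mod int p)" "h = h'"
proof -
  interpret H: subgroup H G by fact
  have hc: "h \<in> carrier G" "h' \<in> carrier G" using h by auto
  have "x [^] (int i - int j) = inv h \<otimes> h'"
  proof -
    have "x [^] (int i - int j) = x [^] i \<otimes> inv (x [^] j)"
      using x by (simp add: int_pow_diff int_pow_int)
    also have "x [^] i = inv h \<otimes> h' \<otimes> x [^] j"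
      using eq hc x by (metis inv_solve_left m_assoc m_closed nat_pow_closed inv_closed)
    finally show ?thesis using hc x by (simp add: m_assoc)
  qed
  then have mem: "x [^] (int i - int j) \<in> H" using h by simp
  have xp: "x [^] (int p * k) = \<one>" for k :: int
    using x by (simp add: int_pow_pow[symmetric] int_pow_int)
  show cong: "[int i = int j] (mod int p)"
  proof (rule ccontr)
    assume "\<not> ?thesis"
    then have "\<not> int p dvd int i - int j" by (simp add: cong_iff_dvd_diff)
    then have "coprime (int p) (int i - int j)"
      using p by (intro prime_imp_coprime) auto
    then obtain a b where ab: "a * int p + b * (int i - int j) = 1"
      using bezout_int[of "int p" "int i - int j"] by (auto simp: coprime_iff_gcd_eq_1)
    have "x = x [^] (int p * a + (int i - int j) * b)"
      using ab x by (simp add: mult.commute)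
    also have "\<dots> = (x [^] (int i - int j)) [^] b"
      using x xp by (simp add: int_pow_mult int_pow_pow)
    also have "\<dots> \<in> H"
      using mem by (rule subgroup_int_pow_closed[OF H])
    finally show False using x by simp
  qed
  then obtain c where "int i - int j = int p * c"
    by (auto simp: cong_iff_dvd_diff)
  then have "inv h \<otimes> h' = \<one>"
    using xp[of c] \<open>x [^] (int i - int j) = inv h \<otimes> h'\<close> by simp
  then show "h = h'" using hc by (metis inv_equality inv_inv inv_closed)
qed

text \<open>Adjoining \<open>x\<close> to \<open>H\<close> adds one dimension. The new coordinate of
  \<open>h x^j\<close> is the exponent \<open>j\<close>, well defined modulo \<open>p\<close>
  because \<open>x^j\<close> lies outside \<open>H\<close> whenever \<open>p\<close> does not divide
  \<open>j\<close>.\<close>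

lemma linear_coordinates_extend:
  assumes p: "Factorial_Ring.prime p" and H: "subgroup H G" and f: "linear_coordinates p G H N f"
    and x: "x \<in> carrier G" "x \<notin> H" "x [^] p = \<one>"
  shows "\<exists>H' f'. subgroup H' G \<and> H \<subset> H' \<and> linear_coordinates p G H' (Suc N) f'"
proof -
  interpret H: subgroup H G by fact
  have p1: "1 < p" using p by (rule prime_gt_1_nat)
  \<comment> \<open>The exponents range over all natural numbers, which makes closure under products
    immediate; they are then determined only modulo \<open>p\<close>.\<close>
  define H' where "H' = {h \<otimes> x [^] (j :: nat) | h j. h \<in> H}"
  have mult: "(h \<otimes> x [^] i) \<otimes> (h' \<otimes> x [^] j) = (h \<otimes> h') \<otimes> x [^] (i + j)"
    if "h \<in> H" "h' \<in> H" for h h' and i j :: nat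
    using that x by (simp add: nat_pow_mult[symmetric] m_ac)
  have xmod: "x [^] (j mod p) = x [^] j" for j
  proof -
    have "x [^] j = x [^] (p * (j div p) + j mod p)" by simp
    also have "\<dots> = x [^] (j mod p)"
      using x by (simp only: nat_pow_mult[symmetric] nat_pow_pow[symmetric]) simp
    finally show ?thesis ..
  qed
  have sub: "subgroup H' G"
  proof (rule subgroupI)
    show "H' \<subseteq> carrier G" using x by (auto simp: H'_def)
    have "\<one> \<otimes> x [^] (0 :: nat) \<in> H'" using H.one_closed unfolding H'_def by blast
    then show "H' \<noteq> {}" by blast
    show "a \<otimes> b \<in> H'" if "a \<in> H'" "b \<in> H'" for a b
      using that mult H.m_closed unfolding H'_def by fastforce
    show "inv a \<in> H'" if a: "a \<in> H'" for a
    proof -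
      obtain h and j :: nat where h: "h \<in> H" "a = h \<otimes> x [^] j" using a by (auto simp: H'_def)
      have pj: "j + (p - 1) * j = p * j" using p1 by (cases p) auto
      have "x [^] j \<otimes> x [^] ((p - 1) * j) = x [^] (p * j)"
        unfolding pj[symmetric] using x by (simp add: nat_pow_mult)
      also have "\<dots> = \<one>" using x by (simp only: nat_pow_pow[symmetric]) simp
      finally have "x [^] ((p - 1) * j) \<otimes> x [^] j = \<one>" using x by (simp add: m_comm)
      then have "inv (x [^] j) = x [^] ((p - 1) * j)"
        using x by (intro inv_equality) auto
      then have "inv a = inv h \<otimes> x [^] ((p - 1) * j)"
        using h x by (simp add: inv_mult)
      then show ?thesis using h by (auto simp: H'_def)
    qed
  qed
  have "h \<in> H'" if "h \<in> H" for h
    using that by (auto simp: H'_def intro!: exI[of _ h] exI[of _ "0 :: nat"])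
  moreover have "x \<in> H'"
    using x by (auto simp: H'_def intro!: exI[of _ \<one>] exI[of _ "1 :: nat"])
  ultimately have psub: "H \<subset> H'" using x by auto
  define D where "D y = (SOME hj. fst hj \<in> H \<and> y = fst hj \<otimes> x [^] (snd hj :: nat))" for y
  define f' where "f' y = (f (fst (D y)))(N := int (snd (D y)))" for y
  have D: "fst (D (h \<otimes> x [^] j)) = h \<and> [int (snd (D (h \<otimes> x [^] j))) = int j] (mod int p)"
    if h: "h \<in> H" for h and j :: nat
  proof -
    have "fst (D (h \<otimes> x [^] j)) \<in> H \<and> h \<otimes> x [^] j = fst (D (h \<otimes> x [^] j)) \<otimes> x [^] snd (D (h \<otimes> x [^] j))"
      unfolding D_def
      by (rule someI[of "\<lambda>hj. fst hj \<in> H \<and> h \<otimes> x [^] j = fst hj \<otimes> x [^] snd hj" "(h, j)"])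
        (simp add: h)
    then show ?thesis
      using coset_representation_unique[OF p H x h, of "fst (D (h \<otimes> x [^] j))" j "snd (D (h \<otimes> x [^] j))"]
      by (auto simp: cong_sym_eq)
  qed
  have f'1: "f' (h \<otimes> x [^] j) k = f h k" if "h \<in> H" "k < N" for h k and j :: nat
    using D[OF that(1), of j] that(2) by (simp add: f'_def)
  have f'2: "[f' (h \<otimes> x [^] j) N = int j] (mod int p)" if "h \<in> H" for h and j :: nat
    using D[OF that, of j] by (simp add: f'_def)
  have "linear_coordinates p G H' (Suc N) f'"
    unfolding linear_coordinates_def
  proof (intro conjI ballI allI impI)
    fix a b k assume a: "a \<in> H'" and b: "b \<in> H'" and k: "k < Suc N"
    obtain h i where h: "h \<in> H" "a = h \<otimes> x [^] (i :: nat)" using a by (auto simp: H'_def)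
    obtain h' j where h': "h' \<in> H" "b = h' \<otimes> x [^] (j :: nat)" using b by (auto simp: H'_def)
    have ab: "a \<otimes> b = (h \<otimes> h') \<otimes> x [^] (i + j)" using h h' mult by simp
    show "[f' (a \<otimes> b) k = f' a k + f' b k] (mod int p)"
    proof (cases "k = N")
      case True
      have "[f' (a \<otimes> b) N = int (i + j)] (mod int p)"
        unfolding ab using h h' by (intro f'2) simp
      moreover have "[f' a N + f' b N = int i + int j] (mod int p)"
        unfolding h(2) h'(2) using h h' by (intro cong_add f'2)
      ultimately show ?thesis using True by (metis cong_sym cong_trans of_nat_add)
    next
      case False
      then have kN: "k < N" using k by simp
      then show ?thesis
        using f h h' unfolding ab by (simp add: f'1 linear_coordinates_def)
    qed
  next
    fix a assume a: "a \<in> H'" and dvd: "\<forall>k<Suc N. int p dvd f' a k"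
    obtain h i where h: "h \<in> H" "a = h \<otimes> x [^] (i :: nat)" using a by (auto simp: H'_def)
    have "h = \<one>"
    proof -
      have "int p dvd f h k" if "k < N" for k
        using dvd f'1[OF h(1) that, of i] that h(2) by (metis less_SucI)
      then show ?thesis using f h(1) by (simp add: linear_coordinates_def)
    qed
    moreover have "x [^] i = \<one>"
    proof -
      have "int p dvd int i"
        using dvd f'2[OF h(1), of i] h(2) cong_dvd_iff by blast
      then have "p dvd i" by (simp only: of_nat_dvd_iff)
      then have "i mod p = 0" by simp
      then show ?thesis using xmod[of i] by simp
    qed
    ultimately show "a = \<one>" using h by simp
  next
    fix v :: "nat \<Rightarrow> int"
    obtain h where h: "h \<in> H" "\<And>k. k < N \<Longrightarrow> [f h k = v k] (mod int p)"
      using f unfolding linear_coordinates_def by blast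
    define j where "j = nat (v N mod int p)"
    have j: "[int j = v N] (mod int p)" using p1 by (simp add: j_def Cong.cong_def)
    show "\<exists>a\<in>H'. \<forall>k<Suc N. [f' a k = v k] (mod int p)"
    proof (intro bexI allI impI)
      show "h \<otimes> x [^] j \<in> H'" using h by (auto simp: H'_def)
      fix k assume "k < Suc N"
      then consider "k = N" | "k < N" by linarith
      then show "[f' (h \<otimes> x [^] j) k = v k] (mod int p)"
      proof cases
        case 1
        then show ?thesis using f'2[OF h(1), of j] j cong_trans by blast
      next
        case 2
        then show ?thesis using h f'1 by simp
      qed
    qed
  next
    have "bij_betw (\<lambda>(h, j). h \<otimes> x [^] j) (H \<times> {..<p}) H'"
    proof (rule bij_betwI')
      fix a b assume "a \<in> H \<times> {..<p}" "b \<in> H \<times> {..<p}"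
      then obtain h i h' j where ab: "a = (h, i)" "b = (h', j)" "h \<in> H" "h' \<in> H" "i < p" "j < p" by blast
      have "h = h' \<and> i = j" if "h \<otimes> x [^] i = h' \<otimes> x [^] j"
        using coset_representation_unique[OF p H x ab(3,4) that] ab(5,6)
        by (simp add: cong_int_iff cong_less_modulus_unique_nat)
      then show "((case a of (h, j) \<Rightarrow> h \<otimes> x [^] j) = (case b of (h, j) \<Rightarrow> h \<otimes> x [^] j)) = (a = b)"
        using ab by auto
    next
      show "(case a of (h, j) \<Rightarrow> h \<otimes> x [^] j) \<in> H'" if "a \<in> H \<times> {..<p}" for a
        using that by (auto simp: H'_def)
    next
      fix a assume "a \<in> H'"
      then obtain h j where h: "h \<in> H" "a = h \<otimes> x [^] (j :: nat)" by (auto simp: H'_def)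
      then show "\<exists>b\<in>H \<times> {..<p}. a = (case b of (h, j) \<Rightarrow> h \<otimes> x [^] j)"
        using p1 by (intro bexI[of _ "(h, j mod p)"]) (simp_all add: xmod)
    qed
    then have "card H' = card (H \<times> {..<p})" by (simp add: bij_betw_same_card)
    also have "\<dots> = p ^ Suc N"
      using f by (simp add: card_cartesian_product linear_coordinates_def)
    finally show "card H' = p ^ Suc N" .
  qed
  then show ?thesis using sub psub by blast
qed

lemma linear_coordinates_exist:
  assumes p: "Factorial_Ring.prime p" and fin: "finite (carrier G)"
    and exp: "\<And>x. x \<in> carrier G \<Longrightarrow> x [^] p = \<one>"
  shows "\<exists>N f. linear_coordinates p G (carrier G) N f"
proof -
  have "\<exists>N f. linear_coordinates p G (carrier G) N f"
    if "subgroup H G" "linear_coordinates p G H N f" for H N f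
    using that
  proof (induction "card (carrier G) - card H" arbitrary: H N f rule: less_induct)
    case less
    show ?case
    proof (cases "H = carrier G")
      case True
      then show ?thesis using less.prems by blast
    next
      case False
      have HG: "H \<subseteq> carrier G" using less.prems(1) by (rule subgroup.subset)
      then obtain x where x: "x \<in> carrier G" "x \<notin> H" using False by blast
      obtain H' f' where H': "subgroup H' G" "H \<subset> H'" "linear_coordinates p G H' (Suc N) f'"
        using linear_coordinates_extend[OF p less.prems x exp[OF x(1)]] by blast
      have H'G: "H' \<subseteq> carrier G" using H'(1) by (rule subgroup.subset)
      then have "card H < card H'" "card H' \<le> card (carrier G)"
        using H'(2) fin by (auto intro!: psubset_card_mono card_mono dest: finite_subset)
      then show ?thesis by (intro less.hyps[OF _ H'(1,3)]) linarith
    qed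
  qed
  moreover have "linear_coordinates p G {\<one>} 0 (\<lambda>_ _. 0)"
    by (simp add: linear_coordinates_def)
  ultimately show ?thesis using triv_subgroup by blast
qed

end

section \<open>Groups whose nonlinear characters vanish off the center\<close>

context group
begin

lemma center_carrier: "z \<in> center G \<Longrightarrow> z \<in> carrier G"
  by (simp add: center_def)

lemma center_commute: "z \<in> center G \<Longrightarrow> g \<in> carrier G \<Longrightarrow> z \<otimes> g = g \<otimes> z"
  by (simp add: center_def)

lemma center_subgroup: "subgroup (center G) G"
proof (rule subgroupI)
  show "center G \<noteq> {}" by (auto simp: center_def intro!: exI[of _ \<one>])
  show "inv a \<in> center G" if a: "a \<in> center G" for a
  proof -
    have "inv a \<otimes> g = g \<otimes> inv a" if g: "g \<in> carrier G" for g
    proof -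
      have ac: "a \<in> carrier G" "a \<otimes> inv g = inv g \<otimes> a" using a g by (auto intro: center_carrier center_commute)
      have "inv a \<otimes> g = inv (inv g \<otimes> a)" using ac(1) g by (simp add: inv_mult_group)
      also have "\<dots> = g \<otimes> inv a" unfolding ac(2)[symmetric] using ac(1) g by (simp add: inv_mult_group)
      finally show ?thesis .
    qed
    then show ?thesis using center_carrier[OF a] unfolding center_def by blast
  qed
  show "a \<otimes> b \<in> center G" if a: "a \<in> center G" and b: "b \<in> center G" for a b
  proof -
    have "a \<otimes> b \<otimes> g = g \<otimes> (a \<otimes> b)" if g: "g \<in> carrier G" for g
    proof -
      have c: "a \<in> carrier G" "b \<in> carrier G" "a \<otimes> g = g \<otimes> a" "b \<otimes> g = g \<otimes> b"
        using a b g by (auto intro: center_carrier center_commute)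
      have "a \<otimes> b \<otimes> g = a \<otimes> (b \<otimes> g)" using c(1,2) g by (rule m_assoc)
      also have "\<dots> = (a \<otimes> g) \<otimes> b" unfolding c(4) using m_assoc[OF c(1) g c(2)] by simp
      also have "\<dots> = g \<otimes> (a \<otimes> b)" unfolding c(3) using g c(1,2) by (rule m_assoc)
      finally show ?thesis .
    qed
    moreover have "a \<otimes> b \<in> carrier G" using a b by (auto intro: center_carrier)
    ultimately show ?thesis unfolding center_def by blast
  qed
qed (auto simp: center_def)

lemma center_normal: "center G \<lhd> G"
  unfolding normal_inv_iff
proof (intro conjI ballI center_subgroup)
  fix x h assume x: "x \<in> carrier G" and h: "h \<in> center G"
  then have "x \<otimes> h = h \<otimes> x" "h \<in> carrier G"
    using center_commute[OF h x] center_carrier[OF h] by simp_all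
  then have "x \<otimes> h \<otimes> inv x = h" using x by (simp add: m_assoc)
  then show "x \<otimes> h \<otimes> inv x \<in> center G" using h by simp
qed

definition commutator :: "'a \<Rightarrow> 'a \<Rightarrow> 'a" where
  "commutator x y = x \<otimes> y \<otimes> inv x \<otimes> inv y"

lemma commutator_derived: "x \<in> carrier G \<Longrightarrow> y \<in> carrier G \<Longrightarrow> commutator x y \<in> derived G (carrier G)"
  unfolding derived_def commutator_def by (rule generate.incl) blast

lemma derived_carrier: "u \<in> derived G (carrier G) \<Longrightarrow> u \<in> carrier G"
  using derived_in_carrier[of "carrier G"] by auto

lemma commutator_carrier [simp]: "x \<in> carrier G \<Longrightarrow> y \<in> carrier G \<Longrightarrow> commutator x y \<in> carrier G"
  by (simp add: commutator_def)

lemma inv_commutator: "x \<in> carrier G \<Longrightarrow> y \<in> carrier G \<Longrightarrow> inv (commutator x y) = commutator y x"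
  by (simp add: commutator_def inv_mult_group m_assoc)

lemma commutator_self: "x \<in> carrier G \<Longrightarrow> commutator x x = \<one>"
  by (simp add: commutator_def m_assoc)

lemma commutator_eq_one_iff:
  assumes "x \<in> carrier G" "y \<in> carrier G"
  shows "commutator x y = \<one> \<longleftrightarrow> x \<otimes> y = y \<otimes> x"
proof -
  have "commutator x y = (x \<otimes> y) \<otimes> inv (y \<otimes> x)"
    using assms by (simp add: commutator_def inv_mult_group m_assoc)
  then show ?thesis using assms by (metis inv_closed inv_equality inv_inv m_closed r_inv)
qed

text \<open>In every group \<open>[x x', y] = x [x', y] x^-1 [x, y]\<close>; a central
  \<open>[x', y]\<close> comes out of the conjugation.\<close>

lemma commutator_mult_left:
  assumes x: "x \<in> carrier G" "x' \<in> carrier G" "y \<in> carrier G" and cen: "commutator x' y \<in> center G"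
  shows "commutator (x \<otimes> x') y = commutator x y \<otimes> commutator x' y"
proof -
  have "commutator (x \<otimes> x') y = x \<otimes> commutator x' y \<otimes> (y \<otimes> inv x \<otimes> inv y)"
  proof -
    have "x \<otimes> commutator x' y \<otimes> (y \<otimes> inv x \<otimes> inv y) =
        x \<otimes> (x' \<otimes> (y \<otimes> (inv x' \<otimes> (inv y \<otimes> (y \<otimes> (inv x \<otimes> inv y))))))"
      using x by (simp add: commutator_def m_assoc)
    also have "inv y \<otimes> (y \<otimes> (inv x \<otimes> inv y)) = inv x \<otimes> inv y"
      using x by (simp add: m_assoc[symmetric])
    finally show ?thesis
      using x by (simp add: commutator_def m_assoc inv_mult_group)
  qed
  also have "x \<otimes> commutator x' y = commutator x' y \<otimes> x"
    using cen x by (simp add: center_commute)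
  also have "commutator x' y \<otimes> x \<otimes> (y \<otimes> inv x \<otimes> inv y) = commutator x' y \<otimes> commutator x y"
    using x by (simp add: commutator_def m_assoc)
  also have "\<dots> = commutator x y \<otimes> commutator x' y"
    using cen x by (simp add: center_commute)
  finally show ?thesis .
qed

lemma comm_group_FactGroup:
  assumes N: "N \<lhd> G" and comm: "\<And>x y. x \<in> carrier G \<Longrightarrow> y \<in> carrier G \<Longrightarrow> commutator x y \<in> N"
  shows "comm_group (G Mod N)"
proof (rule group.group_comm_groupI)
  interpret N: normal N G by fact
  show "group (G Mod N)" by (rule N.factorgroup_is_group)
  fix a b assume "a \<in> carrier (G Mod N)" "b \<in> carrier (G Mod N)"
  then obtain x y where xy: "x \<in> carrier G" "y \<in> carrier G" "a = N #> x" "b = N #> y"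
    by (auto simp: carrier_FactGroup)
  have "inv y \<otimes> (y \<otimes> x) = x" using xy by (simp add: m_assoc[symmetric])
  then have "x \<otimes> y = commutator x y \<otimes> (y \<otimes> x)"
    using xy by (simp add: commutator_def m_assoc)
  then have "N #> (x \<otimes> y) = N #> commutator x y #> (y \<otimes> x)"
    using xy by (simp add: coset_mult_assoc N.subset)
  also have "N #> commutator x y = N"
    using xy comm N.subgroup_axioms by (intro coset_join2) auto
  finally show "a \<otimes>\<^bsub>G Mod N\<^esub> b = b \<otimes>\<^bsub>G Mod N\<^esub> a"
    using xy by (simp add: N.rcos_sum)
qed

end

section \<open>VZ-groups: the commutator map, the exponent and the degrees\<close>

locale vanishing_group = finite_group +
  assumes nonabelian: "\<not> comm_group G"
    and vanishing: "\<And>n \<rho> g. irreducible_representation G n \<rho> \<Longrightarrow> 1 < n \<Longrightarrow>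
      g \<in> carrier G - center G \<Longrightarrow> mat_trace (\<rho> g) = 0"
begin

lemma derived_central: "derived G (carrier G) \<subseteq> center G"
proof
  fix y assume y: "y \<in> derived G (carrier G)"
  show "y \<in> center G"
  proof (rule ccontr)
    assume n: "y \<notin> center G"
    then have "y = \<one>"
      using y derived_carrier by (intro derived_vanish_imp_one vanishing) auto
    then show False using n subgroup.one_closed[OF center_subgroup] by simp
  qed
qed

lemma commutator_central: "x \<in> carrier G \<Longrightarrow> y \<in> carrier G \<Longrightarrow> commutator x y \<in> center G"
  using commutator_derived derived_central by blast

lemma commutator_mult:
  "x \<in> carrier G \<Longrightarrow> x' \<in> carrier G \<Longrightarrow> y \<in> carrier G \<Longrightarrow>
    commutator (x \<otimes> x') y = commutator x y \<otimes> commutator x' y"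
  by (simp add: commutator_mult_left commutator_central)

lemma commutator_mult_right:
  assumes "x \<in> carrier G" "x' \<in> carrier G" "y \<in> carrier G"
  shows "commutator y (x \<otimes> x') = commutator y x \<otimes> commutator y x'"
proof -
  have "commutator y (x \<otimes> x') = inv (commutator (x \<otimes> x') y)"
    using assms by (simp add: inv_commutator)
  also have "\<dots> = inv (commutator x' y) \<otimes> inv (commutator x y)"
    using assms by (simp add: commutator_mult inv_mult_group)
  also have "\<dots> = commutator y x' \<otimes> commutator y x"
    using assms by (simp add: inv_commutator)
  also have "\<dots> = commutator y x \<otimes> commutator y x'"
    using commutator_central[of y x'] assms by (simp add: center_commute)
  finally show ?thesis .
qed

lemma commutator_one: "y \<in> carrier G \<Longrightarrow> commutator \<one> y = \<one>"
  by (simp add: commutator_def)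

lemma commutator_pow:
  "x \<in> carrier G \<Longrightarrow> y \<in> carrier G \<Longrightarrow> commutator (x [^] (k :: nat)) y = commutator x y [^] k"
  by (induction k) (simp_all add: commutator_one commutator_mult)

text \<open>A linear character agrees at both elements because it is trivial on the derived
  subgroup. A nonlinear one vanishes at both, since \<open>u\<close> is central and so
  \<open>x u\<close> lies outside the center together with \<open>x\<close>.\<close>

lemma conjugate_derived_coset:
  assumes x: "x \<in> carrier G - center G" and u: "u \<in> derived G (carrier G)"
  shows "\<exists>g\<in>carrier G. g \<otimes> x \<otimes> inv g = x \<otimes> u"
proof (rule irreducible_characters_separate)
  have uZ: "u \<in> center G" "u \<in> carrier G" using u derived_central derived_carrier by auto
  show "x \<in> carrier G" "x \<otimes> u \<in> carrier G" using x uZ by auto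
  have xu: "x \<otimes> u \<notin> center G"
  proof
    assume "x \<otimes> u \<in> center G"
    then have "x \<otimes> u \<otimes> inv u \<in> center G"
      using subgroup.m_inv_closed[OF center_subgroup uZ(1)] by (rule subgroup.m_closed[OF center_subgroup])
    then show False using x uZ by (simp add: m_assoc)
  qed
  fix n \<rho> assume irr: "irreducible_representation G n \<rho>"
  note \<rho> = irreducible_rep[OF irr]
  show "mat_trace (\<rho> x) = mat_trace (\<rho> (x \<otimes> u))"
  proof (cases "n = 1")
    case True
    then have "\<rho> u = 1\<^sub>m n" using linear_rep_derived[OF _ u] \<rho> by simp
    then show ?thesis
      using x uZ rep_carrier[OF \<rho>, of x] by (simp add: rep_mult[OF \<rho>])
  next
    case False
    then have "1 < n" using irreducible_degree[OF irr] by linarith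
    then show ?thesis using vanishing[OF irr] x xu uZ by auto
  qed
qed

lemma commutator_surj:
  assumes x: "x \<in> carrier G - center G" and u: "u \<in> derived G (carrier G)"
  shows "\<exists>y\<in>carrier G. commutator x y = u"
proof -
  have xc: "x \<in> carrier G" using x by simp
  \<comment> \<open>The inverse is used because an element \<open>g\<close> conjugating
    \<open>x\<close> yields \<open>[g, x]\<close>, whereas a commutator \<open>[x, g]\<close> is
    wanted.\<close>
  have iu: "inv u \<in> derived G (carrier G)"
    using subgroup.m_inv_closed[OF derived_is_subgroup u] by simp
  then obtain g where g: "g \<in> carrier G" "g \<otimes> x \<otimes> inv g = x \<otimes> inv u"
    using conjugate_derived_coset[OF x] by blast
  have uc: "u \<in> carrier G" "inv u \<in> center G" using u iu derived_central derived_carrier by auto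
  have "commutator g x = x \<otimes> inv u \<otimes> inv x"
    unfolding commutator_def g(2) ..
  also have "\<dots> = inv u \<otimes> x \<otimes> inv x"
    using uc xc by (simp add: center_commute)
  also have "\<dots> = inv u" using uc xc by (simp add: m_assoc)
  finally have "commutator x g = u"
    using inv_commutator[OF g(1) xc] uc by simp
  then show ?thesis using g by blast
qed

lemma noncentral_exists: "\<exists>x. x \<in> carrier G - center G"
proof (rule ccontr)
  assume "\<not> ?thesis"
  then have "comm_group G"
    by (intro group_comm_groupI) (auto simp: center_def)
  then show False using nonabelian by simp
qed

lemma derived_nontrivial: "derived G (carrier G) \<noteq> {\<one>}"
proof
  assume d: "derived G (carrier G) = {\<one>}"
  have "comm_group G"
  proof (rule group_comm_groupI)
    fix x y assume xy: "x \<in> carrier G" "y \<in> carrier G"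
    then have "commutator x y = \<one>" using commutator_derived[OF xy] d by simp
    then show "x \<otimes> y = y \<otimes> x" using commutator_eq_one_iff xy by simp
  qed
  then show False using nonabelian by simp
qed

text \<open>Let \<open>x\<close> be noncentral, \<open>k\<close> the least positive exponent with
  \<open>x^k\<close> central, and \<open>p\<close> a prime dividing \<open>k\<close>. Then
  \<open>x^(k/p)\<close> is noncentral, so its commutators exhaust the derived subgroup, and their
  \<open>p\<close>-th powers are commutators with the central element \<open>x^k\<close>.
  Bilinearity carries the exponent over to the quotient by the center.\<close>

lemma prime_exponent:
  obtains p :: nat where "Factorial_Ring.prime p" "\<And>u. u \<in> derived G (carrier G) \<Longrightarrow> u [^] p = \<one>"
    "\<And>x. x \<in> carrier G \<Longrightarrow> x [^] p \<in> center G"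
proof -
  obtain x where x: "x \<in> carrier G" "x \<notin> center G" using noncentral_exists by blast
  define P where "P k \<longleftrightarrow> 0 < k \<and> x [^] (k :: nat) \<in> center G" for k
  have "P (card (carrier G))"
    using order_pos pow_order_eq_1[OF x(1)] subgroup.one_closed[OF center_subgroup]
    by (simp add: P_def Coset.order_def)
  then have k: "P (Least P)" and least: "\<And>j. j < Least P \<Longrightarrow> \<not> P j"
    by (auto intro: LeastI dest: not_less_Least)
  have "Least P \<noteq> 1" using k x by (auto simp: P_def)
  then obtain p where p: "Factorial_Ring.prime p" "p dvd Least P"
    using prime_factor_nat by blast
  then obtain q where q: "Least P = p * q" by blast
  have q0: "0 < q" using k q by (cases q) (auto simp: P_def)
  then have "q < Least P" using q prime_gt_1_nat[OF p(1)] by simp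
  then have xq: "x [^] q \<in> carrier G - center G"
    using least[of q] q0 x by (simp add: P_def)
  have xqp: "(x [^] q) [^] p \<in> center G"
    using k x by (simp add: P_def q nat_pow_pow mult.commute)
  have derived_exp: "u [^] p = \<one>" if u: "u \<in> derived G (carrier G)" for u
  proof -
    obtain y where y: "y \<in> carrier G" "commutator (x [^] q) y = u"
      using commutator_surj[OF xq u] by blast
    have "u [^] p = commutator ((x [^] q) [^] p) y"
      using xq y by (simp add: commutator_pow)
    also have "\<dots> = \<one>"
      using xqp y xq center_commute[OF xqp y(1)] by (subst commutator_eq_one_iff) auto
    finally show ?thesis .
  qed
  have center_exp: "y [^] p \<in> center G" if y: "y \<in> carrier G" for y
  proof -
    have "y [^] p \<otimes> g = g \<otimes> y [^] p" if g: "g \<in> carrier G" for g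
    proof -
      have "commutator (y [^] p) g = \<one>"
        using y g derived_exp[OF commutator_derived[OF y g]] by (simp add: commutator_pow)
      then show ?thesis using y g by (simp add: commutator_eq_one_iff)
    qed
    then show ?thesis using y unfolding center_def by blast
  qed
  show ?thesis by (rule that[OF p(1) derived_exp center_exp])
qed

text \<open>A central element and its inverse act by scalars \<open>s\<close> and
  \<open>1 / s\<close>, with traces \<open>n s\<close> and \<open>n / s\<close>. In particular the
  character is nonzero there.\<close>

lemma central_scalar:
  assumes irr: "irreducible_representation G n \<rho>" and z: "z \<in> center G"
  shows "mat_trace (\<rho> z) * mat_trace (\<rho> (inv z)) = (of_nat n)\<^sup>2"
proof -
  note \<rho> = irreducible_rep[OF irr]
  have n: "0 < n" using irr by (rule irreducible_degree)
  have scalar: "\<rho> w = (mat_trace (\<rho> w) / of_nat n) \<cdot>\<^sub>m 1\<^sub>m n" if w: "w \<in> center G" for w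
  proof (rule schur[OF irr rep_carrier[OF \<rho> center_carrier[OF w]]])
    fix g assume g: "g \<in> carrier G"
    then show "\<rho> g * \<rho> w = \<rho> w * \<rho> g"
      using center_commute[OF w g] center_carrier[OF w] by (simp flip: rep_mult[OF \<rho>])
  qed
  have zc: "z \<in> carrier G" using z by (rule center_carrier)
  have iz: "inv z \<in> center G" using subgroup.m_inv_closed[OF center_subgroup z] .
  have "(\<rho> z * \<rho> (inv z)) $$ (0, 0) = 1" using rep_inv[OF \<rho> zc] n by simp
  moreover have "(\<rho> z * \<rho> (inv z)) $$ (0, 0) = mat_trace (\<rho> z) / of_nat n * (mat_trace (\<rho> (inv z)) / of_nat n)"
    using n by (subst scalar[OF z], subst scalar[OF iz])
      (simp add: mult_smult_distrib[of _ n n _ n] mult_smult_assoc_mat[of _ n n _ n])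
  ultimately show ?thesis using n by (simp add: field_simps power2_eq_square)
qed

lemma degree_square:
  assumes irr: "irreducible_representation G n \<rho>" and n: "1 < n"
  shows "card (carrier G) = card (center G) * n\<^sup>2"
proof -
  have "(of_nat (card (carrier G)) :: complex) = (\<Sum>g\<in>carrier G. mat_trace (\<rho> g) * mat_trace (\<rho> (inv g)))"
    using character_norm[OF irr] by simp
  also have "\<dots> = (\<Sum>g\<in>center G. mat_trace (\<rho> g) * mat_trace (\<rho> (inv g)))"
    using finite_carrier vanishing[OF irr n] center_carrier by (intro sum.mono_neutral_right) auto
  also have "\<dots> = of_nat (card (center G)) * (of_nat n)\<^sup>2"
    by (simp add: central_scalar[OF irr])
  also have "\<dots> = of_nat (card (center G) * n\<^sup>2)" by simp
  finally show ?thesis by (simp only: of_nat_eq_iff)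
qed

end

section \<open>Maps to the integers that are additive modulo \<open>p\<close>\<close>

context group
begin

lemma additive_mod_one:
  assumes F: "\<And>x y. x \<in> carrier G \<Longrightarrow> y \<in> carrier G \<Longrightarrow> [F (x \<otimes> y) = F x + F y] (mod p)"
  shows "[F \<one> = 0] (mod (p :: int))"
  using F[OF one_closed one_closed] by (simp add: cong_iff_dvd_diff)

lemma additive_mod_pow:
  assumes F: "\<And>x y. x \<in> carrier G \<Longrightarrow> y \<in> carrier G \<Longrightarrow> [F (x \<otimes> y) = F x + F y] (mod p)"
    and x: "x \<in> carrier G"
  shows "[F (x [^] (t :: nat)) = int t * F x] (mod (p :: int))"
proof (induction t)
  case 0
  show ?case using additive_mod_one[of F p] F by simp
next
  case (Suc t)
  have "[F (x [^] t \<otimes> x) = F (x [^] t) + F x] (mod p)" using x by (intro F) auto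
  also have "[F (x [^] t) + F x = int t * F x + F x] (mod p)" using Suc by (intro cong_add) auto
  finally show ?case by (simp add: algebra_simps)
qed

text \<open>Such a map vanishes where all coordinates do, so it is determined by its values on the
  elements \<open>g i\<close> dual to the coordinates. The coordinates of \<open>y\<close> are
  cleared from the highest index down by multiplying with powers of \<open>g M\<close>.\<close>

lemma additive_mod_expand:
  fixes w :: "'a \<Rightarrow> nat \<Rightarrow> int" and p :: int
  assumes p: "0 < p"
    and w_add: "\<And>x y k. x \<in> carrier G \<Longrightarrow> y \<in> carrier G \<Longrightarrow> k < N \<Longrightarrow> [w (x \<otimes> y) k = w x k + w y k] (mod p)"
    and w_ker: "\<And>x. x \<in> carrier G \<Longrightarrow> (\<And>k. k < N \<Longrightarrow> [w x k = 0] (mod p)) \<Longrightarrow> [F x = 0] (mod p)"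
    and g: "\<And>i. i < N \<Longrightarrow> g i \<in> carrier G"
    and wg: "\<And>i k. i < N \<Longrightarrow> k < N \<Longrightarrow> [w (g i) k = (if k = i then 1 else 0)] (mod p)"
    and F: "\<And>x y. x \<in> carrier G \<Longrightarrow> y \<in> carrier G \<Longrightarrow> [F (x \<otimes> y) = F x + F y] (mod p)"
    and y: "y \<in> carrier G"
  shows "[F y = (\<Sum>i<N. w y i * F (g i))] (mod p)"
proof -
  have "[F y = (\<Sum>i<M. w y i * F (g i))] (mod p)"
    if "M \<le> N" "y \<in> carrier G" "\<And>k. M \<le> k \<Longrightarrow> k < N \<Longrightarrow> [w y k = 0] (mod p)" for M y
    using that
  proof (induction M arbitrary: y)
    case 0
    then show ?case using w_ker[of y] by simp
  next
    case (Suc M)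
    note y = Suc.prems(2)
    have M: "M < N" using Suc.prems(1) by simp
    \<comment> \<open>A natural exponent congruent to \<open>- w y M\<close>, so that the factor
      \<open>g M [^] t\<close> cancels coordinate \<open>M\<close>.\<close>
    define t where "t = nat ((- w y M) mod p)"
    have t: "[int t = - w y M] (mod p)" using p by (simp add: t_def Cong.cong_def)
    define y' where "y' = y \<otimes> g M [^] t"
    have y': "y' \<in> carrier G" using y g[OF M] by (simp add: y'_def)
    have wy': "[w y' k = w y k + int t * (if k = M then 1 else 0)] (mod p)" if k: "k < N" for k
    proof -
      have "[w y' k = w y k + w (g M [^] t) k] (mod p)"
        unfolding y'_def using y g[OF M] k by (intro w_add) auto
      moreover have "[w (g M [^] t) k = int t * w (g M) k] (mod p)"
        using w_add[OF _ _ k] g[OF M] by (rule additive_mod_pow)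
      moreover have "[int t * w (g M) k = int t * (if k = M then 1 else 0)] (mod p)"
        using wg[OF M k] by (rule cong_scalar_left)
      ultimately show ?thesis by (meson cong_add_lcancel cong_trans)
    qed
    have "[F y' = (\<Sum>i<M. w y' i * F (g i))] (mod p)"
    proof (rule Suc.IH[OF _ y'])
      fix k assume k: "M \<le> k" "k < N"
      show "[w y' k = 0] (mod p)"
      proof (cases "k = M")
        case True
        have "[w y k + int t * 1 = w y M + - w y M] (mod p)"
          using t True by (intro cong_add) auto
        then show ?thesis using wy'[OF k(2)] True by (auto intro: cong_trans)
      next
        case False
        then show ?thesis using wy'[OF k(2)] Suc.prems(3)[of k] k by (auto intro: cong_trans)
      qed
    qed (use M in simp)
    also have "[(\<Sum>i<M. w y' i * F (g i)) = (\<Sum>i<M. w y i * F (g i))] (mod p)"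
    proof (intro cong_sum cong_scalar_right)
      fix i assume "i \<in> {..<M}"
      then show "[w y' i = w y i] (mod p)" using wy'[of i] M by simp
    qed
    finally have F1: "[F y' = (\<Sum>i<M. w y i * F (g i))] (mod p)" .
    have "[F y' = F y + F (g M [^] t)] (mod p)"
      unfolding y'_def using y g[OF M] by (intro F) auto
    moreover have "[F (g M [^] t) = int t * F (g M)] (mod p)"
      using F g[OF M] by (rule additive_mod_pow)
    moreover have "[int t * F (g M) = - w y M * F (g M)] (mod p)"
      using t by (rule cong_scalar_right)
    ultimately have F2: "[F y' = F y + - w y M * F (g M)] (mod p)"
      by (meson cong_add_lcancel cong_trans)
    have "[F y + - w y M * F (g M) = (\<Sum>i<M. w y i * F (g i))] (mod p)"
      using F1 F2 by (meson cong_sym cong_trans)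
    then have "[F y + - w y M * F (g M) + w y M * F (g M) = (\<Sum>i<M. w y i * F (g i)) + w y M * F (g M)] (mod p)"
      by (intro cong_add) auto
    then show ?case by simp
  qed
  from this[of N y] show ?thesis using y by simp
qed

end

section \<open>The rank of the derived subgroup and the structure of VZ-groups\<close>

context vanishing_group
begin

text \<open>The commutator map followed by the \<open>m\<close> coordinates of the derived subgroup gives \<open>m\<close>
  alternating forms on \<open>G\<close> modulo its center. A nonzero combination of them is nonsingular because
  each map \<open>commutator x\<close> with \<open>x\<close> not central is onto the derived subgroup.\<close>

lemma derived_rank_le:
  fixes p n m N :: nat and w c :: "'a \<Rightarrow> nat \<Rightarrow> int"
  assumes p: "Factorial_Ring.prime p" and n: "0 < n" and N: "N = 2 * n"
    and w_add: "\<And>x y k. x \<in> carrier G \<Longrightarrow> y \<in> carrier G \<Longrightarrow> k < N \<Longrightarrow>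
      [w (x \<otimes> y) k = w x k + w y k] (mod int p)"
    and w_ker: "\<And>x. x \<in> carrier G \<Longrightarrow> (\<And>k. k < N \<Longrightarrow> int p dvd w x k) \<Longrightarrow> x \<in> center G"
    and w_center: "\<And>z k. z \<in> center G \<Longrightarrow> k < N \<Longrightarrow> int p dvd w z k"
    and w_surj: "\<And>v. \<exists>x\<in>carrier G. \<forall>k<N. [w x k = v k] (mod int p)"
    and c_add: "\<And>u v k. u \<in> derived G (carrier G) \<Longrightarrow> v \<in> derived G (carrier G) \<Longrightarrow> k < m \<Longrightarrow>
      [c (u \<otimes> v) k = c u k + c v k] (mod int p)"
    and c_surj: "\<And>v. \<exists>u\<in>derived G (carrier G). \<forall>k<m. [c u k = v k] (mod int p)"
  shows "m \<le> n"
proof -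
  note D = commutator_derived
  have "\<exists>x. x \<in> carrier G \<and> (\<forall>k<N. [w x k = (if k = i then 1 else 0)] (mod int p))" for i
    using w_surj[of "\<lambda>k. if k = i then 1 else 0"] by blast
  then obtain g where g: "\<And>i. g i \<in> carrier G"
    and wg: "\<And>i k. k < N \<Longrightarrow> [w (g i) k = (if k = i then 1 else 0)] (mod int p)"
    by metis
  define b where "b i j k = c (commutator (g i) (g j)) k" for i j k
  \<comment> \<open>\<open>b\<close> is antisymmetric only modulo \<open>p\<close>. Keeping one
    triangle and reflecting it with the opposite sign gives integers that are exactly antisymmetric
    and congruent to \<open>b\<close>.\<close>
  define a where "a i j k = (if i < j then b i j k else if j < i then - b j i k else 0)" for i j k
  have one_der: "\<one> \<in> derived G (carrier G)"
    using derived_is_subgroup[of "carrier G"] by (simp add: subgroup.one_closed)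
  have c_one: "[c \<one> k = 0] (mod int p)" if "k < m" for k
    using c_add[OF one_der one_der that] by (simp add: cong_iff_dvd_diff)
  have b_anti: "[b i j k = - b j i k] (mod int p)" if k: "k < m" for i j k
  proof -
    have "commutator (g i) (g j) \<otimes> commutator (g j) (g i) = \<one>"
      using g by (subst inv_commutator[symmetric]) auto
    then have "[c \<one> k = b i j k + b j i k] (mod int p)"
      unfolding b_def using c_add[OF D[OF g g] D[OF g g] k, of i j j i] by simp
    then have "[b i j k + b j i k = 0] (mod int p)"
      using c_one[OF k] cong_sym cong_trans by blast
    then show ?thesis by (simp add: cong_iff_dvd_diff)
  qed
  have ab: "[a i j k = b i j k] (mod int p)" if k: "k < m" for i j k
  proof (cases "i = j")
    case True
    then have "b i j k = c \<one> k" using g by (simp add: b_def commutator_self)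
    then show ?thesis using True c_one[OF k] by (simp add: a_def cong_sym)
  next
    case False
    then show ?thesis using b_anti[OF k, of i j] by (auto simp: a_def cong_sym)
  qed
  have "alternating_forms p n m N a"
  proof
    show "Factorial_Ring.prime p" "0 < n" "N = 2 * n" by fact+
    show "a i j k = - a j i k" for i j k by (simp add: a_def)
    fix x l :: "nat \<Rightarrow> int"
    assume x: "\<exists>i<N. \<not> int p dvd x i" and l: "\<exists>k<m. \<not> int p dvd l k"
    show "\<exists>j<N. \<not> int p dvd (\<Sum>i<N. x i * (\<Sum>k<m. l k * a i j k))"
    proof (rule ccontr)
      assume not: "\<not> ?thesis"
      \<comment> \<open>The functional on the derived subgroup with coefficients \<open>l\<close>;
        composed with the commutator map it is the form in question.\<close>
      define \<psi> where "\<psi> u = (\<Sum>k<m. l k * c u k)" for u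
      have \<psi>_add: "[\<psi> (u \<otimes> v) = \<psi> u + \<psi> v] (mod int p)"
        if "u \<in> derived G (carrier G)" "v \<in> derived G (carrier G)" for u v
      proof -
        have "[\<psi> (u \<otimes> v) = (\<Sum>k<m. l k * (c u k + c v k))] (mod int p)"
          unfolding \<psi>_def using c_add[OF that] by (intro cong_sum cong_scalar_left) simp
        then show ?thesis by (simp add: \<psi>_def distrib_left sum.distrib)
      qed
      have \<psi>_one: "[\<psi> \<one> = 0] (mod int p)"
        using \<psi>_add[OF one_der one_der] by (simp add: cong_iff_dvd_diff)
      have p0: "0 < int p" using p by (simp add: prime_gt_0_nat)
      have expand: "[F y = (\<Sum>i<N. w y i * F (g i))] (mod int p)"
        if F: "\<And>x y. x \<in> carrier G \<Longrightarrow> y \<in> carrier G \<Longrightarrow> [F (x \<otimes> y) = F x + F y] (mod int p)"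
          and Fz: "\<And>z. z \<in> center G \<Longrightarrow> [F z = 0] (mod int p)" and y: "y \<in> carrier G" for F y
      proof (rule additive_mod_expand[OF p0 w_add _ g wg F y])
        fix x assume "x \<in> carrier G" "\<And>k. k < N \<Longrightarrow> [w x k = 0] (mod int p)"
        then show "[F x = 0] (mod int p)" by (intro Fz w_ker) (auto simp: cong_0_iff)
      qed
      obtain h where h: "h \<in> carrier G" "\<And>i. i < N \<Longrightarrow> [w h i = x i] (mod int p)"
        using w_surj[of x] by blast
      have "h \<notin> center G"
        using x h(2) w_center[of h] cong_dvd_iff by blast
      obtain k0 where k0: "k0 < m" "\<not> int p dvd l k0" using l by blast
      \<comment> \<open>\<open>\<psi> u\<close> is congruent to \<open>l k0\<close>, which
        \<open>p\<close> does not divide, and \<open>u\<close> will be a commutator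
        \<open>[h, y]\<close>. If \<open>x\<close>, the coordinates of \<open>h\<close>, were in the
        radical, \<open>\<psi>\<close> would vanish modulo \<open>p\<close> at all
        \<open>[h, g j]\<close> and hence at \<open>[h, y]\<close>.\<close>
      obtain u where u: "u \<in> derived G (carrier G)"
        "\<And>k. k < m \<Longrightarrow> [c u k = (if k = k0 then 1 else 0)] (mod int p)"
        using c_surj[of "\<lambda>k. if k = k0 then 1 else 0"] by blast
      obtain y where y: "y \<in> carrier G" "commutator h y = u"
        using commutator_surj[of h u] h \<open>h \<notin> center G\<close> u by blast
      have "[\<psi> u = (\<Sum>k<m. l k * (if k = k0 then 1 else 0))] (mod int p)"
        unfolding \<psi>_def using u(2) by (intro cong_sum cong_scalar_left) simp
      then have \<psi>u: "[\<psi> u = l k0] (mod int p)"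
        using k0(1) by (simp add: if_distrib[of "\<lambda>t. _ * t"] cong: if_cong)
      have central_one: "commutator s t = \<one>" "commutator t s = \<one>"
        if "s \<in> center G" "t \<in> carrier G" for s t
        using that center_carrier[OF that(1)] center_commute[OF that]
        by (simp_all add: commutator_eq_one_iff)
      have hg: "[\<psi> (commutator h (g j)) = 0] (mod int p)" if j: "j < N" for j
      proof -
        have "[\<psi> (commutator h (g j)) = (\<Sum>i<N. w h i * \<psi> (commutator (g i) (g j)))] (mod int p)"
        proof (rule expand)
          show "[\<psi> (commutator (x \<otimes> y) (g j)) = \<psi> (commutator x (g j)) + \<psi> (commutator y (g j))] (mod int p)"
            if "x \<in> carrier G" "y \<in> carrier G" for x y
            unfolding commutator_mult[OF that g] using that g by (intro \<psi>_add D)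
          show "[\<psi> (commutator z (g j)) = 0] (mod int p)" if "z \<in> center G" for z
            using central_one(1)[OF that g] \<psi>_one by simp
        qed (rule h(1))
        also have "[(\<Sum>i<N. w h i * \<psi> (commutator (g i) (g j))) =
            (\<Sum>i<N. x i * (\<Sum>k<m. l k * a i j k))] (mod int p)"
        proof (intro cong_sum cong_mult)
          show "[w h i = x i] (mod int p)" if "i \<in> {..<N}" for i using h(2) that by simp
          show "[\<psi> (commutator (g i) (g j)) = (\<Sum>k<m. l k * a i j k)] (mod int p)" for i
            unfolding \<psi>_def b_def[symmetric] using ab
            by (intro cong_sum cong_scalar_left) (simp add: cong_sym)
        qed
        also have "[(\<Sum>i<N. x i * (\<Sum>k<m. l k * a i j k)) = 0] (mod int p)"
          using not j by (auto simp: cong_0_iff)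
        finally show ?thesis .
      qed
      have "[\<psi> (commutator h y) = (\<Sum>j<N. w y j * \<psi> (commutator h (g j)))] (mod int p)"
      proof (rule expand)
        show "[\<psi> (commutator h (x \<otimes> y)) = \<psi> (commutator h x) + \<psi> (commutator h y)] (mod int p)"
          if "x \<in> carrier G" "y \<in> carrier G" for x y
          unfolding commutator_mult_right[OF that h(1)] using that h(1) by (intro \<psi>_add D)
        show "[\<psi> (commutator h z) = 0] (mod int p)" if "z \<in> center G" for z
          using central_one(2)[OF that h(1)] \<psi>_one by simp
      qed (rule y(1))
      also have "[(\<Sum>j<N. w y j * \<psi> (commutator h (g j))) = (\<Sum>j<N. w y j * 0)] (mod int p)"
        using hg by (intro cong_sum cong_scalar_left) simp
      finally have "[\<psi> u = 0] (mod int p)" using y(2) by simp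
      then have "[l k0 = 0] (mod int p)" using \<psi>u cong_sym cong_trans by blast
      then show False using k0(2) by (simp add: cong_0_iff)
    qed
  qed
  then show ?thesis by (rule alternating_forms.dimension_bound)
qed

text \<open>The quotient by the center and the derived subgroup both receive coordinates modulo
  \<open>p\<close>, which makes their orders powers of \<open>p\<close> and brings the dimension
  bound into play.\<close>

theorem vanishing_structure:
  obtains p m n :: nat where "Factorial_Ring.prime p" "0 < m" "m \<le> n"
    "\<And>x. x \<in> carrier G \<Longrightarrow> x [^] p \<in> center G"
    "\<And>u. u \<in> derived G (carrier G) \<Longrightarrow> u [^] p = \<one>"
    "card (carrier G) = card (center G) * p ^ (2 * n)"
    "card (derived G (carrier G)) = p ^ m"
    "\<And>d \<rho>. irreducible_representation G d \<rho> \<Longrightarrow> 1 < d \<Longrightarrow> d = p ^ n"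
proof -
  let ?U = "derived G (carrier G)"
  obtain p :: nat where p: "Factorial_Ring.prime p"
    and der_exp: "\<And>u. u \<in> ?U \<Longrightarrow> u [^] p = \<one>"
    and cen_exp: "\<And>x. x \<in> carrier G \<Longrightarrow> x [^] p \<in> center G"
    using prime_exponent by metis
  have p1: "1 < p" using p by (rule prime_gt_1_nat)
  interpret Z: normal "center G" G by (rule center_normal)
  define P where "P = G Mod center G"
  have P_carrier: "carrier P = (\<lambda>x. center G #> x) ` carrier G"
    by (simp add: P_def carrier_FactGroup)
  have coset_mult: "(center G #> x) \<otimes>\<^bsub>P\<^esub> (center G #> y) = center G #> (x \<otimes> y)"
    if "x \<in> carrier G" "y \<in> carrier G" for x y
    using that by (simp add: P_def Z.rcos_sum)
  have coset_one: "center G #> x = \<one>\<^bsub>P\<^esub> \<longleftrightarrow> x \<in> center G" if "x \<in> carrier G" for x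
    using that coset_join1[OF _ that center_subgroup] coset_join2[OF that center_subgroup]
    by (auto simp: P_def)
  interpret P: comm_group P
    unfolding P_def using commutator_central by (intro comm_group_FactGroup center_normal)
  have "a [^]\<^bsub>P\<^esub> p = \<one>\<^bsub>P\<^esub>" if "a \<in> carrier P" for a
  proof -
    from that have "a \<in> (\<lambda>x. center G #> x) ` carrier G" unfolding P_carrier .
    then obtain x where x: "a = center G #> x" "x \<in> carrier G" by (rule imageE)
    then have "a [^]\<^bsub>P\<^esub> p = center G #> (x [^] p)" by (simp add: P_def Z.FactGroup_pow)
    also have "\<dots> = \<one>\<^bsub>P\<^esub>" using x cen_exp[of x] coset_one[of "x [^] p"] by simp
    finally show ?thesis .
  qed
  moreover have "finite (carrier P)" using finite_carrier by (simp add: P_carrier)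
  ultimately obtain N f where f: "linear_coordinates p P (carrier P) N f"
    using P.linear_coordinates_exist[OF p] by blast
  define w where "w x = f (center G #> x)" for x
  have "comm_group (G\<lparr>carrier := ?U\<rparr>)"
  proof (rule group.group_comm_groupI)
    show "group (G\<lparr>carrier := ?U\<rparr>)"
      by (rule subgroup_imp_group) (rule derived_is_subgroup, simp)
    fix u v assume "u \<in> carrier (G\<lparr>carrier := ?U\<rparr>)" "v \<in> carrier (G\<lparr>carrier := ?U\<rparr>)"
    then show "u \<otimes>\<^bsub>G\<lparr>carrier := ?U\<rparr>\<^esub> v = v \<otimes>\<^bsub>G\<lparr>carrier := ?U\<rparr>\<^esub> u"
      using derived_central derived_carrier[of v] center_commute[of u v] by auto
  qed
  moreover have "finite ?U"
    using finite_carrier derived_in_carrier[of "carrier G"] by (auto intro: finite_subset)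
  moreover have "u [^]\<^bsub>G\<lparr>carrier := ?U\<rparr>\<^esub> p = \<one>\<^bsub>G\<lparr>carrier := ?U\<rparr>\<^esub>" if "u \<in> ?U" for u
    using der_exp[OF that] by (simp flip: nat_pow_consistent)
  ultimately obtain m c where c: "linear_coordinates p (G\<lparr>carrier := ?U\<rparr>) ?U m c"
    using comm_group.linear_coordinates_exist[of "G\<lparr>carrier := ?U\<rparr>" p] p by auto
  obtain d \<rho> where d: "irreducible_representation G d \<rho>" "1 < d"
    using nonlinear_irreducible_exists[OF nonabelian] by blast
  have "center G \<noteq> {}" using subgroup.one_closed[OF center_subgroup] by blast
  then have cen_pos: "0 < card (center G)"
    using finite_subset[OF Z.subset finite_carrier] by (simp add: card_gt_0_iff)
  \<comment> \<open>Lagrange's theorem and the degree formula give \<open>p^N = d^2\<close>, so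
    \<open>d\<close> is a power of \<open>p\<close> and \<open>N\<close> is even.\<close>
  have "card (carrier P) * card (center G) = card (carrier G)"
    using lagrange[OF center_subgroup] by (simp add: P_def FactGroup_def Coset.order_def)
  then have "p ^ N * card (center G) = d\<^sup>2 * card (center G)"
    using f degree_square[OF d] by (simp add: linear_coordinates_def mult.commute)
  then have pN: "p ^ N = d\<^sup>2" using cen_pos by simp
  then have "d dvd p ^ N" by (simp add: power2_eq_square)
  then obtain n where n: "d = p ^ n" using p by (auto simp: divides_primepow_nat)
  have "p ^ N = p ^ (2 * n)" using pN by (simp add: n power_mult[symmetric] mult.commute)
  then have N: "N = 2 * n" using p1 by (simp add: power_inject_exp)
  have n0: "0 < n" using d(2) n by (cases n) auto
  have "m \<le> n"
  proof (rule derived_rank_le[OF p n0 N])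
    show "[w (x \<otimes> y) k = w x k + w y k] (mod int p)"
      if "x \<in> carrier G" "y \<in> carrier G" "k < N" for x y k
    proof -
      have "center G #> x \<in> carrier P" "center G #> y \<in> carrier P" using that by (auto simp: P_carrier)
      then show ?thesis
        using f that by (simp add: w_def linear_coordinates_def flip: coset_mult)
    qed
    show "x \<in> center G" if "x \<in> carrier G" "\<And>k. k < N \<Longrightarrow> int p dvd w x k" for x
    proof -
      have "center G #> x \<in> carrier P" using that by (auto simp: P_carrier)
      then have "center G #> x = \<one>\<^bsub>P\<^esub>"
        using f that(2) by (simp add: w_def linear_coordinates_def)
      then show ?thesis using coset_one[OF that(1)] by simp
    qed
    show "int p dvd w z k" if "z \<in> center G" "k < N" for z k
    proof -
      have "center G #> z = \<one>\<^bsub>P\<^esub>" using coset_one[OF center_carrier[OF that(1)]] that by simp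
      moreover have "[f (\<one>\<^bsub>P\<^esub> \<otimes>\<^bsub>P\<^esub> \<one>\<^bsub>P\<^esub>) k = f \<one>\<^bsub>P\<^esub> k + f \<one>\<^bsub>P\<^esub> k] (mod int p)"
        using f that(2) P.one_closed unfolding linear_coordinates_def by blast
      ultimately show ?thesis by (simp add: w_def cong_iff_dvd_diff)
    qed
    show "\<exists>x\<in>carrier G. \<forall>k<N. [w x k = v k] (mod int p)" for v
    proof -
      obtain a where "a \<in> carrier P" "\<forall>k<N. [f a k = v k] (mod int p)"
        using f unfolding linear_coordinates_def by blast
      then show ?thesis by (auto simp: P_carrier w_def)
    qed
    show "[c (u \<otimes> v) k = c u k + c v k] (mod int p)" if "u \<in> ?U" "v \<in> ?U" "k < m" for u v k
      using c that by (simp add: linear_coordinates_def)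
    show "\<exists>u\<in>?U. \<forall>k<m. [c u k = v k] (mod int p)" for v
      using c unfolding linear_coordinates_def by blast
  qed
  moreover have card_U: "card ?U = p ^ m" using c by (simp add: linear_coordinates_def)
  moreover have "0 < m"
  proof (rule ccontr)
    assume "\<not> 0 < m"
    then obtain u where "?U = {u}" using card_U by (auto simp: card_1_singleton_iff)
    moreover have "\<one> \<in> ?U" by (rule subgroup.one_closed) (rule derived_is_subgroup, simp)
    ultimately show False using derived_nontrivial by auto
  qed
  moreover have "card (carrier G) = card (center G) * p ^ (2 * n)"
    using degree_square[OF d] by (simp add: n power_mult[symmetric] mult.commute)
  \<comment> \<open>All nonlinear degrees agree, since the square of each is the index of the
    center.\<close>
  moreover have "e = p ^ n" if "irreducible_representation G e \<sigma>" "1 < e" for e \<sigma>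
    using degree_square[OF that] degree_square[OF d] cen_pos n by simp
  ultimately show ?thesis using that[of p m n] p cen_exp der_exp by metis
qed

end

section \<open>The quotient by the second term of the vanishing series\<close>

context finite_group
begin

lemma char_degree_irreducible:
  "irreducible_representation G n \<rho> \<Longrightarrow> char_degree G (\<lambda>g\<in>carrier G. mat_trace (\<rho> g)) = n"
  by (rule char_degree_eq[OF is_group irreducible_rep])

lemma nl_iff:
  "\<chi> \<in> nl G \<longleftrightarrow> (\<exists>n \<rho>. irreducible_representation G n \<rho> \<and> 1 < n \<and> \<chi> = (\<lambda>g\<in>carrier G. mat_trace (\<rho> g)))"
  using char_degree_irreducible unfolding nl_def Irr_def by blast

lemma cd_iff: "d \<in> cd G \<longleftrightarrow> (\<exists>\<rho>. irreducible_representation G d \<rho>)"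
  using char_degree_irreducible unfolding cd_def Irr_def by force

text \<open>Supplies the degree \<open>1\<close> in \<open>cd\<close>; any nonzero vector of a
  one-dimensional space spans it.\<close>

lemma trivial_irreducible: "irreducible_representation G 1 (\<lambda>_. 1\<^sub>m 1)"
proof -
  have "representation G 1 (\<lambda>_. 1\<^sub>m 1)"
    by (simp add: representation_iff[OF is_group])
  moreover have "W = {0\<^sub>v 1} \<or> W = carrier_vec 1"
    if W: "VectorSpace.subspace class_ring W (module_vec TYPE(complex) 1)" for W
  proof (rule disjCI)
    assume ne: "W \<noteq> carrier_vec 1"
    have "w = 0\<^sub>v 1" if w: "w \<in> W" for w
    proof (rule ccontr)
      assume w0: "w \<noteq> 0\<^sub>v 1"
      have wc: "w \<in> carrier_vec 1" using W w by (auto simp: subspace_iff)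
      have "w $ 0 \<noteq> 0"
      proof
        assume "w $ 0 = 0"
        then have "w = 0\<^sub>v 1" using wc by (intro eq_vecI) auto
        then show False using w0 by simp
      qed
      then have "v = (v $ 0 / w $ 0) \<cdot>\<^sub>v w" if "v \<in> carrier_vec 1" for v
        using wc that by (intro eq_vecI) auto
      moreover have "(v $ 0 / w $ 0) \<cdot>\<^sub>v w \<in> W" for v
        using W w by (simp add: subspace_iff)
      ultimately have "carrier_vec 1 \<subseteq> W" by (metis subsetI)
      then show False using ne W by (auto simp: subspace_iff)
    qed
    then show "W = {0\<^sub>v 1}" using W by (auto simp: subspace_iff)
  qed
  ultimately show ?thesis by (simp add: irreducible_representation_def)
qed

definition nonvanishing :: "'a set" where
  "nonvanishing = {g \<in> carrier G. \<exists>\<chi>\<in>nl G. \<chi> g \<noteq> 0}"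

lemma nonvanishing_iff:
  "g \<in> nonvanishing \<longleftrightarrow>
     g \<in> carrier G \<and> (\<exists>n \<rho>. irreducible_representation G n \<rho> \<and> 1 < n \<and> mat_trace (\<rho> g) \<noteq> 0)"
    (is "_ \<longleftrightarrow> ?R")
proof
  assume "g \<in> nonvanishing"
  then obtain \<chi> where g: "g \<in> carrier G" and \<chi>: "\<chi> \<in> nl G" "\<chi> g \<noteq> 0"
    unfolding nonvanishing_def by blast
  obtain n \<rho> where "irreducible_representation G n \<rho>" "1 < n" "\<chi> = (\<lambda>g\<in>carrier G. mat_trace (\<rho> g))"
    using \<chi>(1) unfolding nl_iff by blast
  moreover from this have "mat_trace (\<rho> g) \<noteq> 0" using \<chi>(2) g by simp
  ultimately show ?R using g by blast
next
  assume ?R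
  then obtain n \<rho> where g: "g \<in> carrier G"
    and \<rho>: "irreducible_representation G n \<rho>" "1 < n" "mat_trace (\<rho> g) \<noteq> 0" by blast
  then have "(\<lambda>g\<in>carrier G. mat_trace (\<rho> g)) \<in> nl G" unfolding nl_iff by blast
  moreover have "(\<lambda>g\<in>carrier G. mat_trace (\<rho> g)) g \<noteq> 0" using g \<rho> by simp
  ultimately show "g \<in> nonvanishing" using g unfolding nonvanishing_def by blast
qed

lemma V_eq: "V G = generate G nonvanishing"
  by (simp add: V_def nonvanishing_def)

text \<open>Characters are constant on conjugacy classes, so the generating set is closed under
  conjugation.\<close>

lemma V_normal: "V G \<lhd> G"
  unfolding V_eq
proof (rule normal_generateI)
  show "nonvanishing \<subseteq> carrier G" by (auto simp: nonvanishing_def)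
  fix h g assume h: "h \<in> nonvanishing" and g: "g \<in> carrier G"
  obtain n \<rho> where irr: "irreducible_representation G n \<rho>" "1 < n" and tr: "mat_trace (\<rho> h) \<noteq> 0"
    and hc: "h \<in> carrier G"
    using h by (auto simp: nonvanishing_iff)
  note \<rho> = irreducible_rep[OF irr(1)]
  have "mat_trace (\<rho> (g \<otimes> h \<otimes> inv g)) = mat_trace (\<rho> (g \<otimes> h) * \<rho> (inv g))"
    using g hc by (simp add: rep_mult[OF \<rho>])
  also have "\<dots> = mat_trace (\<rho> (inv g) * \<rho> (g \<otimes> h))"
    using g hc by (intro mat_trace_comm[of _ n n] rep_carrier[OF \<rho>]) auto
  also have "\<dots> = mat_trace (\<rho> (inv g \<otimes> (g \<otimes> h)))"
    using g hc by (simp add: rep_mult[OF \<rho>])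
  also have "inv g \<otimes> (g \<otimes> h) = h"
    using g hc by (simp add: m_assoc[symmetric])
  finally have "mat_trace (\<rho> (g \<otimes> h \<otimes> inv g)) \<noteq> 0" using tr by simp
  moreover have "g \<otimes> h \<otimes> inv g \<in> carrier G" using g hc by simp
  ultimately show "g \<otimes> h \<otimes> inv g \<in> nonvanishing"
    using irr unfolding nonvanishing_iff by blast
qed

lemma commutator_subgroup_eq:
  "commutator_subgroup G H K = generate G (\<Union>h\<in>H. \<Union>k\<in>K. {commutator h k})"
  by (simp add: commutator_subgroup_def commutator_def)

lemma commutator_in_commutator_subgroup:
  "h \<in> H \<Longrightarrow> k \<in> K \<Longrightarrow> commutator h k \<in> commutator_subgroup G H K"
  unfolding commutator_subgroup_eq by (rule generate.incl) blast

text \<open>A conjugate of a commutator is the commutator of the conjugates, and \<open>H\<close> is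
  closed under conjugation.\<close>

lemma commutator_subgroup_normal:
  assumes H: "H \<lhd> G"
  shows "commutator_subgroup G H (carrier G) \<lhd> G"
  unfolding commutator_subgroup_eq
proof (rule normal_generateI)
  interpret H: normal H G by fact
  show "(\<Union>h\<in>H. \<Union>k\<in>carrier G. {commutator h k}) \<subseteq> carrier G" by auto
  fix c g assume "c \<in> (\<Union>h\<in>H. \<Union>k\<in>carrier G. {commutator h k})" and g: "g \<in> carrier G"
  then obtain h k where h: "h \<in> H" "k \<in> carrier G" "c = commutator h k" by auto
  have hc: "h \<in> carrier G" using h by auto
  have cancel: "inv g \<otimes> (g \<otimes> y) = y" if "y \<in> carrier G" for y
    using that g by (simp add: m_assoc[symmetric])
  have "g \<otimes> c \<otimes> inv g = commutator (g \<otimes> h \<otimes> inv g) (g \<otimes> k \<otimes> inv g)"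
    using g hc h by (simp add: commutator_def m_assoc inv_mult_group cancel)
  then show "g \<otimes> c \<otimes> inv g \<in> (\<Union>h\<in>H. \<Union>k\<in>carrier G. {commutator h k})"
    using H.inv_op_closed2[OF g h(1)] g h by auto
qed

lemma commutator_subgroup_incl:
  assumes H: "H \<lhd> G"
  shows "commutator_subgroup G H (carrier G) \<subseteq> H"
  unfolding commutator_subgroup_eq
proof (rule generate_subgroup_incl)
  interpret H: normal H G by fact
  show "subgroup H G" by (rule H.subgroup_axioms)
  show "(\<Union>h\<in>H. \<Union>k\<in>carrier G. {commutator h k}) \<subseteq> H"
  proof clarify
    fix h k assume h: "h \<in> H" "k \<in> carrier G"
    then have "h \<otimes> (k \<otimes> inv h \<otimes> inv k) \<in> H"
      by (intro H.m_closed H.inv_op_closed2) auto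
    then show "commutator h k \<in> H" using h by (simp add: commutator_def m_assoc)
  qed
qed

lemma quotient_finite_group:
  assumes "N \<lhd> G"
  shows "finite_group (G Mod N)"
proof -
  interpret N: normal N G by fact
  interpret Q: group "G Mod N" by (rule N.factorgroup_is_group)
  show ?thesis
    by unfold_locales (simp add: carrier_FactGroup finite_carrier)
qed

text \<open>The group and its quotient act through the same matrices, so they have the same
  invariant subspaces.\<close>

lemma inflate_irreducible:
  assumes N: "N \<lhd> G" and irr: "irreducible_representation (G Mod N) n \<sigma>"
  shows "irreducible_representation G n (\<lambda>g. \<sigma> (N #> g))"
proof -
  interpret N: normal N G by fact
  interpret Q: group "G Mod N" by (rule N.factorgroup_is_group)
  have \<sigma>: "representation (G Mod N) n \<sigma>" using irr by (simp add: irreducible_representation_def)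
  have coset: "N #> g \<in> carrier (G Mod N)" if "g \<in> carrier G" for g
    using that by (auto simp: carrier_FactGroup)
  have "representation G n (\<lambda>g. \<sigma> (N #> g))"
    unfolding representation_iff[OF is_group]
  proof (intro conjI ballI)
    note \<sigma>' = \<sigma>[unfolded representation_iff[OF Q.is_group]]
    show "\<sigma> (N #> g) \<in> carrier_mat n n" if "g \<in> carrier G" for g
      using \<sigma>' coset[OF that] by blast
    show "\<sigma> (N #> (g \<otimes> h)) = \<sigma> (N #> g) * \<sigma> (N #> h)" if "g \<in> carrier G" "h \<in> carrier G" for g h
      using \<sigma>' coset[OF that(1)] coset[OF that(2)] N.rcos_sum[OF that] by (metis mult_FactGroup)
    have "N #> \<one> = N" by (simp add: N.subset)
    then show "\<sigma> (N #> \<one>) = 1\<^sub>m n" using \<sigma>' by simp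
  qed
  moreover have "W = {0\<^sub>v n} \<or> W = carrier_vec n"
    if W: "VectorSpace.subspace class_ring W (module_vec TYPE(complex) n)"
      and inv: "\<forall>g\<in>carrier G. \<forall>w\<in>W. \<sigma> (N #> g) *\<^sub>v w \<in> W" for W
  proof -
    have "\<forall>q\<in>carrier (G Mod N). \<forall>w\<in>W. \<sigma> q *\<^sub>v w \<in> W"
      using inv by (auto simp: carrier_FactGroup)
    then show ?thesis using irr W unfolding irreducible_representation_def by blast
  qed
  ultimately show ?thesis
    using irr unfolding irreducible_representation_def by blast
qed

end

section \<open>The theorem for the quotient by \<open>V2\<close>\<close>

text \<open>The groups \<open>V1 / V2\<close> and \<open>G' / V2\<close> are formed from the record
  \<open>G\<close> with its carrier restricted to the subgroup, and indices are numbers of cosets.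
  By \<open>lower_central_2\<close> the derived subgroup is
  \<open>lower_central G 2\<close>.\<close>

theorem lemma4p3:
  fixes G :: "('a, 'b) monoid_scheme"
  assumes "group G" and "finite (carrier G)" and "\<not> comm_group G"
    and "V_series G 2 \<subset> derived G (carrier G)"
  shows "VZ_group (G Mod V_series G 2) \<and>
    V (G Mod V_series G 2) = carrier (G\<lparr>carrier := V_series G 1\<rparr> Mod V_series G 2) \<and>
    (\<exists>p m n :: nat. Factorial_Ring.prime p \<and> 0 < m \<and> m \<le> n \<and>
       elementary_abelian p (G Mod V_series G 1) \<and>
       elementary_abelian p (G\<lparr>carrier := derived G (carrier G)\<rparr> Mod V_series G 2) \<and>
       card (rcosets\<^bsub>G\<^esub> V_series G 1) = p ^ (2 * n) \<and>
       card (rcosets\<^bsub>G\<lparr>carrier := derived G (carrier G)\<rparr>\<^esub> V_series G 2) = p ^ m \<and>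
       cd (G Mod V_series G 2) = {1, p ^ n})"
proof -
  interpret G: finite_group G
    using assms(1,2) by (simp add: finite_group_def finite_group_axioms_def)
  define D where "D = derived G (carrier G)"
  define V1 where "V1 = V_series G 1"
  define V2 where "V2 = V_series G 2"
  have V1: "V1 = V G" unfolding V1_def by (rule V_series_1)
  have V2: "V2 = commutator_subgroup G V1 (carrier G)"
    unfolding V2_def V1_def using V_series_step[of 2 G] by simp
  have V2_less: "V2 \<subset> D" using assms(4) by (simp add: V2_def D_def)
  interpret V1: normal V1 G unfolding V1 by (rule G.V_normal)
  interpret V2: normal V2 G unfolding V2 by (rule G.commutator_subgroup_normal) (rule V1.normal_axioms)
  have V2_V1: "V2 \<subseteq> V1"
    unfolding V2 by (rule G.commutator_subgroup_incl) (rule V1.normal_axioms)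
  have D_sub: "subgroup D G" unfolding D_def by (rule G.derived_is_subgroup) simp
  define Q where "Q = G Mod V2"
  define \<pi> where "\<pi> x = V2 #>\<^bsub>G\<^esub> x" for x
  interpret Q: finite_group Q
    unfolding Q_def by (rule G.quotient_finite_group) (rule V2.normal_axioms)
  interpret \<pi>: group_hom G Q \<pi>
    by unfold_locales (use V2.r_coset_hom_Mod in \<open>simp add: Q_def \<pi>_def[abs_def]\<close>)
  have Q_carrier: "carrier Q = \<pi> ` carrier G"
    by (simp add: Q_def \<pi>_def[abs_def] carrier_FactGroup)
  have \<pi>_one: "\<pi> x = \<one>\<^bsub>Q\<^esub> \<longleftrightarrow> x \<in> V2" if "x \<in> carrier G" for x
    using that G.coset_join1[OF _ that V2.subgroup_axioms] G.coset_join2[OF that V2.subgroup_axioms]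
    by (auto simp: \<pi>_def Q_def)
  have \<pi>_comm: "\<pi> (G.commutator x y) = Q.commutator (\<pi> x) (\<pi> y)"
    if "x \<in> carrier G" "y \<in> carrier G" for x y
    using that by (simp add: G.commutator_def Q.commutator_def)
  \<comment> \<open>Here the inclusion has to be proper: an abelian quotient would put all
    commutators into \<open>V2\<close>.\<close>
  have Q_nonabelian: "\<not> comm_group Q"
  proof
    assume "comm_group Q"
    then interpret QC: comm_group Q .
    have "G.commutator x y \<in> V2" if xy: "x \<in> carrier G" "y \<in> carrier G" for x y
    proof -
      have "\<pi> (G.commutator x y) = \<one>\<^bsub>Q\<^esub>"
        unfolding \<pi>_comm[OF xy] using xy
        by (subst Q.commutator_eq_one_iff) (auto simp: QC.m_comm)
      then show ?thesis using xy \<pi>_one by simp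
    qed
    then have "D \<subseteq> V2"
      unfolding D_def derived_def G.commutator_def
      by (intro G.generate_subgroup_incl V2.subgroup_axioms) auto
    then show False using V2_less by simp
  qed
  have \<pi>_V1_central: "\<pi> ` V1 \<subseteq> center Q"
  proof
    fix q assume "q \<in> \<pi> ` V1"
    then obtain v where v: "v \<in> V1" "q = \<pi> v" by blast
    have vc: "v \<in> carrier G" using v by auto
    have "q \<otimes>\<^bsub>Q\<^esub> r = r \<otimes>\<^bsub>Q\<^esub> q" if r: "r \<in> carrier Q" for r
    proof -
      obtain k where k: "k \<in> carrier G" "r = \<pi> k" using r unfolding Q_carrier by blast
      have "G.commutator v k \<in> V2"
        unfolding V2 using v k by (intro G.commutator_in_commutator_subgroup) auto
      then have "Q.commutator q r = \<one>\<^bsub>Q\<^esub>"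
        using \<pi>_one[of "G.commutator v k"] \<pi>_comm[OF vc k(1)] vc k v by simp
      then show ?thesis using vc k v by (simp add: Q.commutator_eq_one_iff)
    qed
    moreover have "q \<in> carrier Q" using vc v by simp
    ultimately show "q \<in> center Q" unfolding center_def by blast
  qed
  have nonvanish: "\<pi> g \<in> \<pi> ` V1"
    if "irreducible_representation Q n \<sigma>" "1 < n" "g \<in> carrier G" "mat_trace (\<sigma> (\<pi> g)) \<noteq> 0" for n \<sigma> g
  proof -
    have "irreducible_representation G n (\<lambda>g. \<sigma> (\<pi> g))"
      using G.inflate_irreducible[OF V2.normal_axioms] that(1) by (simp add: Q_def \<pi>_def)
    then have "g \<in> G.nonvanishing"
      using that unfolding G.nonvanishing_iff by blast
    then have "g \<in> V1" unfolding V1 G.V_eq by (rule generate.incl)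
    then show ?thesis by blast
  qed
  interpret Q: vanishing_group Q
  proof
    show "\<not> comm_group Q" by fact
    fix n \<sigma> q assume irr: "irreducible_representation Q n \<sigma>" "1 < n" and q: "q \<in> carrier Q - center Q"
    then obtain g where g: "g \<in> carrier G" "q = \<pi> g" by (auto simp: Q_carrier)
    then show "mat_trace (\<sigma> q) = 0"
      using nonvanish[OF irr g(1)] \<pi>_V1_central q by blast
  qed
  have VQ_sub: "V Q \<subseteq> \<pi> ` V1"
    unfolding Q.V_eq
  proof (rule Q.generate_subgroup_incl)
    show "subgroup (\<pi> ` V1) Q" by (rule \<pi>.subgroup_img_is_subgroup[OF V1.subgroup_axioms])
    show "Q.nonvanishing \<subseteq> \<pi> ` V1"
    proof
      fix q assume "q \<in> Q.nonvanishing"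
      then obtain n \<sigma> g where "irreducible_representation Q n \<sigma>" "1 < n" "g \<in> carrier G"
        "q = \<pi> g" "mat_trace (\<sigma> q) \<noteq> 0"
        unfolding Q.nonvanishing_iff Q_carrier by blast
      then show "q \<in> \<pi> ` V1" using nonvanish by simp
    qed
  qed
  obtain d \<tau> where \<tau>: "irreducible_representation Q d \<tau>" "1 < d"
    using Q.nonlinear_irreducible_exists[OF Q_nonabelian] by blast
  \<comment> \<open>A nonlinear character is nonzero at central elements. This closes the cycle of
    inclusions from the image of \<open>V1\<close> to \<open>center Q\<close>, to \<open>V Q\<close>
    and back to the image of \<open>V1\<close>.\<close>
  have center_VQ: "center Q \<subseteq> V Q"
  proof
    fix z assume z: "z \<in> center Q"
    have "mat_trace (\<tau> z) \<noteq> 0"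
      using Q.central_scalar[OF \<tau>(1) z] \<tau>(2) by auto
    then have "z \<in> Q.nonvanishing"
      using \<tau> Q.center_carrier[OF z] unfolding Q.nonvanishing_iff by blast
    then show "z \<in> V Q" unfolding Q.V_eq by (rule generate.incl)
  qed
  have VQ: "V Q = \<pi> ` V1" and center_Q: "center Q = \<pi> ` V1"
    using VQ_sub center_VQ \<pi>_V1_central by auto
  \<comment> \<open>A coset depends on the multiplication and not on the carrier, so the cosets of
    \<open>V2\<close> in a restricted group are literally cosets in \<open>G\<close>.\<close>
  have restrict_coset: "V2 #>\<^bsub>G\<lparr>carrier := S\<rparr>\<^esub> x = \<pi> x" for S x
    by (simp add: r_coset_def \<pi>_def)
  have restrict_rcosets: "rcosets\<^bsub>G\<lparr>carrier := S\<rparr>\<^esub> V2 = \<pi> ` S" for S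
    unfolding RCOSETS_def restrict_coset by auto
  have derived_Q: "derived Q (carrier Q) = \<pi> ` D"
    unfolding Q_carrier D_def using \<pi>.derived_img[of "carrier G"] by simp
  \<comment> \<open>\<open>V1\<close> contains the kernel \<open>V2\<close>, so it is the full
    preimage of its image, the center of the quotient.\<close>
  have in_V1: "x \<in> V1" if x: "x \<in> carrier G" "\<pi> x \<in> center Q" for x
  proof -
    obtain v where v: "v \<in> V1" "\<pi> x = \<pi> v" using x(2) unfolding center_Q by blast
    have "x \<in> V2 #>\<^bsub>G\<^esub> v"
      using G.rcos_self[OF x(1) V2.subgroup_axioms] v(2) by (simp add: \<pi>_def)
    then obtain u where "u \<in> V2" "x = u \<otimes>\<^bsub>G\<^esub> v" by (auto simp: r_coset_def)
    then show ?thesis using V2_V1 v(1) by blast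
  qed
  have VZ: "VZ_group Q"
    unfolding VZ_group_def
  proof (intro conjI ballI)
    fix \<chi> q assume "\<chi> \<in> nl Q" and q: "q \<in> carrier Q - center Q"
    then show "\<chi> q = 0" unfolding Q.nl_iff using Q.vanishing[OF _ _ q] by auto
  qed (use Q.is_group Q.finite_carrier Q_nonabelian in auto)
  obtain p m n :: nat where p: "Factorial_Ring.prime p" and m: "0 < m" "m \<le> n"
    and cen_exp: "\<And>x. x \<in> carrier Q \<Longrightarrow> x [^]\<^bsub>Q\<^esub> p \<in> center Q"
    and der_exp: "\<And>u. u \<in> derived Q (carrier Q) \<Longrightarrow> u [^]\<^bsub>Q\<^esub> p = \<one>\<^bsub>Q\<^esub>"
    and cardQ: "card (carrier Q) = card (center Q) * p ^ (2 * n)"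
    and cardD: "card (derived Q (carrier Q)) = p ^ m"
    and degree: "\<And>e \<rho>. irreducible_representation Q e \<rho> \<Longrightarrow> 1 < e \<Longrightarrow> e = p ^ n"
    by (rule Q.vanishing_structure) (rule that)
  have \<pi>_pow: "\<pi> (x [^]\<^bsub>G\<^esub> p) = \<pi> x [^]\<^bsub>Q\<^esub> p" if "x \<in> carrier G" for x
    using that by (simp add: \<pi>_def Q_def V2.FactGroup_pow)
  have elem1: "elementary_abelian p (G Mod V1)"
    unfolding elementary_abelian_def
  proof (intro conjI ballI)
    show "comm_group (G Mod V1)"
    proof (rule G.comm_group_FactGroup[OF V1.normal_axioms])
      fix x y assume xy: "x \<in> carrier G" "y \<in> carrier G"
      then have "\<pi> (G.commutator x y) \<in> center Q"
        unfolding \<pi>_comm[OF xy] by (intro Q.commutator_central) auto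
      then show "G.commutator x y \<in> V1" using xy by (intro in_V1) auto
    qed
    fix a assume "a \<in> carrier (G Mod V1)"
    then obtain x where x: "x \<in> carrier G" "a = V1 #>\<^bsub>G\<^esub> x" by (auto simp: carrier_FactGroup)
    have "x [^]\<^bsub>G\<^esub> p \<in> V1"
      using x cen_exp[of "\<pi> x"] by (intro in_V1) (simp_all add: \<pi>_pow)
    then have "V1 #>\<^bsub>G\<^esub> (x [^]\<^bsub>G\<^esub> p) = V1"
      using x by (intro G.coset_join2 V1.subgroup_axioms) auto
    then show "a [^]\<^bsub>G Mod V1\<^esub> p = \<one>\<^bsub>G Mod V1\<^esub>"
      using x by (simp add: V1.FactGroup_pow)
  qed (simp_all add: p carrier_FactGroup G.finite_carrier)
  have D_carrier: "x \<in> carrier G" if "x \<in> D" for x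
    using that G.derived_carrier by (simp add: D_def)
  have D_V1: "D \<subseteq> V1"
    using in_V1 D_carrier derived_Q Q.derived_central by blast
  have elem2: "elementary_abelian p (G\<lparr>carrier := D\<rparr> Mod V2)"
    unfolding elementary_abelian_def
  proof (intro conjI ballI)
    interpret H: group "G\<lparr>carrier := D\<rparr>" using D_sub by (rule G.subgroup_imp_group)
    interpret HV2: normal V2 "G\<lparr>carrier := D\<rparr>"
      using G.normal_restrict_supergroup[OF D_sub V2.normal_axioms] V2_less by simp
    show "comm_group (G\<lparr>carrier := D\<rparr> Mod V2)"
    proof (rule H.comm_group_FactGroup[OF HV2.normal_axioms])
      fix x y assume "x \<in> carrier (G\<lparr>carrier := D\<rparr>)" "y \<in> carrier (G\<lparr>carrier := D\<rparr>)"
      then have xy: "x \<in> D" "y \<in> D" by auto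
      have "H.commutator x y = G.commutator x y"
        unfolding H.commutator_def G.commutator_def
        using xy by (simp add: G.m_inv_consistent[OF D_sub])
      \<comment> \<open>\<open>D\<close> is contained in \<open>V1\<close>, and \<open>V2\<close> is
        generated by the commutators of \<open>V1\<close> with \<open>G\<close>.\<close>
      also have "\<dots> \<in> V2"
        unfolding V2 using xy D_V1 D_carrier by (intro G.commutator_in_commutator_subgroup) auto
      finally show "H.commutator x y \<in> V2" .
    qed
    show "finite (carrier (G\<lparr>carrier := D\<rparr> Mod V2))"
      using finite_subset[OF _ G.finite_carrier, of D] D_carrier by (auto simp: carrier_FactGroup)
    fix a assume "a \<in> carrier (G\<lparr>carrier := D\<rparr> Mod V2)"
    then obtain x where x: "x \<in> D" "a = V2 #>\<^bsub>G\<lparr>carrier := D\<rparr>\<^esub> x" by (auto simp: carrier_FactGroup)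
    have "\<pi> (x [^]\<^bsub>G\<^esub> p) = \<one>\<^bsub>Q\<^esub>"
      using der_exp[of "\<pi> x"] x D_carrier by (simp add: derived_Q \<pi>_pow)
    moreover have "a [^]\<^bsub>G\<lparr>carrier := D\<rparr> Mod V2\<^esub> p = V2 #>\<^bsub>G\<lparr>carrier := D\<rparr>\<^esub> (x [^]\<^bsub>G\<lparr>carrier := D\<rparr>\<^esub> p)"
      unfolding x(2) by (rule HV2.FactGroup_pow) (simp add: x(1))
    ultimately show "a [^]\<^bsub>G\<lparr>carrier := D\<rparr> Mod V2\<^esub> p = \<one>\<^bsub>G\<lparr>carrier := D\<rparr> Mod V2\<^esub>"
      unfolding restrict_coset by (simp add: Q_def flip: G.nat_pow_consistent)
  qed (rule p)
  \<comment> \<open>Lagrange's theorem for \<open>V2\<close> in \<open>V1\<close>, for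
    \<open>V2\<close> in \<open>G\<close> and for \<open>V1\<close> in \<open>G\<close> turns the
    index of \<open>center Q\<close> into the index of \<open>V1\<close>.\<close>
  have index: "card (rcosets\<^bsub>G\<^esub> V1) = p ^ (2 * n)"
  proof -
    have fV: "finite V1" using finite_subset[OF V1.subset G.finite_carrier] .
    have "V1 \<noteq> {}" using subgroup.one_closed[OF V1.subgroup_axioms] by blast
    then have pos: "0 < card V1" using fV by (simp add: card_gt_0_iff)
    interpret H: group "G\<lparr>carrier := V1\<rparr>" using V1.subgroup_axioms by (rule G.subgroup_imp_group)
    have sub: "subgroup V2 (G\<lparr>carrier := V1\<rparr>)"
      using G.subgroup_incl[OF V2.subgroup_axioms V1.subgroup_axioms V2_V1] .
    have "card (\<pi> ` V1) * card V2 = card V1"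
      using H.lagrange[OF sub] by (simp add: restrict_rcosets Coset.order_def)
    moreover have "card (carrier Q) * card V2 = card (carrier G)"
      using G.lagrange[OF V2.subgroup_axioms] by (simp add: Q_def FactGroup_def Coset.order_def)
    moreover have "card (rcosets\<^bsub>G\<^esub> V1) * card V1 = card (carrier G)"
      using G.lagrange[OF V1.subgroup_axioms] by (simp add: Coset.order_def)
    ultimately have "card (rcosets\<^bsub>G\<^esub> V1) * card V1 = p ^ (2 * n) * card V1"
      using cardQ by (metis center_Q mult.assoc mult.commute)
    then show ?thesis using pos by simp
  qed
  have cd: "cd Q = {1, p ^ n}"
  proof (rule Set.set_eqI)
    fix e
    show "e \<in> cd Q \<longleftrightarrow> e \<in> {1, p ^ n}"
    proof
      assume "e \<in> cd Q"
      then obtain \<rho> where \<rho>: "irreducible_representation Q e \<rho>" unfolding Q.cd_iff by blast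
      show "e \<in> {1, p ^ n}"
        using degree[OF \<rho>] Q.irreducible_degree[OF \<rho>] by (cases "1 < e") auto
    next
      assume "e \<in> {1, p ^ n}"
      then show "e \<in> cd Q"
        using Q.trivial_irreducible degree[OF \<tau>] \<tau>(1) unfolding Q.cd_iff by blast
    qed
  qed
  have "V Q = carrier (G\<lparr>carrier := V1\<rparr> Mod V2)"
    unfolding VQ carrier_FactGroup restrict_coset by simp
  moreover have "card (rcosets\<^bsub>G\<lparr>carrier := D\<rparr>\<^esub> V2) = p ^ m"
    using cardD by (simp add: restrict_rcosets derived_Q)
  ultimately show ?thesis
    using VZ p m elem1 elem2 index cd unfolding V1_def V2_def D_def Q_def by blast
qed

end
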